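(* Let $\lambda=(\lambda_n)$ be an arbitrary frequency and $(G,\beta)$ a $\lambda$-Dirichlet group. Then there is an onto (linear) isometry $$\Psi:\mathcal H_\infty^\lambda[\mathrm{Re}>0]\to H_\infty^\lambda(G),\qquad F\mapsto f,$$ which preserves Bohr and Fourier coefficients, i.e. $a_{\lambda_n}(F)=\widehat f(h_{\lambda_n})$ for all $n$.
   Context: A frequency is a strictly increasing, unbounded sequence $\lambda=(\lambda_n)_{n\in\mathbb N}$ of non-negative real numbers. A Dirichlet group $(G,\beta)$ is a compact abelian group $G$ together with a continuous homomorphism $\beta:(\mathbb R,+)\to G$ with dense range; it is a $\lambda$-Dirichlet group if for every $n$ there is a (then unique) character $h_{\lambda_n}\in\widehat G$ with $h_{\lambda_n}(\beta(t))=e^{-i\lambda_nt}$ for all $t\in\mathbb R$. With $m$ the normalized Haar measure and $\widehat f(\gamma)=\int_Gf\,\overline\gamma\,dm$, $H_\infty^\lambda(G)$ is the closed subspace of all $f\in L_\infty(G)$ such that $\widehat f(\gamma)\neq0$ implies $\gamma=h_{\lambda_n}$ for some $n$. Write $[\mathrm{Re}>0]=\{z\in\mathbb C:\mathrm{Re}\,z>0\}$. A continuous function $g:\mathbb R\to\mathbb C$ is uniformly almost periodic if for every $\varepsilon>0$ there is $l>0$ such that every interval $I\subset\mathbb R$ with $|I|=l$ contains some $\tau$ with $\sup_{x\in\mathbb R}|g(x+\tau)-g(x)|<\varepsilon$ (equivalently, $g$ is a uniform limit of trigonometric polynomials $\sum_{n=1}^Na_ne^{-itx_n}$, $x_n\in\mathbb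 R$). For a bounded holomorphic $F:[\mathrm{Re}>0]\to\mathbb C$ and $\sigma>0$ put $F_\sigma(t)=F(\sigma+it)$. If $F_\sigma$ is uniformly almost periodic for some (equivalently all) $\sigma>0$, the Bohr coefficients of $F$ are $a_x(F)=\lim_{T\to\infty}\frac1{2T}\int_{-T}^TF_\sigma(t)e^{(\sigma+it)x}\,dt$ for $x\in\mathbb R$, which do not depend on $\sigma>0$; thus a finite sum $F(z)=\sum a_ne^{-\lambda_nz}$ has Bohr coefficients $a_{\lambda_n}(F)=a_n$. $\mathcal H_\infty^\lambda[\mathrm{Re}>0]$ is the Banach space of all bounded holomorphic $F:[\mathrm{Re}>0]\to\mathbb C$ such that $F_\sigma$ is uniformly almost periodic for all (equivalently some) $\sigma>0$ and $a_x(F)=0$ whenever $x\notin\{\lambda_n:n\in\mathbb N\}$, with norm $\|F\|_\infty=\sup_{\mathrm{Re}\,z>0}|F(z)|$. *)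

theory Defs
  imports "HOL-Probability.Probability"
begin

section \<open>Frequencies and Dirichlet groups\<close>

definition frequency :: "(nat \<Rightarrow> real) \<Rightarrow> bool" where
  "frequency freq \<longleftrightarrow> strict_mono freq \<and> (\<forall>n. 0 \<le> freq n) \<and> \<not> bdd_above (range freq)"

text \<open>Compact groups are Hausdorff by convention, hence the sort \<open>t2_space\<close> below.\<close>

definition group_character :: "('g::{topological_ab_group_add,t2_space} \<Rightarrow> complex) \<Rightarrow> bool" where
  "group_character \<gamma> \<longleftrightarrow> continuous_on UNIV \<gamma> \<and> (\<forall>x. norm (\<gamma> x) = 1)
     \<and> (\<forall>x y. \<gamma> (x + y) = \<gamma> x * \<gamma> y)"

definition dirichlet_group :: "(real \<Rightarrow> 'g::{topological_ab_group_add,t2_space}) \<Rightarrow> bool" where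
  "dirichlet_group \<beta> \<longleftrightarrow> compact (UNIV :: 'g set) \<and> continuous_on UNIV \<beta>
     \<and> (\<forall>s t. \<beta> (s + t) = \<beta> s + \<beta> t) \<and> closure (range \<beta>) = UNIV"

definition extends_frequency ::
  "(real \<Rightarrow> 'g::{topological_ab_group_add,t2_space}) \<Rightarrow> real \<Rightarrow> ('g \<Rightarrow> complex) \<Rightarrow> bool" where
  "extends_frequency \<beta> x h \<longleftrightarrow>
     group_character h \<and> (\<forall>t. h (\<beta> t) = exp (- \<i> * of_real x * of_real t))"

definition freq_dirichlet_group ::
  "(nat \<Rightarrow> real) \<Rightarrow> (real \<Rightarrow> 'g::{topological_ab_group_add,t2_space}) \<Rightarrow> bool" where
  "freq_dirichlet_group freq \<beta> \<longleftrightarrow>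
     dirichlet_group \<beta> \<and> (\<forall>n. \<exists>h. extends_frequency \<beta> (freq n) h)"

text \<open>The character \<open>h\<^sub>x\<close>; it is unique because \<open>\<beta>\<close> has dense range.\<close>

definition freq_char ::
  "(real \<Rightarrow> 'g::{topological_ab_group_add,t2_space}) \<Rightarrow> real \<Rightarrow> 'g \<Rightarrow> complex" where
  "freq_char \<beta> x = (THE h. extends_frequency \<beta> x h)"

lemma freq_char_unique:
  fixes \<beta> :: "real \<Rightarrow> 'g::{topological_ab_group_add,t2_space}"
  assumes "dirichlet_group \<beta>" "extends_frequency \<beta> x h"
  shows "freq_char \<beta> x = h"
  unfolding freq_char_def
proof (rule the_equality, rule assms(2))
  fix k assume k: "extends_frequency \<beta> x k"
  have "closed {y. k y = h y}"
    using k assms(2) unfolding extends_frequency_def group_character_def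
    by (intro closed_Collect_eq) auto
  moreover have "range \<beta> \<subseteq> {y. k y = h y}"
    using k assms(2) unfolding extends_frequency_def by auto
  ultimately have "closure (range \<beta>) \<subseteq> {y. k y = h y}"
    by (rule closure_minimal[rotated])
  then show "k = h"
    using assms(1) unfolding dirichlet_group_def by auto
qed

text \<open>
  Normalized Haar measure on the Borel sets. Regularity is part of the definition, since \<open>G\<close> need
  not be second countable (e.g. the Bohr compactification of the reals).
\<close>

definition normalized_haar_measure ::
  "'g::{topological_ab_group_add,t2_space} measure \<Rightarrow> bool" where
  "normalized_haar_measure m \<longleftrightarrow>
     sets m = sets borel \<and> emeasure m UNIV = 1
     \<and> (\<forall>g. \<forall>A\<in>sets borel. emeasure m ((\<lambda>x. g + x) ` A) = emeasure m A)
     \<and> (\<forall>A\<in>sets borel. emeasure m A = (INF U\<in>{U. A \<subseteq> U \<and> open U}. emeasure m U))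
     \<and> (\<forall>A\<in>sets borel. emeasure m A = (SUP K\<in>{K. K \<subseteq> A \<and> compact K}. emeasure m K))"


section \<open>The space of essentially bounded functions\<close>

text \<open>
  Elements of \<open>L\<^sub>\<infinity>\<close> are the classes of essentially bounded measurable functions modulo equality
  almost everywhere.
\<close>

definition linf_fun :: "'a measure \<Rightarrow> ('a \<Rightarrow> complex) set" where
  "linf_fun m = {f \<in> borel_measurable m. esssup m (\<lambda>x. ereal (norm (f x))) < \<infinity>}"

definition linf_rel :: "'a measure \<Rightarrow> (('a \<Rightarrow> complex) \<times> ('a \<Rightarrow> complex)) set" where
  "linf_rel m = {(f, g). f \<in> linf_fun m \<and> g \<in> linf_fun m \<and> (AE x in m. f x = g x)}"

definition linf :: "'a measure \<Rightarrow> ('a \<Rightarrow> complex) set set" where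
  "linf m = linf_fun m // linf_rel m"

definition linf_add :: "'a measure \<Rightarrow> ('a \<Rightarrow> complex) set \<Rightarrow> ('a \<Rightarrow> complex) set \<Rightarrow> ('a \<Rightarrow> complex) set"
  where "linf_add m A B = (\<Union>f\<in>A. \<Union>g\<in>B. linf_rel m `` {\<lambda>x. f x + g x})"

definition linf_scale :: "'a measure \<Rightarrow> complex \<Rightarrow> ('a \<Rightarrow> complex) set \<Rightarrow> ('a \<Rightarrow> complex) set" where
  "linf_scale m c A = (\<Union>f\<in>A. linf_rel m `` {\<lambda>x. c * f x})"

definition linf_norm :: "'a measure \<Rightarrow> ('a \<Rightarrow> complex) set \<Rightarrow> real" where
  "linf_norm m A = the_elem ((\<lambda>f. real_of_ereal (esssup m (\<lambda>x. ereal (norm (f x))))) ` A)"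

definition fourier_coeff :: "'a measure \<Rightarrow> ('a \<Rightarrow> complex) set \<Rightarrow> ('a \<Rightarrow> complex) \<Rightarrow> complex" where
  "fourier_coeff m A \<gamma> = the_elem ((\<lambda>f. \<integral>x. f x * cnj (\<gamma> x) \<partial>m) ` A)"

text \<open>\<open>H\<^sub>\<infinity>\<^sup>\<lambda>(G)\<close>\<close>

definition hardy_inf_group :: "(nat \<Rightarrow> real) \<Rightarrow> (real \<Rightarrow> 'g::{topological_ab_group_add,t2_space})
    \<Rightarrow> 'g measure \<Rightarrow> ('g \<Rightarrow> complex) set set" where
  "hardy_inf_group freq \<beta> m = {A \<in> linf m. \<forall>\<gamma>. group_character \<gamma> \<longrightarrow>
     fourier_coeff m A \<gamma> \<noteq> 0 \<longrightarrow> (\<exists>n. \<gamma> = freq_char \<beta> (freq n))}"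

text \<open>The operations on classes are computed on representatives.\<close>

lemma equiv_linf_rel: "equiv (linf_fun m) (linf_rel m)"
proof (rule equivI)
  show "linf_rel m \<subseteq> linf_fun m \<times> linf_fun m" by (auto simp: linf_rel_def)
  show "refl_on (linf_fun m) (linf_rel m)" by (auto simp: refl_on_def linf_rel_def)
  show "sym (linf_rel m)" by (auto simp: sym_def linf_rel_def eq_commute)
  show "trans (linf_rel m)"
  proof (rule transI)
    fix f g h assume *: "(f, g) \<in> linf_rel m" "(g, h) \<in> linf_rel m"
    then have "AE x in m. f x = g x" "AE x in m. g x = h x" by (simp_all add: linf_rel_def)
    then have "AE x in m. f x = h x" by eventually_elim simp
    with * show "(f, h) \<in> linf_rel m" by (simp add: linf_rel_def)
  qed
qed

lemma linf_norm_class: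
  assumes "f \<in> linf_fun m"
  shows "linf_norm m (linf_rel m `` {f}) = real_of_ereal (esssup m (\<lambda>x. ereal (norm (f x))))"
proof -
  let ?F = "\<lambda>f. real_of_ereal (esssup m (\<lambda>x. ereal (norm (f x))))"
  have "?F g = ?F f" if "g \<in> linf_rel m `` {f}" for g
  proof -
    have "esssup m (\<lambda>x. ereal (norm (g x))) = esssup m (\<lambda>x. ereal (norm (f x)))"
      using that by (intro esssup_AE_cong) (auto simp: linf_rel_def linf_fun_def)
    then show ?thesis by simp
  qed
  moreover have "f \<in> linf_rel m `` {f}" using assms by (auto simp: linf_rel_def)
  ultimately have "?F ` (linf_rel m `` {f}) = {?F f}" by blast
  then show ?thesis by (simp add: linf_norm_def)
qed

lemma fourier_coeff_class:
  assumes "f \<in> linf_fun m" "\<gamma> \<in> borel_measurable m"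
  shows "fourier_coeff m (linf_rel m `` {f}) \<gamma> = (\<integral>x. f x * cnj (\<gamma> x) \<partial>m)"
proof -
  let ?F = "\<lambda>f. \<integral>x. f x * cnj (\<gamma> x) \<partial>m"
  have [measurable]: "(\<lambda>x. cnj (\<gamma> x)) \<in> borel_measurable m"
    using assms(2) by (rule measurable_compose)
      (intro borel_measurable_continuous_onI continuous_intros)
  have "?F g = ?F f" if "g \<in> linf_rel m `` {f}" for g
    using that by (intro integral_cong_AE) (auto simp: linf_rel_def linf_fun_def)
  moreover have "f \<in> linf_rel m `` {f}" using assms by (auto simp: linf_rel_def)
  ultimately have "?F ` (linf_rel m `` {f}) = {?F f}" by blast
  then show ?thesis by (simp add: fourier_coeff_def)
qed

lemma linf_fun_add:
  assumes "f \<in> linf_fun m" "g \<in> linf_fun m"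
  shows "(\<lambda>x. f x + g x) \<in> linf_fun m"
proof -
  have [measurable]: "f \<in> borel_measurable m" "g \<in> borel_measurable m"
    using assms by (auto simp: linf_fun_def)
  have "esssup m (\<lambda>x. ereal (norm (f x + g x))) \<le> esssup m (\<lambda>x. ereal (norm (f x)) + ereal (norm (g x)))"
    by (intro esssup_mono) (auto intro: norm_triangle_ineq)
  also have "\<dots> \<le> esssup m (\<lambda>x. ereal (norm (f x))) + esssup m (\<lambda>x. ereal (norm (g x)))"
    by (rule esssup_add)
  also have "\<dots> < \<infinity>" using assms by (auto simp: linf_fun_def)
  finally show ?thesis by (simp add: linf_fun_def)
qed

lemma linf_fun_scale:
  assumes "f \<in> linf_fun m"
  shows "(\<lambda>x. c * f x) \<in> linf_fun m"
proof -
  have [measurable]: "f \<in> borel_measurable m" using assms by (auto simp: linf_fun_def)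
  have "esssup m (\<lambda>x. ereal (norm (c * f x))) \<le> esssup m (\<lambda>x. ereal (norm c + 1) * ereal (norm (f x)))"
    by (intro esssup_mono) (auto simp: norm_mult intro: mult_right_mono)
  also have "\<dots> = ereal (norm c + 1) * esssup m (\<lambda>x. ereal (norm (f x)))"
    by (rule esssup_cmult) (simp add: add_nonneg_pos)
  also have "\<dots> < \<infinity>" 
    using assms norm_ge_zero[of c] by (auto simp: linf_fun_def simp del: norm_ge_zero)
  finally show ?thesis by (simp add: linf_fun_def)
qed

lemma linf_add_class:
  assumes "f \<in> linf_fun m" "g \<in> linf_fun m"
  shows "linf_add m (linf_rel m `` {f}) (linf_rel m `` {g}) = linf_rel m `` {\<lambda>x. f x + g x}"
  unfolding linf_add_def
proof (rule UN_equiv_class2[OF equiv_linf_rel equiv_linf_rel _ assms])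
  show "congruent2 (linf_rel m) (linf_rel m) (\<lambda>f g. linf_rel m `` {\<lambda>x. f x + g x})"
  proof (rule congruent2I')
    fix f f' g g' assume *: "(f, f') \<in> linf_rel m" "(g, g') \<in> linf_rel m"
    then have "AE x in m. f x = f' x" "AE x in m. g x = g' x" by (simp_all add: linf_rel_def)
    then have "AE x in m. f x + g x = f' x + g' x" by eventually_elim simp
    with * show "linf_rel m `` {\<lambda>x. f x + g x} = linf_rel m `` {\<lambda>x. f' x + g' x}"
      by (intro equiv_class_eq[OF equiv_linf_rel]) (simp add: linf_rel_def linf_fun_add)
  qed
qed

lemma linf_scale_class:
  assumes "f \<in> linf_fun m"
  shows "linf_scale m c (linf_rel m `` {f}) = linf_rel m `` {\<lambda>x. c * f x}"
  unfolding linf_scale_def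
proof (rule UN_equiv_class[OF equiv_linf_rel _ assms])
  show "(\<lambda>f. linf_rel m `` {\<lambda>x. c * f x}) respects linf_rel m"
  proof (rule congruentI)
    fix f f' assume *: "(f, f') \<in> linf_rel m"
    then have "AE x in m. f x = f' x" by (simp add: linf_rel_def)
    then have "AE x in m. c * f x = c * f' x" by eventually_elim simp
    with * show "linf_rel m `` {\<lambda>x. c * f x} = linf_rel m `` {\<lambda>x. c * f' x}"
      by (intro equiv_class_eq[OF equiv_linf_rel]) (simp add: linf_rel_def linf_fun_scale)
  qed
qed


section \<open>Almost periodic functions on the right half-plane\<close>

text \<open>
  Every interval of length \<open>l\<close> contains the open interval with the same end points, so it suffices
  to let \<open>I\<close> range over the open ones. The supremum is taken in \<open>ereal\<close> because it may be infinite.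
\<close>

definition uniformly_almost_periodic :: "(real \<Rightarrow> complex) \<Rightarrow> bool" where
  "uniformly_almost_periodic g \<longleftrightarrow> continuous_on UNIV g \<and>
     (\<forall>\<epsilon>>0. \<exists>l>0. \<forall>a. \<exists>\<tau>\<in>{a<..<a + l}. (SUP x. ereal (norm (g (x + \<tau>) - g x))) < ereal \<epsilon>)"

definition right_half_plane :: "complex set" where
  "right_half_plane = {z. Re z > 0}"

definition vertical :: "(complex \<Rightarrow> complex) \<Rightarrow> real \<Rightarrow> real \<Rightarrow> complex" where
  "vertical F \<sigma> t = F (Complex \<sigma> t)"

text \<open>The Bohr coefficient is the limit common to all abscissae \<open>\<sigma> > 0\<close>.\<close>

definition bohr_coeff :: "(complex \<Rightarrow> complex) \<Rightarrow> real \<Rightarrow> complex" where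
  "bohr_coeff F x = (THE a. \<forall>\<sigma>>0.
     ((\<lambda>T. of_real (1 / (2 * T)) *
        integral {-T..T} (\<lambda>t. vertical F \<sigma> t * exp (Complex \<sigma> t * of_real x))) \<longlongrightarrow> a) at_top)"

text \<open>
  \<open>\<H>\<^sub>\<infinity>\<^sup>\<lambda>[Re > 0]\<close>. A function on the half-plane is represented by its extension by \<open>0\<close>, so that
  equality of functions in HOL is equality on the half-plane.
\<close>

definition hardy_inf_half_plane :: "(nat \<Rightarrow> real) \<Rightarrow> (complex \<Rightarrow> complex) set" where
  "hardy_inf_half_plane freq = {F.
     F holomorphic_on right_half_plane \<and> bounded (F ` right_half_plane)
     \<and> (\<forall>z. z \<notin> right_half_plane \<longrightarrow> F z = 0)
     \<and> (\<forall>\<sigma>>0. uniformly_almost_periodic (vertical F \<sigma>))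
     \<and> (\<forall>x. x \<notin> range freq \<longrightarrow> bohr_coeff F x = 0)}"

definition half_plane_norm :: "(complex \<Rightarrow> complex) \<Rightarrow> real" where
  "half_plane_norm F = (SUP z\<in>right_half_plane. norm (F z))"

end

theory Submission
  imports Defs "HOL-Complex_Analysis.Complex_Analysis"
begin

text \<open>
  Both spaces are identified with the same set of coefficient sequences \<open>a\<close>: those for which the Riesz
  sums \<open>\<Sum>\<^bsub>\<lambda>\<^sub>n < N\<^esub> (1 - \<lambda>\<^sub>n / N) a\<^sub>n exp (- \<lambda>\<^sub>n z)\<close> are bounded on the imaginary axis uniformly in \<open>N\<close>; the
  best bound is the norm on either side. Because a frequency is discrete, these are finite sums.
  They are Fejer means: by Bohr's uniqueness theorem an almost periodic function with frequencies
  \<open>\<lambda>\<^sub>n\<close> has these sums as convolutions with the Fejer kernel, which does not increase the supremum norm.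
  On the half-plane this is applied on vertical lines, on the group to the orbits along \<open>\<beta>\<close> of
  \<open>f\<close> averaged by an approximate unit. Conversely, bounded Riesz sums converge uniformly
  on \<open>Re z \<ge> \<sigma> > 0\<close> (maximum principle and Cauchy estimates), and in \<open>L\<^sub>2\<close> of the group.

  The uniqueness theorem is proved by Wiener's method, with no measure on the dual group. It also
  replaces the Peter--Weyl theorem for \<open>G\<close>: a frequency that occurs along an orbit of a continuous function
  on \<open>G\<close> extends to a character.
\<close>

section \<open>Almost periodic functions and their means\<close>

text \<open>Partial sums cannot replace the Riesz sums: they need not be bounded, already for power
  series. The Fejer kernel is nonnegative with mass 1, so its means keep a supremum bound, and its
  Fourier transform is the compactly supported \<open>tri\<close>, so they are finite sums. An
  element of L_infinity has no values along an orbit, since the dense line can be a null set of the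
  group; hence the averaging over translates, which multiplies the finitely many coefficients of a
  Riesz sum by factors close to 1. Wiener's method rests on this: if all Bohr coefficients of
  \<open>g\<close> vanish, the spectral measure of its correlation has no atoms, hence the
  correlation has mean square 0 and, being almost periodic, is 0; its value at 0 is the mean square
  of \<open>g\<close>. To do without the measure, the correlation is first smoothed by the Fejer
  kernel, which confines it to a bounded band of frequencies; on such a band its averages against
  characters are uniformly small by compactness. The group may fail to be metrizable, which explains
  the care with joint measurability, equicontinuity and regularity of the measure.\<close>

definition unif :: "real measure" where
  "unif = uniform_measure lborel {-1..1}"

text \<open>Time averages are treated as integrals against a fixed probability measure on the line,
  so that bounds, convolution and Fubini are proved once for \<open>real_distribution\<close> and
  shared with \<open>fejer\<close> and \<open>tri_dist\<close>.\<close>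

lemma real_distribution_unif: "real_distribution unif"
  unfolding real_distribution_def real_distribution_axioms_def unif_def
  by (auto intro!: prob_space_uniform_measure)

interpretation unif: real_distribution unif
  by (rule real_distribution_unif)

lemma AE_unif: "AE s in unif. \<bar>s\<bar> \<le> 1"
  unfolding unif_def by (rule AE_uniform_measureI) (auto simp: abs_le_iff)

text \<open>The endpoints are excluded for the sake of \<open>tendsto_unif_difference\<close>: seen
  from \<bar>u'\<bar> = 1, the rescaled interval grows to a half-line instead of the whole
  line.\<close>

lemma AE_unif': "AE s in unif. \<bar>s\<bar> < 1"
proof -
  have "AE s in lborel. s \<noteq> (1::real)" "AE s in lborel. s \<noteq> (-1::real)"
    by (rule AE_lborel_singleton)+
  then have "AE s in lborel. s \<in> {-1..1::real} \<longrightarrow> \<bar>s\<bar> < 1"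
    by eventually_elim auto
  then show ?thesis unfolding unif_def by (intro AE_uniform_measureI) auto
qed

lemma unif_eq_density: "unif = density lborel (\<lambda>s. ennreal (indicator {-1..1} s / 2))"
proof -
  have "indicator {-1..1} x / emeasure lborel {-1..1::real} = ennreal (indicator {-1..1} x / 2)" for x :: real
    by (auto split: split_indicator simp: divide_ennreal simp flip: ennreal_numeral ennreal_1)
  then show ?thesis by (simp add: unif_def uniform_measure_def)
qed

lemma integral_unif:
  fixes f :: "real \<Rightarrow> complex"
  assumes [measurable]: "f \<in> borel_measurable borel"
  shows "(\<integral>s. f s \<partial>unif) = (\<integral>s. (indicator {-1..1} s / 2) *\<^sub>R f s \<partial>lborel)"
  unfolding unif_eq_density by (subst integral_density) auto

context real_distribution
begin

lemma integrable_bounded: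
  fixes f :: "real \<Rightarrow> 'b::{banach,second_countable_topology}"
  assumes "f \<in> borel_measurable borel" "\<And>x. norm (f x) \<le> C"
  shows "integrable M f"
  using assms by (intro integrable_const_bound[where B=C]) auto

lemma norm_integral_le:
  fixes f :: "real \<Rightarrow> complex"
  assumes [measurable]: "f \<in> borel_measurable borel" and "\<And>x. norm (f x) \<le> C"
  shows "norm (\<integral>x. f x \<partial>M) \<le> C"
proof -
  have "norm (\<integral>x. f x \<partial>M) \<le> (\<integral>x. norm (f x) \<partial>M)" by (rule integral_norm_bound)
  also have "\<dots> \<le> (\<integral>x. C \<partial>M)"
    using assms by (intro integral_mono integrable_bounded) auto
  finally show ?thesis using prob_space by simp
qed

end

lemma pair_prob_space_swap:
  fixes f :: "'a \<Rightarrow> 'b \<Rightarrow> complex"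
  assumes "prob_space M" "prob_space N"
    and [measurable]: "case_prod f \<in> borel_measurable (M \<Otimes>\<^sub>M N)" and bnd: "\<And>x y. norm (f x y) \<le> C"
  shows "(\<integral>x. \<integral>y. f x y \<partial>N \<partial>M) = (\<integral>y. \<integral>x. f x y \<partial>M \<partial>N)"
proof -
  interpret M: prob_space M by fact
  interpret N: prob_space N by fact
  interpret P: pair_prob_space M N ..
  have "integrable (M \<Otimes>\<^sub>M N) (case_prod f)"
    using bnd by (intro P.integrable_const_bound[where B=C]) auto
  then show ?thesis by (rule P.Fubini_integral[symmetric])
qed

lemma pair_real_distribution_swap:
  fixes f :: "real \<Rightarrow> real \<Rightarrow> complex"
  assumes "real_distribution M" "real_distribution N"
    and "case_prod f \<in> borel_measurable (borel \<Otimes>\<^sub>M borel)" and bnd: "\<And>x y. norm (f x y) \<le> C"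
  shows "(\<integral>x. \<integral>y. f x y \<partial>N \<partial>M) = (\<integral>y. \<integral>x. f x y \<partial>M \<partial>N)"
proof (rule pair_prob_space_swap[OF _ _ _ bnd])
  interpret M: real_distribution M by fact
  interpret N: real_distribution N by fact
  show "prob_space M" "prob_space N" by unfold_locales
  show "case_prod f \<in> borel_measurable (M \<Otimes>\<^sub>M N)"
    using assms(3) by (simp cong: measurable_cong_sets sets_pair_measure_cong)
qed

text \<open>
  Bochner's form of almost periodicity: the translates are totally bounded in the supremum norm. Unlike
  relative density of almost periods, this passes to sums and products at once.
\<close>

definition bochner_ap :: "(real \<Rightarrow> complex) \<Rightarrow> bool" where
  "bochner_ap g \<longleftrightarrow> continuous_on UNIV g \<and>
    (\<forall>e>0. \<exists>B. finite B \<and> (\<forall>t. \<exists>b\<in>B. \<forall>x. norm (g (x + t) - g (x + b)) \<le> e))"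

lemma bochner_ap_continuous: "bochner_ap g \<Longrightarrow> continuous_on UNIV g"
  by (simp add: bochner_ap_def)

lemma bochner_ap_measurable: "bochner_ap g \<Longrightarrow> g \<in> borel_measurable borel"
  by (simp add: bochner_ap_continuous borel_measurable_continuous_onI)

lemma bochner_apE:
  assumes "bochner_ap g" "e > 0"
  obtains B where "finite B" "\<And>t. \<exists>b\<in>B. \<forall>x. norm (g (x + t) - g (x + b)) \<le> e"
  using assms unfolding bochner_ap_def by blast

lemma bochner_ap_bounded:
  assumes "bochner_ap g"
  obtains C where "C > 0" "\<And>x. norm (g x) \<le> C"
proof -
  obtain B where B: "finite B" "\<And>t. \<exists>b\<in>B. \<forall>x. norm (g (x + t) - g (x + b)) \<le> 1"
    using bochner_apE[OF assms, of 1] by auto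
  define C where "C = 1 + (\<Sum>b\<in>B. norm (g b))"
  have "norm (g t) \<le> C" for t
  proof -
    obtain b where b: "b \<in> B" "\<forall>x. norm (g (x + t) - g (x + b)) \<le> 1" using B by blast
    have "norm (g t - g b) \<le> 1" using b(2)[rule_format, of 0] by simp
    then have "norm (g t) \<le> 1 + norm (g b)"
      using norm_triangle_sub[of "g t" "g b"] by simp
    also have "norm (g b) \<le> (\<Sum>b\<in>B. norm (g b))"
      using b B by (intro member_le_sum) auto
    finally show ?thesis by (simp add: C_def)
  qed
  moreover have "C > 0" unfolding C_def by (simp add: add_pos_nonneg sum_nonneg)
  ultimately show ?thesis using that by blast
qed

text \<open>Translation carries \<open>x\<close> to a net point \<open>b\<close> and
  \<open>y\<close> to \<open>y - x + b\<close> at a cost of e/3 each, so continuity at the finitely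
  many net points is enough.\<close>

lemma bochner_ap_uniformly_continuous:
  assumes "bochner_ap g" "e > 0"
  obtains d where "d > 0" "\<And>x y. \<bar>y - x\<bar> < d \<Longrightarrow> norm (g y - g x) \<le> e"
proof -
  obtain B where B: "finite B" "\<And>t. \<exists>b\<in>B. \<forall>x. norm (g (x + t) - g (x + b)) \<le> e/3"
    using bochner_apE[OF assms(1), of "e/3"] assms(2) by auto
  have "\<exists>d>0. \<forall>y. \<bar>y - b\<bar> < d \<longrightarrow> norm (g y - g b) < e/3" for b
    using bochner_ap_continuous[OF assms(1), unfolded continuous_on_iff dist_norm real_norm_def, rule_format, of b "e/3"] assms(2)
    by auto
  then obtain d where d: "\<And>b. d b > 0"
      "\<And>b y. \<bar>y - b\<bar> < d b \<Longrightarrow> norm (g y - g b) < e/3" by metis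
  define D where "D = Min (insert 1 (d ` B))"
  have D: "D > 0" "\<And>b. b \<in> B \<Longrightarrow> D \<le> d b"
    using B d unfolding D_def by auto
  have "norm (g y - g x) \<le> e" if "\<bar>y - x\<bar> < D" for x y
  proof -
    obtain b where b: "b \<in> B" "\<And>z. norm (g (z + x) - g (z + b)) \<le> e/3" using B(2) by blast
    have 1: "norm (g x - g b) \<le> e/3" using b(2)[of 0] by simp
    have 2: "norm (g y - g (y - x + b)) \<le> e/3" using b(2)[of "y - x"] by simp
    have 3: "norm (g (y - x + b) - g b) < e/3"
      using that D(2)[OF b(1)] by (intro d(2)) auto
    have "g y - g x = (g y - g (y - x + b)) + (g (y - x + b) - g b) - (g x - g b)" by simp
    also have "norm \<dots> \<le> norm (g y - g (y - x + b)) + norm (g (y - x + b) - g b) + norm (g x - g b)"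
      by (rule order_trans[OF norm_triangle_ineq4 add_right_mono[OF norm_triangle_ineq]])
    finally show ?thesis using 1 2 3 by simp
  qed
  then show ?thesis using D that by blast
qed

text \<open>Translations are classified by pairs of net points; one representative per class is kept.\<close>

lemma bochner_ap_joint:
  assumes f: "bochner_ap f" and g: "bochner_ap g" and "e > 0"
  obtains B where "finite B"
    "\<And>t. \<exists>b\<in>B. (\<forall>x. norm (f (x + t) - f (x + b)) \<le> e) \<and> (\<forall>x. norm (g (x + t) - g (x + b)) \<le> e)"
proof -
  obtain B1 where B1: "finite B1" "\<And>t. \<exists>b\<in>B1. \<forall>x. norm (f (x + t) - f (x + b)) \<le> e/2"
    using bochner_apE[OF f, of "e/2"] \<open>e > 0\<close> by auto
  obtain B2 where B2: "finite B2" "\<And>t. \<exists>b\<in>B2. \<forall>x. norm (g (x + t) - g (x + b)) \<le> e/2"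
    using bochner_apE[OF g, of "e/2"] \<open>e > 0\<close> by auto
  define P where "P p t \<longleftrightarrow> (\<forall>x. norm (f (x + t) - f (x + fst p)) \<le> e/2) \<and>
    (\<forall>x. norm (g (x + t) - g (x + snd p)) \<le> e/2)" for p t
  \<comment> \<open>For a pair of net points that no translation matches, \<open>SOME\<close> yields
    an arbitrary real; the surplus points do no harm.\<close>
  define B where "B = (\<lambda>p. SOME t. P p t) ` (B1 \<times> B2)"
  have "finite B" using B1 B2 by (auto simp: B_def)
  moreover have "\<exists>b\<in>B. (\<forall>x. norm (f (x + t) - f (x + b)) \<le> e) \<and> (\<forall>x. norm (g (x + t) - g (x + b)) \<le> e)" for t
  proof -
    obtain b1 b2 where b: "b1 \<in> B1" "b2 \<in> B2" "P (b1, b2) t"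
      using B1(2)[of t] B2(2)[of t] unfolding P_def by auto
    define s where "s = (SOME t. P (b1, b2) t)"
    have s: "P (b1, b2) s" unfolding s_def using b(3) by (rule someI)
    have tri: "norm (u - v) \<le> e" if "norm (u - w) \<le> e/2" "norm (v - w) \<le> e/2" for u v w :: complex
      using norm_triangle_le_diff[of "u - w" "v - w" e] that by simp
    have "s \<in> B" unfolding B_def s_def by (rule imageI) (simp add: b)
    moreover have "norm (f (x + t) - f (x + s)) \<le> e" "norm (g (x + t) - g (x + s)) \<le> e" for x
      by (rule tri[of _ "f (x + b1)"] tri[of _ "g (x + b2)"]; use s b(3) in \<open>simp add: P_def\<close>)+
    ultimately show ?thesis by blast
  qed
  ultimately show ?thesis using that by blast
qed

lemma bochner_ap_add:
  assumes "bochner_ap f" "bochner_ap g" shows "bochner_ap (\<lambda>x. f x + g x)"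
  unfolding bochner_ap_def
proof (intro conjI allI impI)
  show "continuous_on UNIV (\<lambda>x. f x + g x)"
    using assms by (intro continuous_intros bochner_ap_continuous)
  fix e :: real assume "e > 0"
  then obtain B where B: "finite B" "\<And>t. \<exists>b\<in>B. (\<forall>x. norm (f (x + t) - f (x + b)) \<le> e/2) \<and>
      (\<forall>x. norm (g (x + t) - g (x + b)) \<le> e/2)"
    using bochner_ap_joint[OF assms, of "e/2"] by auto
  have "norm (f (x + t) + g (x + t) - (f (x + b) + g (x + b))) \<le> e"
    if "norm (f (x + t) - f (x + b)) \<le> e/2" "norm (g (x + t) - g (x + b)) \<le> e/2" for x t b
    using norm_triangle_le[of "f (x + t) - f (x + b)" "g (x + t) - g (x + b)" e] that
    by (simp add: algebra_simps)
  then show "\<exists>B. finite B \<and> (\<forall>t. \<exists>b\<in>B. \<forall>x. norm (f (x + t) + g (x + t) - (f (x + b) + g (x + b))) \<le> e)"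
    using B by (intro exI[of _ B]) blast
qed

lemma bochner_ap_mult:
  assumes "bochner_ap f" "bochner_ap g" shows "bochner_ap (\<lambda>x. f x * g x)"
  unfolding bochner_ap_def
proof (intro conjI allI impI)
  show "continuous_on UNIV (\<lambda>x. f x * g x)"
    using assms by (intro continuous_intros bochner_ap_continuous)
  obtain C where C: "C > 0" "\<And>x. norm (f x) \<le> C" using bochner_ap_bounded[OF assms(1)] by blast
  obtain D where D: "D > 0" "\<And>x. norm (g x) \<le> D" using bochner_ap_bounded[OF assms(2)] by blast
  fix e :: real assume "e > 0"
  then obtain B where B: "finite B" "\<And>t. \<exists>b\<in>B. (\<forall>x. norm (f (x + t) - f (x + b)) \<le> e/(C+D)) \<and>
      (\<forall>x. norm (g (x + t) - g (x + b)) \<le> e/(C+D))"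
    using bochner_ap_joint[OF assms, of "e/(C+D)"] C D by auto
  have "norm (f (x + t) * g (x + t) - (f (x + b) * g (x + b))) \<le> e"
    if "norm (f (x + t) - f (x + b)) \<le> e/(C+D)" "norm (g (x + t) - g (x + b)) \<le> e/(C+D)" for x t b
  proof -
    have "f (x + t) * g (x + t) - f (x + b) * g (x + b) =
      (f (x + t) - f (x + b)) * g (x + t) + f (x + b) * (g (x + t) - g (x + b))"
      by (simp add: algebra_simps)
    also have "norm \<dots> \<le> e/(C+D) * D + C * (e/(C+D))"
      using that C D \<open>e > 0\<close>
      by (intro norm_triangle_le add_mono) (simp_all only: norm_mult, auto intro!: mult_mono simp del: times_divide_eq_left times_divide_eq_right)
    also have "\<dots> = (C+D) * (e / (C+D))" by (metis add.commute distrib_right mult.commute)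
    also have "\<dots> = e" using C D by simp
    finally show ?thesis .
  qed
  then show "\<exists>B. finite B \<and> (\<forall>t. \<exists>b\<in>B. \<forall>x. norm (f (x + t) * g (x + t) - f (x + b) * g (x + b)) \<le> e)"
    using B by (intro exI[of _ B]) blast
qed

lemma bochner_ap_const: "bochner_ap (\<lambda>x. c)"
  unfolding bochner_ap_def by (auto intro!: exI[of _ "{0}"])

lemma bochner_ap_cnj:
  assumes "bochner_ap f" shows "bochner_ap (\<lambda>x. cnj (f x))"
  using assms unfolding bochner_ap_def
  by (simp flip: complex_cnj_diff add: continuous_on_cnj)

lemma bochner_ap_shift:
  assumes "bochner_ap f" shows "bochner_ap (\<lambda>x. f (x + a))"
  unfolding bochner_ap_def
proof (intro conjI allI impI)
  show "continuous_on UNIV (\<lambda>x. f (x + a))"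
    by (intro continuous_on_compose2[OF bochner_ap_continuous[OF assms]] continuous_intros) auto
  fix e :: real assume "e > 0"
  then obtain B where B: "finite B" "\<And>t. \<exists>b\<in>B. \<forall>x. norm (f (x + t) - f (x + b)) \<le> e"
    using bochner_apE[OF assms] by blast
  show "\<exists>B. finite B \<and> (\<forall>t. \<exists>b\<in>B. \<forall>x. norm (f (x + t + a) - f (x + b + a)) \<le> e)"
  proof (intro exI[of _ B] conjI allI B(1))
    fix t
    obtain b where b: "b \<in> B" "\<And>x. norm (f (x + t) - f (x + b)) \<le> e" using B(2) by blast
    have "norm (f (x + t + a) - f (x + b + a)) \<le> e" for x
      using b(2)[of "x + a"] by (simp add: add_ac)
    then show "\<exists>b\<in>B. \<forall>x. norm (f (x + t + a) - f (x + b + a)) \<le> e" using b(1) by blast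
  qed
qed

lemma bochner_ap_uniform_limit:
  assumes "\<And>e. e > 0 \<Longrightarrow> \<exists>h. bochner_ap h \<and> (\<forall>x. norm (g x - h x) \<le> e)"
  shows "bochner_ap g"
proof -
  \<comment> \<open>The sequence serves only to quote the uniform limit theorem for continuity; the
    net is taken from a single approximant below.\<close>
  have "\<exists>h. \<forall>n. bochner_ap (h n) \<and> (\<forall>x. norm (g x - h n x) \<le> inverse (Suc n))"
    by (intro choice allI assms) simp
  then obtain h where h: "\<And>n. bochner_ap (h n)" "\<And>n x. norm (g x - h n x) \<le> inverse (Suc n)" by blast
  have "uniform_limit UNIV h g sequentially"
  proof (rule uniform_limitI)
    fix e :: real assume "e > 0"
    then obtain N where N: "inverse (Suc N) < e" using reals_Archimedean by blast
    have "dist (h n x) (g x) < e" if "n \<ge> N" for n x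
    proof -
      have "inverse (Suc n) \<le> inverse (real (Suc N))" using that by (intro le_imp_inverse_le) auto
      then have "norm (g x - h n x) < e" using h(2)[of x n] N by (meson le_less_trans)
      then show ?thesis by (simp add: dist_norm norm_minus_commute)
    qed
    then show "\<forall>\<^sub>F n in sequentially. \<forall>x\<in>UNIV. dist (h n x) (g x) < e"
      by (auto simp: eventually_sequentially)
  qed
  then have "continuous_on UNIV g"
    by (rule uniform_limit_theorem[rotated]) (auto intro!: always_eventually bochner_ap_continuous h)
  moreover have "\<exists>B. finite B \<and> (\<forall>t. \<exists>b\<in>B. \<forall>x. norm (g (x + t) - g (x + b)) \<le> e)" if "e > 0" for e
  proof -
    have e3: "e/3 > 0" using that by simp
    obtain h where h: "bochner_ap h" "\<And>x. norm (g x - h x) \<le> e/3" using assms[of "e/3", OF e3] by blast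
    obtain B where B: "finite B" "\<And>t. \<exists>b\<in>B. \<forall>x. norm (h (x + t) - h (x + b)) \<le> e/3"
      using bochner_apE[OF h(1) e3] by blast
    have "norm (g (x + t) - g (x + b)) \<le> e" if "norm (h (x + t) - h (x + b)) \<le> e/3" for x t b
    proof -
      have "g (x + t) - g (x + b) = (g (x+t) - h (x+t)) + (h (x + t) - h (x + b)) - (g (x + b) - h (x + b))" by simp
      also have "norm \<dots> \<le> norm (g (x+t) - h (x+t)) + norm (h (x + t) - h (x + b)) + norm (g (x + b) - h (x + b))"
        by (rule order_trans[OF norm_triangle_ineq4 add_right_mono[OF norm_triangle_ineq]])
      finally show ?thesis using h(2)[of "x+t"] h(2)[of "x+b"] that by simp
    qed
    then show ?thesis using B by (intro exI[of _ B]) blast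
  qed
  ultimately show ?thesis by (simp add: bochner_ap_def)
qed

lemma bochner_ap_sum:
  "(\<And>i. i \<in> I \<Longrightarrow> bochner_ap (f i)) \<Longrightarrow> bochner_ap (\<lambda>x. \<Sum>i\<in>I. f i x)"
  by (induction I rule: infinite_finite_induct) (auto intro: bochner_ap_const bochner_ap_add)

text \<open>Translation by \<open>t\<close> multiplies the function by the constant
  \<open>cis (y * t)\<close>, so a finite net of the unit circle yields a finite net of
  translates.\<close>

lemma bochner_ap_cis: "bochner_ap (\<lambda>x. cis (y * x))"
  unfolding bochner_ap_def
proof (intro conjI allI impI)
  show "continuous_on UNIV (\<lambda>x. cis (y * x))" by (intro continuous_intros)
  fix e :: real assume "e > 0"
  have e2: "e/2 > 0" using \<open>e > 0\<close> by simp
  have "\<forall>e>0. \<exists>K. finite K \<and> sphere (0::complex) 1 \<subseteq> (\<Union>k\<in>K. ball k e)"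
    using compact_sphere unfolding compact_eq_totally_bounded by (rule conjunct2)
  from this[rule_format, OF e2] obtain K where K: "finite K" "sphere (0::complex) 1 \<subseteq> (\<Union>k\<in>K. ball k (e/2::real))"
    by blast
  define B where "B = (\<lambda>k. SOME t. norm (cis (y * t) - k) < e/2) ` K"
  show "\<exists>B. finite B \<and> (\<forall>t. \<exists>b\<in>B. \<forall>x. norm (cis (y * (x + t)) - cis (y * (x + b))) \<le> e)"
  proof (intro exI[of _ B] conjI allI)
    show "finite B" using K by (auto simp: B_def)
    fix t
    have "cis (y * t) \<in> sphere 0 1" by simp
    with K(2) have "cis (y * t) \<in> (\<Union>k\<in>K. ball k (e/2))" by (rule subsetD)
    then obtain k where k: "k \<in> K" "norm (cis (y * t) - k) < e/2"
      by (auto simp only: UN_iff mem_ball dist_norm norm_minus_commute)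
    define b where "b = (SOME t. norm (cis (y * t) - k) < e/2)"
    have b: "norm (cis (y * b) - k) < e/2" unfolding b_def using k(2) by (rule someI)
    have "norm (cis (y * (x + t)) - cis (y * (x + b))) \<le> e" for x
    proof -
      have "cis (y * (x + t)) - cis (y * (x + b)) = cis (y * x) * ((cis (y * t) - k) - (cis (y * b) - k))"
        by (simp add: algebra_simps cis_mult)
      also have "norm \<dots> \<le> norm (cis (y * t) - k) + norm (cis (y * b) - k)"
        by (simp only: norm_mult norm_cis mult_1_left norm_triangle_ineq4)
      finally show ?thesis using k(2) b by simp
    qed
    moreover have "b \<in> B" using k(1) by (auto simp: B_def b_def)
    ultimately show "\<exists>b\<in>B. \<forall>x. norm (cis (y * (x + t)) - cis (y * (x + b))) \<le> e" by blast
  qed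
qed

lemma bochner_ap_cmult: "bochner_ap f \<Longrightarrow> bochner_ap (\<lambda>x. c * f x)"
  by (intro bochner_ap_mult bochner_ap_const)

lemma bochner_ap_diff: "bochner_ap f \<Longrightarrow> bochner_ap g \<Longrightarrow> bochner_ap (\<lambda>x. f x - g x)"
  using bochner_ap_add[of f "\<lambda>x. -1 * g x"] bochner_ap_cmult[of g "-1"] by simp

text \<open>Averaging does not increase the supremum distance of two translates, so the modulus of
  continuity and the nets of \<open>g\<close> carry over without loss.\<close>

lemma bochner_ap_convolution:
  assumes "bochner_ap g" "real_distribution M"
  shows "bochner_ap (\<lambda>t. \<integral>s. g (t + a * s) \<partial>M)"
proof -
  interpret real_distribution M by fact
  have [measurable]: "g \<in> borel_measurable borel" by (rule bochner_ap_measurable) fact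
  obtain C where C: "\<And>x. norm (g x) \<le> C" using bochner_ap_bounded[OF assms(1)] by blast
  have int: "integrable M (\<lambda>s. g (t + a * s))" for t
    using C by (intro integrable_bounded[where C=C]) auto
  have bnd: "norm ((\<integral>s. g (t + a * s) \<partial>M) - (\<integral>s. g (t' + a * s) \<partial>M)) \<le> e"
    if "\<And>x. norm (g (t + x) - g (t' + x)) \<le> e" for t t' e
  proof -
    have "(\<integral>s. g (t + a * s) \<partial>M) - (\<integral>s. g (t' + a * s) \<partial>M) = (\<integral>s. g (t + a * s) - g (t' + a * s) \<partial>M)"
      by (simp add: int)
    also have "norm \<dots> \<le> e" using that by (intro norm_integral_le) auto
    finally show ?thesis .
  qed
  show ?thesis unfolding bochner_ap_def
  proof (intro conjI allI impI)
    show "continuous_on UNIV (\<lambda>t. \<integral>s. g (t + a * s) \<partial>M)"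
      unfolding continuous_on_iff dist_norm
    proof (intro ballI allI impI)
      fix x e :: real assume "e > 0"
      then obtain d where d: "d > 0" "\<And>x y. \<bar>y - x\<bar> < d \<Longrightarrow> norm (g y - g x) \<le> e/2"
        using bochner_ap_uniformly_continuous[OF assms(1), of "e/2"] by auto
      have "norm ((\<integral>s. g (y + a * s) \<partial>M) - (\<integral>s. g (x + a * s) \<partial>M)) < e" if "norm (y - x) < d" for y
      proof -
        have "norm ((\<integral>s. g (y + a * s) \<partial>M) - (\<integral>s. g (x + a * s) \<partial>M)) \<le> e/2"
          using that by (intro bnd d) auto
        then show ?thesis using \<open>e > 0\<close> by simp
      qed
      then show "\<exists>d>0. \<forall>x'\<in>UNIV. norm (x' - x) < d \<longrightarrow>
          norm ((\<integral>s. g (x' + a * s) \<partial>M) - (\<integral>s. g (x + a * s) \<partial>M)) < e" using d(1) by blast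
    qed
    fix e :: real assume "e > 0"
    then obtain B where B: "finite B" "\<And>t. \<exists>b\<in>B. \<forall>x. norm (g (x + t) - g (x + b)) \<le> e"
      using bochner_apE[OF assms(1)] by blast
    show "\<exists>B. finite B \<and> (\<forall>t. \<exists>b\<in>B. \<forall>x. norm ((\<integral>s. g (x + t + a * s) \<partial>M) - (\<integral>s. g (x + b + a * s) \<partial>M)) \<le> e)"
    proof (intro exI[of _ B] conjI allI B(1))
      fix t
      obtain b where b: "b \<in> B" "\<And>x. norm (g (x + t) - g (x + b)) \<le> e" using B(2) by blast
      have "norm ((\<integral>s. g (x + t + a * s) \<partial>M) - (\<integral>s. g (x + b + a * s) \<partial>M)) \<le> e" for x
      proof (rule bnd)
        fix y show "norm (g (x + t + y) - g (x + b + y)) \<le> e"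
          using b(2)[of "x + y"] by (simp add: add_ac)
      qed
      then show "\<exists>b\<in>B. \<forall>x. norm ((\<integral>s. g (x + t + a * s) \<partial>M) - (\<integral>s. g (x + b + a * s) \<partial>M)) \<le> e"
        using b(1) by blast
    qed
  qed
qed

section \<open>Time averages and the mean value\<close>

definition avg :: "(real \<Rightarrow> complex) \<Rightarrow> real \<Rightarrow> real \<Rightarrow> complex" where
  "avg g T t = (\<integral>s. g (t + T * s) \<partial>unif)"

lemma measurable_cis [measurable]: "cis \<in> borel_measurable borel"
  by (intro borel_measurable_continuous_onI continuous_intros)

lemma measurable_cnj [measurable]: "cnj \<in> borel_measurable borel"
  by (intro borel_measurable_continuous_onI continuous_intros)

definition mean :: "(real \<Rightarrow> complex) \<Rightarrow> complex" where
  "mean g = Lim at_top (\<lambda>T. avg g T 0)"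

lemma integrable_unif_ap: "bochner_ap g \<Longrightarrow> integrable unif (\<lambda>s. g (t + a * s))"
proof -
  assume g: "bochner_ap g"
  have [measurable]: "g \<in> borel_measurable borel" by (rule bochner_ap_measurable) fact
  obtain C where C: "\<And>x. norm (g x) \<le> C" using bochner_ap_bounded[OF g] by blast
  show ?thesis using C by (intro unif.integrable_bounded[where C=C]) auto
qed

lemma bochner_ap_avg: "bochner_ap g \<Longrightarrow> bochner_ap (avg g T)"
  using bochner_ap_convolution[OF _ real_distribution_unif, of g T] by (simp add: avg_def[abs_def])

lemma norm_avg_le:
  assumes "g \<in> borel_measurable borel" "\<And>x. norm (g x) \<le> C"
  shows "norm (avg g T t) \<le> C"
  unfolding avg_def using assms by (intro unif.norm_integral_le) auto

lemma avg_add: "bochner_ap f \<Longrightarrow> bochner_ap g \<Longrightarrow> avg (\<lambda>x. f x + g x) T t = avg f T t + avg g T t"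
  by (simp add: avg_def integrable_unif_ap)

lemma avg_diff: "bochner_ap f \<Longrightarrow> bochner_ap g \<Longrightarrow> avg (\<lambda>x. f x - g x) T t = avg f T t - avg g T t"
  by (simp add: avg_def integrable_unif_ap)

lemma avg_cmult: "avg (\<lambda>x. c * f x) T t = c * avg f T t"
  by (simp add: avg_def)

lemma avg_const: "avg (\<lambda>x. c) T t = c"
  using unif.prob_space by (simp add: avg_def)

lemma norm_avg_diff_le:
  assumes "bochner_ap f" "bochner_ap g" "\<And>x. norm (f x - g x) \<le> e"
  shows "norm (avg f T t - avg g T t) \<le> e"
  using norm_avg_le[OF bochner_ap_measurable[OF bochner_ap_diff[OF assms(1,2)]] assms(3)] avg_diff[OF assms(1,2)]
  by simp

lemma avg_avg_commute:
  assumes "bochner_ap g"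
  shows "avg (avg g S) T t = avg (avg g T) S t"
proof -
  have [measurable]: "g \<in> borel_measurable borel" by (rule bochner_ap_measurable) fact
  obtain C where C: "\<And>x. norm (g x) \<le> C" using bochner_ap_bounded[OF assms] by blast
  have "avg (avg g S) T t = (\<integral>s. \<integral>s'. g (t + T * s + S * s') \<partial>unif \<partial>unif)"
    by (simp add: avg_def)
  also have "\<dots> = (\<integral>s'. \<integral>s. g (t + T * s + S * s') \<partial>unif \<partial>unif)"
    using C by (intro pair_real_distribution_swap[OF real_distribution_unif real_distribution_unif]) auto
  finally show ?thesis by (simp add: avg_def algebra_simps)
qed

text \<open>On the scale of \<open>unif\<close> the shift moves the window by \<open>a / T\<close>,
  and the old and the new window differ only near their ends.\<close>

lemma norm_avg_shift_le:
  assumes "g \<in> borel_measurable borel" and C: "\<And>x. norm (g x) \<le> C" and "T > 0"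
  shows "norm (avg g T (t + a) - avg g T t) \<le> 2 * C * \<bar>a\<bar> / T"
proof -
  note [measurable] = assms(1)
  define d where "d = a / T"
  define w :: "real \<Rightarrow> real" where "w s = indicator {-1..1} s / 2" for s
  \<comment> \<open>\<open>D\<close> dominates the difference of the two windows for either sign of
    \<open>d\<close>. Its integral is 4 \<bar>d\<bar>, and the density 1/2 of \<open>unif\<close>
    turns this into the constant 2.\<close>
  define D where "D s = (indicator {-1-\<bar>d\<bar>..-1+\<bar>d\<bar>} s + indicator {1-\<bar>d\<bar>..1+\<bar>d\<bar>} s :: real)" for s
  have w[measurable]: "w \<in> borel_measurable borel" unfolding w_def by measurable
  have C0: "C \<ge> 0" using C[of 0] norm_ge_zero order_trans by blast
  have int: "integrable lborel (\<lambda>s. w (b + s) *\<^sub>R h s)"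
    if h: "h \<in> borel_measurable borel" "\<And>x. norm (h x) \<le> C" for b and h :: "real \<Rightarrow> complex"
  proof -
    note [measurable] = h(1)
    have "integrable lborel (\<lambda>s. indicator {-1-b..1-b} s * (C/2) :: real)"
      by simp
    then show ?thesis
      by (rule Bochner_Integration.integrable_bound)
         (use h in \<open>auto simp: w_def norm_mult C0 intro!: AE_I2 split: split_indicator\<close>)
  qed
  have "avg g T (t + a) = (\<integral>s. w s *\<^sub>R g (t + a + T * s) \<partial>lborel)"
    unfolding avg_def w_def by (rule integral_unif) measurable
  also have "\<dots> = (\<integral>s. w (- d + s) *\<^sub>R g (t + T * s) \<partial>lborel)"
    using \<open>T > 0\<close> by (subst lborel_integral_real_affine[where c=1 and t="-d"]) (auto simp: d_def algebra_simps)
  finally have 1: "avg g T (t + a) = (\<integral>s. w (- d + s) *\<^sub>R g (t + T * s) \<partial>lborel)" .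
  have 2: "avg g T t = (\<integral>s. w (0 + s) *\<^sub>R g (t + T * s) \<partial>lborel)"
    unfolding avg_def w_def by (subst integral_unif) auto
  have "avg g T (t + a) - avg g T t = (\<integral>s. w (- d + s) *\<^sub>R g (t + T * s) - w (0 + s) *\<^sub>R g (t + T * s) \<partial>lborel)"
    unfolding 1 2 using C by (intro Bochner_Integration.integral_diff[symmetric] int) auto
  also have "norm \<dots> \<le> (\<integral>s. C / 2 * D s \<partial>lborel)"
  proof (rule Bochner_Integration.integral_norm_bound_integral)
    show "integrable lborel (\<lambda>s. C / 2 * D s)" unfolding D_def by simp
    fix s
    have "\<bar>w (- d + s) - w s\<bar> \<le> 1/2 * D s"
      unfolding w_def D_def by (auto split: split_indicator)
    moreover have "0 \<le> D s" unfolding D_def by simp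
    ultimately
    have "norm ((w (- d + s) - w s) *\<^sub>R g (t + T * s)) \<le> (1/2 * D s) * C"
      unfolding norm_scaleR real_norm_def using C C0 by (intro mult_mono) auto
    then show "norm (w (- d + s) *\<^sub>R g (t + T * s) - w (0 + s) *\<^sub>R g (t + T * s)) \<le> C / 2 * D s"
      by (simp add: scaleR_diff_left mult.commute)
  qed (use C in \<open>intro Bochner_Integration.integrable_diff int; auto\<close>)
  also have "\<dots> = 2 * C * \<bar>a\<bar> / T"
    using \<open>T > 0\<close> by (simp add: D_def d_def abs_div)
  finally show ?thesis .
qed

text \<open>An arbitrary translation is traded for a net point at a cost of e/2. Net points are
  bounded by \<open>L\<close>, and \<open>T0\<close> is chosen so that a shift by \<open>L\<close>
  costs at most e/2 more.\<close>

lemma avg_almost_constant: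
  assumes "bochner_ap g" "e > 0"
  obtains T0 where "T0 > 0" "\<And>T t. T \<ge> T0 \<Longrightarrow> norm (avg g T t - avg g T 0) \<le> e"
proof -
  obtain C where C: "C > 0" "\<And>x. norm (g x) \<le> C" using bochner_ap_bounded[OF assms(1)] by blast
  have e2: "e/2 > 0" using assms by simp
  obtain B where B: "finite B" "\<And>t. \<exists>b\<in>B. \<forall>x. norm (g (x + t) - g (x + b)) \<le> e/2"
    using bochner_apE[OF assms(1) e2] by blast
  define L where "L = 1 + (\<Sum>b\<in>B. \<bar>b\<bar>)"
  define T0 where "T0 = 4 * C * L / e"
  have L: "L > 0" unfolding L_def by (simp add: add_pos_nonneg sum_nonneg)
  then have "T0 > 0" using C(1) assms(2) by (simp add: T0_def)
  moreover have "norm (avg g T t - avg g T 0) \<le> e" if T: "T \<ge> T0" for T t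
  proof -
    obtain b where b: "b \<in> B" "\<And>x. norm (g (x + t) - g (x + b)) \<le> e/2" using B(2) by blast
    have "\<bar>b\<bar> \<le> L" unfolding L_def using b B member_le_sum[of b B abs] by simp
    have "T > 0" using T \<open>T0 > 0\<close> by simp
    have "avg g T t - avg g T b = avg (\<lambda>x. g (x + t)) T 0 - avg (\<lambda>x. g (x + b)) T 0"
      by (simp add: avg_def add_ac)
    also have "norm \<dots> \<le> e/2"
      by (rule norm_avg_diff_le) (use b assms in \<open>auto intro: bochner_ap_shift\<close>)
    finally have 1: "norm (avg g T t - avg g T b) \<le> e/2" .
    have "norm (avg g T (0 + b) - avg g T 0) \<le> 2 * C * \<bar>b\<bar> / T"
      by (rule norm_avg_shift_le) (use C \<open>T > 0\<close> assms in \<open>auto intro: bochner_ap_measurable\<close>)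
    also have "\<dots> \<le> 2 * C * L / T0"
      using C \<open>\<bar>b\<bar> \<le> L\<close> T \<open>T0 > 0\<close> L by (intro frac_le mult_left_mono) auto
    also have "\<dots> = e/2" using C L assms(2) by (simp add: T0_def)
    finally have 2: "norm (avg g T b - avg g T 0) \<le> e/2" by simp
    show ?thesis using norm_triangle_mono[OF 1 2] by simp
  qed
  ultimately show ?thesis using that by blast
qed

text \<open>The averages over two long intervals commute, and each is nearly constant, so they nearly agree.\<close>

lemma mean_uniform_limit:
  assumes "bochner_ap g"
  shows "uniform_limit UNIV (avg g) (\<lambda>_. mean g) at_top"
proof -
  have close: "\<exists>T0>0. \<forall>S\<ge>T0. \<forall>T\<ge>T0. \<forall>t. norm (avg g T t - avg g S 0) \<le> e" if "e > 0" for e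
  proof -
    have e3: "e/3 > 0" using that by simp
    obtain T0 where T0: "T0 > 0" "\<And>T t. T \<ge> T0 \<Longrightarrow> norm (avg g T t - avg g T 0) \<le> e/3"
      using avg_almost_constant[OF assms e3] by blast
    \<comment> \<open>Here \<open>S\<close> is arbitrary: an average of the nearly constant function
      \<open>avg g T\<close>, over whatever length, stays near its value.\<close>
    have *: "norm (avg (avg g T) S 0 - avg g T 0) \<le> e/3" if "T \<ge> T0" for S T
    proof -
      have "norm (avg (avg g T) S 0 - avg (\<lambda>_. avg g T 0) S 0) \<le> e/3"
        by (rule norm_avg_diff_le) (use assms that T0 in \<open>auto intro: bochner_ap_avg bochner_ap_const\<close>)
      then show ?thesis by (simp add: avg_const)
    qed
    have "norm (avg g T t - avg g S 0) \<le> e" if "T \<ge> T0" "S \<ge> T0" for S T t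
    proof -
      have "norm (avg g T 0 - avg (avg g T) S 0) \<le> e/3" "norm (avg (avg g T) S 0 - avg g S 0) \<le> e/3"
        using *[OF that(1), of S] *[OF that(2), of T] avg_avg_commute[OF assms, of S T 0]
        by (simp_all add: norm_minus_commute)
      from norm_triangle_mono[OF T0(2)[OF that(1)] norm_triangle_mono[OF this]]
      show ?thesis by simp
    qed
    then show ?thesis using T0(1) by blast
  qed
  \<comment> \<open>Integer lengths suffice to find the limit; \<open>close\<close> then extends the
    convergence to all real lengths and all centres.\<close>
  have "Cauchy (\<lambda>n. avg g (real n) 0)"
    unfolding Cauchy_def dist_norm
  proof (intro allI impI)
    fix e :: real assume "e > 0"
    then have "e/2 > 0" by simp
    from close[OF this] obtain T0 where T0: "T0 > 0" "\<And>S T t. S \<ge> T0 \<Longrightarrow> T \<ge> T0 \<Longrightarrow> norm (avg g T t - avg g S 0) \<le> e/2"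
      by blast
    obtain N where N: "real N \<ge> T0" using real_arch_simple by blast
    have "norm (avg g (real m) 0 - avg g (real n) 0) < e" if "m \<ge> N" "n \<ge> N" for m n
    proof -
      have "norm (avg g (real m) 0 - avg g (real n) 0) \<le> e/2"
        by (rule T0(2)) (use that N in linarith)+
      then show ?thesis using \<open>e > 0\<close> by linarith
    qed
    then show "\<exists>M. \<forall>m\<ge>M. \<forall>n\<ge>M. norm (avg g (real m) 0 - avg g (real n) 0) < e" by blast
  qed
  then obtain M where M: "(\<lambda>n. avg g (real n) 0) \<longlonglongrightarrow> M"
    using Cauchy_convergent convergent_def by blast
  have lim: "\<exists>T0. \<forall>T\<ge>T0. \<forall>t. norm (avg g T t - M) \<le> e" if "e > 0" for e
  proof -
    from close[OF that] obtain T0 where T0: "T0 > 0" "\<And>S T t. S \<ge> T0 \<Longrightarrow> T \<ge> T0 \<Longrightarrow> norm (avg g T t - avg g S 0) \<le> e"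
      by blast
    obtain N where N: "real N \<ge> T0" using real_arch_simple by blast
    have "norm (avg g T t - M) \<le> e" if "T \<ge> T0" for T t
    proof (rule Lim_bounded)
      show "(\<lambda>n. norm (avg g T t - avg g (real n) 0)) \<longlonglongrightarrow> norm (avg g T t - M)"
        by (intro tendsto_intros M)
      show "\<forall>n\<ge>N. norm (avg g T t - avg g (real n) 0) \<le> e"
        using that N by (intro allI impI T0(2)) auto
    qed
    then show ?thesis by blast
  qed
  have ul: "uniform_limit UNIV (avg g) (\<lambda>_. M) at_top"
  proof (rule uniform_limitI)
    fix e :: real assume "e > 0"
    then have "e/2 > 0" by simp
    from lim[OF this] obtain T0 where T0: "\<And>T t. T \<ge> T0 \<Longrightarrow> norm (avg g T t - M) \<le> e/2" by blast
    have "norm (avg g T t - M) < e" if "T \<ge> T0" for T t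
      using T0[OF that, of t] \<open>e > 0\<close> by linarith
    then show "\<forall>\<^sub>F n in at_top. \<forall>x\<in>UNIV. dist (avg g n x) M < e"
      by (auto simp: eventually_at_top_linorder dist_norm)
  qed
  have "((\<lambda>T. avg g T 0) \<longlongrightarrow> M) at_top"
    by (rule tendsto_uniform_limitI[OF ul]) simp
  then have "mean g = M" unfolding mean_def by (intro tendsto_Lim) auto
  with ul show ?thesis by simp
qed

lemma tendsto_mean: "bochner_ap g \<Longrightarrow> ((\<lambda>T. avg g T t) \<longlongrightarrow> mean g) at_top"
  by (rule tendsto_uniform_limitI[OF mean_uniform_limit]) auto

lemma mean_eqI: "bochner_ap g \<Longrightarrow> ((\<lambda>T. avg g T t) \<longlongrightarrow> M) at_top \<Longrightarrow> mean g = M"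
  using tendsto_unique[OF _ tendsto_mean] trivial_limit_at_top_linorder by blast

lemma mean_add: "bochner_ap f \<Longrightarrow> bochner_ap g \<Longrightarrow> mean (\<lambda>x. f x + g x) = mean f + mean g"
  by (rule mean_eqI[of _ 0]) (auto intro!: bochner_ap_add tendsto_intros tendsto_mean simp: avg_add)

lemma mean_cmult: "bochner_ap f \<Longrightarrow> mean (\<lambda>x. c * f x) = c * mean f"
  by (rule mean_eqI[of _ 0]) (auto intro!: bochner_ap_cmult tendsto_intros tendsto_mean simp: avg_cmult)

lemma mean_diff: "bochner_ap f \<Longrightarrow> bochner_ap g \<Longrightarrow> mean (\<lambda>x. f x - g x) = mean f - mean g"
  by (rule mean_eqI[of _ 0]) (auto intro!: bochner_ap_diff tendsto_intros tendsto_mean simp: avg_diff)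

lemma mean_const: "mean (\<lambda>x. c) = c"
  by (rule mean_eqI[of _ 0]) (auto intro!: bochner_ap_const simp: avg_const)

lemma mean_sum: "(\<And>i. i \<in> I \<Longrightarrow> bochner_ap (f i)) \<Longrightarrow> mean (\<lambda>x. \<Sum>i\<in>I. f i x) = (\<Sum>i\<in>I. mean (f i))"
  by (induction I rule: infinite_finite_induct) (auto simp: mean_const mean_add bochner_ap_sum)

lemma mean_shift: "bochner_ap f \<Longrightarrow> mean (\<lambda>x. f (x + a)) = mean f"
  by (rule mean_eqI[of _ 0])
     (use tendsto_mean[of f a] in \<open>auto intro!: bochner_ap_shift simp: avg_def add_ac\<close>)

lemma norm_mean_le: "bochner_ap f \<Longrightarrow> (\<And>x. norm (f x) \<le> C) \<Longrightarrow> norm (mean f) \<le> C"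
  by (rule tendsto_upperbound[OF tendsto_norm[OF tendsto_mean[of _ 0]]])
     (auto intro!: always_eventually norm_avg_le bochner_ap_measurable)

lemma norm_mean_diff_le:
  "bochner_ap f \<Longrightarrow> bochner_ap g \<Longrightarrow> (\<And>x. norm (f x - g x) \<le> e) \<Longrightarrow> norm (mean f - mean g) \<le> e"
  using norm_mean_le[of "\<lambda>x. f x - g x" e] by (simp add: bochner_ap_diff mean_diff)

lemma Re_mean_ge:
  assumes "bochner_ap f" "\<And>x. Re (f x) \<ge> c"
  shows "Re (mean f) \<ge> c"
proof (rule tendsto_lowerbound[OF tendsto_Re[OF tendsto_mean[OF assms(1), of 0]]])
  have "c \<le> Re (avg f T 0)" for T
  proof -
    have "(\<integral>s. c \<partial>unif) \<le> (\<integral>s. Re (f (0 + T * s)) \<partial>unif)"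
      using assms by (intro integral_mono integrable_Re integrable_unif_ap) auto
    then show ?thesis
      using integral_Re[OF integrable_unif_ap[OF assms(1), of 0 T]] unif.prob_space by (simp add: avg_def)
  qed
  then show "\<forall>\<^sub>F T in at_top. c \<le> Re (avg f T 0)" by simp
qed simp

text \<open>A shift by half a period reverses the sign, while the mean is invariant under
  shifts.\<close>

lemma mean_cis: "mean (\<lambda>t. cis (y * t)) = (if y = 0 then 1 else 0)"
proof (cases "y = 0")
  case False
  have "mean (\<lambda>t. cis (y * (t + pi / y))) = mean (\<lambda>t. cis (y * t))"
    by (rule mean_shift[OF bochner_ap_cis])
  moreover have "(\<lambda>t. cis (y * (t + pi / y))) = (\<lambda>t. -1 * cis (y * t))"
    using False by (simp add: distrib_left fun_eq_iff flip: cis_mult)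
  ultimately have "-1 * mean (\<lambda>t. cis (y * t)) = mean (\<lambda>t. cis (y * t))"
    using mean_cmult[OF bochner_ap_cis] by metis
  then show ?thesis using False by simp
qed (simp add: mean_const)

lemma bochner_ap_norm_sq: "bochner_ap g \<Longrightarrow> bochner_ap (\<lambda>x. g x * cnj (g x))"
  by (intro bochner_ap_mult bochner_ap_cnj)

text \<open>
  If \<open>h = g \<cdot> cnj g\<close> is positive at \<open>x0\<close>, then finitely many translates of \<open>h\<close> have a sum that is
  bounded below by a positive constant.
\<close>

lemma mean_norm_sq_eq_0:
  assumes "bochner_ap g" "mean (\<lambda>x. g x * cnj (g x)) = 0"
  shows "g x0 = 0"
proof (rule ccontr)
  assume nz: "g x0 \<noteq> 0"
  define h where "h = (\<lambda>x. g x * cnj (g x))"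
  have h: "bochner_ap h" unfolding h_def by (rule bochner_ap_norm_sq) fact
  have h_eq: "h x = of_real ((norm (g x))\<^sup>2)" for x unfolding h_def complex_norm_square ..
  define c where "c = (norm (g x0))\<^sup>2"
  have c: "c / 2 > 0" using nz by (simp add: c_def)
  obtain B where B: "finite B" "\<And>t. \<exists>b\<in>B. \<forall>x. norm (h (x + t) - h (x + b)) \<le> c/2"
    using bochner_apE[OF h c] by blast
  \<comment> \<open>If the translation by \<open>t\<close> is close to that by \<open>b\<close>,
    then the summand of \<open>b\<close> is close to the value \<open>c\<close> of \<open>h\<close>
    at \<open>x0\<close>; the other summands are nonnegative.\<close>
  define k where "k t = (\<Sum>b\<in>B. h (t + (x0 - b)))" for t
  have "Re (mean k) \<ge> c/2"
  proof (rule Re_mean_ge)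
    show "bochner_ap k" unfolding k_def by (intro bochner_ap_sum bochner_ap_shift h)
    fix t
    obtain b where b: "b \<in> B" "norm (h (x0 - b + t) - h (x0 - b + b)) \<le> c/2" using B(2) by blast
    have "Re (h (t + (x0 - b))) \<ge> c/2"
      using b(2) abs_Re_le_cmod[of "h (t + (x0 - b)) - h x0"]
      by (simp add: h_eq c_def add_ac)
    also have "Re (h (t + (x0 - b))) \<le> (\<Sum>b\<in>B. Re (h (t + (x0 - b))))"
      by (rule member_le_sum) (use b B in \<open>auto simp: h_eq\<close>)
    finally show "Re (k t) \<ge> c/2" by (simp add: k_def)
  qed
  moreover have "mean k = (\<Sum>b\<in>B. mean (\<lambda>t. h (t + (x0 - b))))"
    unfolding k_def by (intro mean_sum bochner_ap_shift h)
  moreover have "\<dots> = 0" using mean_shift[OF h] assms(2) by (simp add: h_def)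
  ultimately show False using c by simp
qed

text \<open>Averages of one length \<open>S\<close> control all longer ones. Averaging
  \<open>avg g S\<close> over length \<open>T\<close> keeps the bound \<open>e\<close>; in the
  opposite order the same double average is a mean of \<open>avg g T\<close> over centres at
  distance at most \<open>S\<close> from \<open>t\<close>.\<close>

lemma norm_avg_le_avg:
  assumes "bochner_ap g" "\<And>x. norm (g x) \<le> C" "T > 0" "S > 0" "\<And>t. norm (avg g S t) \<le> e"
  shows "norm (avg g T t) \<le> e + 2 * C * S / T"
proof -
  have meas: "g \<in> borel_measurable borel" by (rule bochner_ap_measurable) fact
  have C: "C \<ge> 0" using assms(2)[of 0] norm_ge_zero order_trans by blast
  have "norm (avg (avg g S) T t) \<le> e"
    by (intro norm_avg_le assms bochner_ap_measurable bochner_ap_avg)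
  moreover have "norm (avg (avg g T) S t - avg g T t) \<le> 2 * C * S / T"
  proof -
    have m[measurable]: "avg g T \<in> borel_measurable borel" by (intro bochner_ap_measurable bochner_ap_avg assms)
    have "norm (\<integral>s. avg g T (t + S * s) - avg g T t \<partial>unif) \<le> (\<integral>s. norm (avg g T (t + S * s) - avg g T t) \<partial>unif)"
      by (rule integral_norm_bound)
    also have "\<dots> \<le> (\<integral>s. 2 * C * S / T \<partial>unif)"
    proof (rule integral_mono_AE)
      show "integrable unif (\<lambda>s. norm (avg g T (t + S * s) - avg g T t))"
        by (intro integrable_norm Bochner_Integration.integrable_diff integrable_unif_ap bochner_ap_avg assms) (rule bochner_ap_const)
      show "AE s in unif. norm (avg g T (t + S * s) - avg g T t) \<le> 2 * C * S / T"
        using AE_unif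
      proof eventually_elim
        case (elim s)
        have "norm (avg g T (t + S * s) - avg g T t) \<le> 2 * C * \<bar>S * s\<bar> / T"
          by (rule norm_avg_shift_le[OF meas assms(2,3)])
        also have "\<dots> \<le> 2 * C * S / T"
          using assms elim C by (intro divide_right_mono mult_left_mono) (auto simp: abs_mult mult_left_le)
        finally show ?case .
      qed
    qed simp
    finally have "norm (\<integral>s. avg g T (t + S * s) - avg g T t \<partial>unif) \<le> 2 * C * S / T"
      using unif.prob_space by simp
    moreover have "(\<integral>s. avg g T (t + S * s) - avg g T t \<partial>unif) = avg (avg g T) S t - avg g T t"
      unfolding avg_def[of "avg g T"] using unif.prob_space integrable_unif_ap[OF bochner_ap_avg[OF assms(1)]] by simp
    ultimately show ?thesis by simp
  qed
  ultimately have "norm (avg (avg g S) T t - (avg (avg g T) S t - avg g T t)) \<le> e + 2 * C * S / T"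
    using norm_triangle_ineq4 add_mono order_trans by blast
  then show ?thesis using avg_avg_commute[OF assms(1), of S T t] by simp
qed

lemma norm_cis_diff_le: "norm (cis a - cis b) \<le> \<bar>a - b\<bar>"
proof -
  have "cis a - cis b = cis b * (cis (a - b) - 1)"
    by (simp add: algebra_simps cis_mult)
  also have "norm \<dots> = norm (cis (a - b) - 1)" by (simp only: norm_mult norm_cis mult_1_left)
  also have "\<dots> = norm (exp (\<i> * of_real (a - b)) - 1)" by (simp only: cis_conv_exp)
  also have "\<dots> \<le> \<bar>a - b\<bar>"
    using iexp_approx1[of "a - b" 0] by simp
  finally show ?thesis .
qed

text \<open>Each frequency \<open>x\<close> has its own good length \<open>S x\<close>. It remains
  good for neighbouring frequencies, finitely many neighbourhoods cover the band, and
  \<open>norm_avg_le_avg\<close> passes from the finitely many lengths to all large ones.\<close>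

lemma avg_uniformly_small:
  assumes g: "bochner_ap g" and zero: "\<And>x. mean (\<lambda>t. g t * cis (x * t)) = 0" and "e > 0"
  obtains T0 where "T0 > 0"
    "\<And>T x t. T \<ge> T0 \<Longrightarrow> \<bar>x\<bar> \<le> X \<Longrightarrow> norm (avg (\<lambda>t. g t * cis (x * t)) T t) \<le> e"
proof -
  obtain C where C: "C > 0" "\<And>x. norm (g x) \<le> C" using bochner_ap_bounded[OF g] by blast
  have apx: "bochner_ap (\<lambda>t. g t * cis (x * t))" for x by (intro bochner_ap_mult bochner_ap_cis g)
  have bx: "norm (g t * cis (x * t)) \<le> C" for x t using C by (simp add: norm_mult)
  have e3: "e/3 > 0" using \<open>e > 0\<close> by simp
  have "\<exists>T>0. \<forall>t. norm (avg (\<lambda>t. g t * cis (x * t)) T t) \<le> e/3" for x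
  proof -
    have "\<forall>\<^sub>F T in at_top. \<forall>t\<in>UNIV. dist (avg (\<lambda>t. g t * cis (x * t)) T t) (mean (\<lambda>t. g t * cis (x * t))) < e/3"
      using mean_uniform_limit[OF apx] e3 by (rule uniform_limitD)
    moreover have "\<forall>\<^sub>F T in at_top. (0::real) < T" by (rule eventually_gt_at_top)
    ultimately have "\<forall>\<^sub>F T in at_top. T > 0 \<and> (\<forall>t. norm (avg (\<lambda>t. g t * cis (x * t)) T t) \<le> e/3)"
      by eventually_elim (auto simp: zero intro: less_imp_le)
    from eventually_happens'[OF _ this] show ?thesis by simp
  qed
  then obtain S where S: "\<And>x. S x > 0" "\<And>x t. norm (avg (\<lambda>t. g t * cis (x * t)) (S x) t) \<le> e/3"
    by metis
  \<comment> \<open>Over a window of half-length \<open>S x\<close>, characters with frequencies at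
    distance \<open>r x\<close> differ by at most \<open>r x * S x\<close>; multiplied by the bound
    \<open>C\<close> this is e/3.\<close>
  define r where "r x = e / (3 * C * S x)" for x
  have r: "r x > 0" for x using \<open>e > 0\<close> C S by (simp add: r_def)
  have near: "norm (avg (\<lambda>t. g t * cis (y * t)) (S x) t) \<le> 2 * e / 3" if "\<bar>y - x\<bar> \<le> r x" for x y t
  proof -
    have [measurable]: "g \<in> borel_measurable borel" by (rule bochner_ap_measurable) fact
    have i: "integrable unif (\<lambda>s. g (t + S x * s) * cis (z * (S x * s)))" for z
      using C by (intro unif.integrable_bounded[where C=C]) (auto simp: norm_mult)
    \<comment> \<open>The phase at the centre \<open>t\<close> splits off as a unimodular factor.
      Without this the comparison of two frequencies would deteriorate as \<open>t\<close>
      grows.\<close>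
    have shift: "avg (\<lambda>t. g t * cis (z * t)) (S x) t = cis (z * t) * (\<integral>s. g (t + S x * s) * cis (z * (S x * s)) \<partial>unif)" for z
      unfolding avg_def by (subst integral_mult_right_zero[symmetric]) (simp add: distrib_left cis_mult[symmetric] mult_ac)
    have "norm ((\<integral>s. g (t + S x * s) * cis (y * (S x * s)) \<partial>unif) - (\<integral>s. g (t + S x * s) * cis (x * (S x * s)) \<partial>unif))
      = norm (\<integral>s. g (t + S x * s) * cis (y * (S x * s)) - g (t + S x * s) * cis (x * (S x * s)) \<partial>unif)"
      using i by simp
    also have "\<dots> \<le> (\<integral>s. norm (g (t + S x * s) * cis (y * (S x * s)) - g (t + S x * s) * cis (x * (S x * s))) \<partial>unif)"
      by (rule integral_norm_bound)
    also have "\<dots> \<le> (\<integral>s. e/3 \<partial>unif)"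
    proof (rule integral_mono_AE)
      show "AE s in unif. norm (g (t + S x * s) * cis (y * (S x * s)) - g (t + S x * s) * cis (x * (S x * s))) \<le> e/3"
        using AE_unif
      proof eventually_elim
        case (elim s)
        have "norm (g (t + S x * s) * (cis (y * (S x * s)) - cis (x * (S x * s)))) \<le> C * (r x * (S x * 1))"
          unfolding norm_mult
        proof (intro mult_mono C)
          have "norm (cis (y * (S x * s)) - cis (x * (S x * s))) \<le> \<bar>y * (S x * s) - x * (S x * s)\<bar>"
            by (rule norm_cis_diff_le)
          also have "\<dots> = \<bar>y - x\<bar> * (S x * \<bar>s\<bar>)"
            using S(1)[of x] by (simp add: abs_mult flip: left_diff_distrib)
          also have "\<dots> \<le> r x * (S x * 1)"
            using that elim S(1)[of x] r[of x] by (intro mult_mono) auto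
          finally show "norm (cis (y * (S x * s)) - cis (x * (S x * s))) \<le> r x * (S x * 1)" .
        qed (use C in auto)
        also have "\<dots> = e/3" using C S(1)[of x] by (simp add: r_def)
        finally show ?case by (simp add: right_diff_distrib)
      qed
    qed (use i in auto)
    also have "\<dots> = e/3" using unif.prob_space by simp
    finally have 1: "norm ((\<integral>s. g (t + S x * s) * cis (y * (S x * s)) \<partial>unif) - (\<integral>s. g (t + S x * s) * cis (x * (S x * s)) \<partial>unif)) \<le> e/3" .
    have 2: "norm (\<integral>s. g (t + S x * s) * cis (x * (S x * s)) \<partial>unif) \<le> e/3"
      using S(2)[of x t] by (simp only: shift norm_mult norm_cis mult_1_left)
    have "norm (\<integral>s. g (t + S x * s) * cis (y * (S x * s)) \<partial>unif) \<le> 2 * e / 3"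
      using norm_triangle_mono[OF 1 2] by simp
    then show ?thesis by (simp only: shift norm_mult norm_cis mult_1_left)
  qed
  have cov: "{-X..X} \<subseteq> (\<Union>x\<in>{-X..X}. ball x (r x))" using r by auto
  obtain D where D: "D \<subseteq> {-X..X}" "finite D" "{-X..X} \<subseteq> (\<Union>x\<in>D. ball x (r x))"
    using compactE_image[OF compact_Icc _ cov] by auto
  define L where "L = 1 + (\<Sum>x\<in>D. S x)"
  have L: "L > 0" unfolding L_def using S by (simp add: add_pos_nonneg sum_nonneg less_imp_le)
  \<comment> \<open>This leaves e/3 for the passage from length \<open>S x\<close> to length
    \<open>T\<close>.\<close>
  define T0 where "T0 = 6 * C * L / e"
  have "T0 > 0" using L C \<open>e > 0\<close> by (simp add: T0_def)
  moreover have "norm (avg (\<lambda>t. g t * cis (y * t)) T t) \<le> e" if "T \<ge> T0" "\<bar>y\<bar> \<le> X" for T y t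
  proof -
    have "y \<in> {-X..X}" using that by auto
    then obtain x where x: "x \<in> D" "\<bar>y - x\<bar> < r x"
      using D(3) by (auto simp: dist_real_def abs_minus_commute dest!: subsetD)
    have "S x \<le> L" unfolding L_def using x D S member_le_sum[of x D S] less_imp_le[OF S(1)] by force
    have "T > 0" using that \<open>T0 > 0\<close> by simp
    have "norm (avg (\<lambda>t. g t * cis (y * t)) T t) \<le> 2 * e / 3 + 2 * C * S x / T"
      by (rule norm_avg_le_avg[OF apx bx \<open>T > 0\<close> S(1) near]) (use x in simp)
    also have "2 * C * S x / T \<le> 2 * C * L / T0"
      using C \<open>S x \<le> L\<close> that \<open>T0 > 0\<close> L by (intro frac_le mult_left_mono) auto
    also have "2 * C * L / T0 = e/3" using C L by (simp add: T0_def)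
    finally show ?thesis by simp
  qed
  ultimately show ?thesis using that by blast
qed

text \<open>The autocorrelation of \<open>g\<close>, a positive definite function: its value at 0 is
  the mean square of \<open>g\<close>, and its spectral measure is the power spectrum of
  \<open>g\<close>.\<close>

definition corr :: "(real \<Rightarrow> complex) \<Rightarrow> real \<Rightarrow> complex" where
  "corr g s = mean (\<lambda>t. g (t + s) * cnj (g t))"

lemma norm_corr_diff_le:
  assumes g: "bochner_ap g" "\<And>x. norm (g x) \<le> C" and e: "\<And>x. norm (g (x + s) - g (x + r)) \<le> e"
  shows "norm (corr g s - corr g r) \<le> C * e"
  unfolding corr_def
proof (rule norm_mean_diff_le)
  fix x
  have C: "C \<ge> 0" using g(2)[of 0] norm_ge_zero order_trans by blast
  have "g (x + s) * cnj (g x) - g (x + r) * cnj (g x) = cnj (g x) * (g (x + s) - g (x + r))"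
    by (simp add: algebra_simps)
  also have "norm \<dots> \<le> C * e" unfolding norm_mult
    by (intro mult_mono) (use e g(2) C in auto)
  finally show "norm (g (x + s) * cnj (g x) - g (x + r) * cnj (g x)) \<le> C * e" .
qed (intro bochner_ap_mult bochner_ap_shift bochner_ap_cnj g)+

text \<open>The continuity and the nets of \<open>g\<close> serve for the correlation as well, up to
  the factor \<open>C\<close> from \<open>norm_corr_diff_le\<close>.\<close>

lemma bochner_ap_corr:
  assumes g: "bochner_ap g" shows "bochner_ap (corr g)"
proof -
  obtain C where C: "C > 0" "\<And>x. norm (g x) \<le> C" using bochner_ap_bounded[OF g] by blast
  show ?thesis unfolding bochner_ap_def
  proof (intro conjI allI impI)
    show "continuous_on UNIV (corr g)"
      unfolding continuous_on_iff dist_norm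
    proof (intro ballI allI impI)
      fix x e :: real assume "e > 0"
      then have "e / (2 * C) > 0" using C by simp
      then obtain d where d: "d > 0" "\<And>x y. \<bar>y - x\<bar> < d \<Longrightarrow> norm (g y - g x) \<le> e / (2 * C)"
        using bochner_ap_uniformly_continuous[OF g] by metis
      have "norm (corr g y - corr g x) < e" if "norm (y - x) < d" for y
      proof -
        have "norm (corr g y - corr g x) \<le> C * (e / (2 * C))"
          by (rule norm_corr_diff_le[OF g C(2)]) (use that d in simp)
        also have "\<dots> < e" using C \<open>e > 0\<close> by simp
        finally show ?thesis .
      qed
      then show "\<exists>d>0. \<forall>y\<in>UNIV. norm (y - x) < d \<longrightarrow> norm (corr g y - corr g x) < e" using d by blast
    qed
    fix e :: real assume "e > 0"
    then have "e / C > 0" using C by simp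
    then obtain B where B: "finite B" "\<And>t. \<exists>b\<in>B. \<forall>x. norm (g (x + t) - g (x + b)) \<le> e / C"
      using bochner_apE[OF g] by blast
    show "\<exists>B. finite B \<and> (\<forall>t. \<exists>b\<in>B. \<forall>x. norm (corr g (x + t) - corr g (x + b)) \<le> e)"
    proof (intro exI[of _ B] conjI allI B(1))
      fix t
      obtain b where b: "b \<in> B" "\<And>x. norm (g (x + t) - g (x + b)) \<le> e / C" using B(2) by blast
      have "norm (corr g (x + t) - corr g (x + b)) \<le> C * (e / C)" for x
        by (rule norm_corr_diff_le[OF g C(2)]) (use b(2)[of "_ + x"] in \<open>simp add: add_ac\<close>)
      then show "\<exists>b\<in>B. \<forall>x. norm (corr g (x + t) - corr g (x + b)) \<le> e" using C b(1) by auto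
    qed
  qed
qed

section \<open>The Fejer kernel\<close>

definition tri :: "real \<Rightarrow> real" where
  "tri x = max 0 (1 - \<bar>x\<bar>)"

text \<open>Division by zero makes the value at 0 equal to 0 instead of the limit 1/2. This is
  invisible to integrals; where the point matters, \<open>fejer_cont\<close> is used.\<close>

definition fejer_fun :: "real \<Rightarrow> real" where
  "fejer_fun s = (1 - cos s) / s\<^sup>2"

text \<open>The number is pi, but it is never evaluated: positivity and the scaling behaviour of the
  integral suffice.\<close>

definition fejer_const :: real where
  "fejer_const = (\<integral>s. fejer_fun s \<partial>lborel)"

definition fejer :: "real measure" where
  "fejer = density lborel (\<lambda>s. ennreal (fejer_fun s / fejer_const))"

lemma tri_simps [simp]: "tri x \<ge> 0" "tri x \<le> 1" "tri (-x) = tri x" "tri 0 = 1"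
  by (auto simp: tri_def)

lemma tri_eq_0: "\<bar>x\<bar> \<ge> 1 \<Longrightarrow> tri x = 0"
  by (auto simp: tri_def)

lemma measurable_fejer_fun [measurable]: "fejer_fun \<in> borel_measurable borel"
  unfolding fejer_fun_def by measurable

lemma fejer_fun_nonneg [simp]: "fejer_fun s \<ge> 0"
  by (simp add: fejer_fun_def)

lemma fejer_fun_minus [simp]: "fejer_fun (-s) = fejer_fun s"
  by (simp add: fejer_fun_def)

lemma one_minus_cos_le: "1 - cos s \<le> s\<^sup>2 / (2::real)"
proof -
  have "1 - cos s = 2 * (sin (s/2))\<^sup>2" using cos_double_sin[of "s/2"] by simp
  also have "(sin (s/2))\<^sup>2 \<le> (s/2)\<^sup>2"
    using abs_sin_x_le_abs_x[of "s/2"] by (simp only: power2_abs abs_le_square_iff)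
  finally show ?thesis by (simp add: power_divide)
qed

lemma integrable_fejer_fun: "integrable lborel fejer_fun"
proof -
  have "integrable lborel (\<lambda>s. 4 * inverse (1 + s\<^sup>2) :: real)"
    using integrable_inverse_1_plus_square by (simp add: set_integrable_def)
  then show ?thesis
  proof (rule Bochner_Integration.integrable_bound)
    have "fejer_fun s \<le> 4 * inverse (1 + s\<^sup>2)" for s
    proof (cases "s = 0")
      case False
      \<comment> \<open>A single majorant for both regimes: this bound handles large
        \<open>s\<close>, \<open>one_minus_cos_le\<close> small \<open>s\<close>, and their sum is
        at most 4 \<open>s\<^sup>2\<close>.\<close>
      have "(1 - cos s) * s\<^sup>2 \<le> 2 * s\<^sup>2" by (intro mult_right_mono) (auto intro: order_trans[OF _ cos_ge_minus_one])
      then have "(1 - cos s) * (1 + s\<^sup>2) \<le> 4 * s\<^sup>2"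
        using one_minus_cos_le[of s] zero_le_power2[of s] unfolding ring_distribs by linarith
      moreover have "1 + s\<^sup>2 > 0" by (simp add: add_pos_nonneg)
      ultimately show ?thesis using False
        by (simp add: fejer_fun_def divide_simps)
    qed (simp add: fejer_fun_def)
    then show "AE s in lborel. norm (fejer_fun s) \<le> norm (4 * inverse (1 + s\<^sup>2))"
      by (intro AE_I2) (simp add: order_trans[OF _ abs_ge_self])
  qed simp
qed

lemma fejer_const_pos: "fejer_const > 0"
proof -
  have c: "cos 1 < (1::real)" using cos_monotone_0_pi[of 0 1] pi_gt3 by simp
  have "(\<integral>s. (1 - cos 1) / 4 * indicator {1..2::real} s \<partial>lborel) \<le> (\<integral>s. fejer_fun s \<partial>lborel)"
  proof (rule integral_mono)
    fix s :: real
    have "(1 - cos 1) / 4 \<le> fejer_fun s" if s: "s \<in> {1..2}"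
      unfolding fejer_fun_def
    proof (rule frac_le)
      show "1 - cos 1 \<le> 1 - cos s" using s pi_gt3 cos_monotone_0_pi_le[of 1 s] by simp
      show "s\<^sup>2 \<le> 4" using s power_mono[of s 2 2] by simp
    qed (use s in auto)
    then show "(1 - cos 1) / 4 * indicator {1..2} s \<le> fejer_fun s"
      by (auto split: split_indicator)
  qed (auto intro: integrable_fejer_fun)
  then show ?thesis using c by (simp add: fejer_const_def)
qed

text \<open>The substitution of \<open>a * s\<close> gives \<open>a\<^sup>2\<close> from the
  denominator against the Jacobian \<bar>a\<bar>. The kink of the remaining factor \<bar>a\<bar> is
  what produces the triangle in \<open>char_fejer\<close>.\<close>

lemma
  shows integrable_one_minus_cos: "integrable lborel (\<lambda>s. (1 - cos (a * s)) / s\<^sup>2)"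
    and integral_one_minus_cos: "(\<integral>s. (1 - cos (a * s)) / s\<^sup>2 \<partial>lborel) = \<bar>a\<bar> * fejer_const"
proof -
  have eq: "fejer_fun (0 + a * s) = (1 - cos (a * s)) / s\<^sup>2 / a\<^sup>2" for s
    by (simp add: fejer_fun_def power_mult_distrib mult.commute)
  have "integrable lborel (\<lambda>s. (1 - cos (a * s)) / s\<^sup>2) \<and>
      (\<integral>s. (1 - cos (a * s)) / s\<^sup>2 \<partial>lborel) = \<bar>a\<bar> * fejer_const"
  proof (cases "a = 0")
    case False
    have "integrable lborel (\<lambda>s. fejer_fun (0 + a * s))"
      using False integrable_fejer_fun by (rule lborel_integrable_real_affine[rotated])
    then have "integrable lborel (\<lambda>s. (1 - cos (a * s)) / s\<^sup>2 / a\<^sup>2 * a\<^sup>2)"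
      unfolding eq by (intro integrable_mult_left[where c="a\<^sup>2"])
    moreover have "(1 - cos (a * s)) / s\<^sup>2 / a\<^sup>2 * a\<^sup>2 = (1 - cos (a * s)) / s\<^sup>2" for s
      using False by simp
    ultimately have "integrable lborel (\<lambda>s. (1 - cos (a * s)) / s\<^sup>2)" by (simp only:)
    moreover have "fejer_const = \<bar>a\<bar> *\<^sub>R (\<integral>s. fejer_fun (0 + a * s) \<partial>lborel)"
      unfolding fejer_const_def by (rule lborel_integral_real_affine) fact
    then have "\<bar>a\<bar> * fejer_const = (\<bar>a\<bar> * \<bar>a\<bar>) * ((\<integral>s. (1 - cos (a * s)) / s\<^sup>2 \<partial>lborel) / a\<^sup>2)"
      unfolding eq integral_divide_zero real_scaleR_def by (metis mult.assoc)
    then have "(\<integral>s. (1 - cos (a * s)) / s\<^sup>2 \<partial>lborel) = \<bar>a\<bar> * fejer_const"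
      using False by (simp add: power2_eq_square)
    ultimately show ?thesis by blast
  qed simp
  then show "integrable lborel (\<lambda>s. (1 - cos (a * s)) / s\<^sup>2)"
    "(\<integral>s. (1 - cos (a * s)) / s\<^sup>2 \<partial>lborel) = \<bar>a\<bar> * fejer_const" by auto
qed

lemma real_distribution_fejer: "real_distribution fejer"
proof -
  have "prob_space fejer"
  proof
    have "emeasure fejer (space fejer) = (\<integral>\<^sup>+s. ennreal (fejer_fun s / fejer_const) \<partial>lborel)"
      unfolding fejer_def by (subst emeasure_density) auto
    also have "\<dots> = ennreal (\<integral>s. fejer_fun s / fejer_const \<partial>lborel)"
      using fejer_const_pos integrable_fejer_fun by (intro nn_integral_eq_integral) auto
    also have "\<dots> = 1" using fejer_const_pos by (simp add: fejer_const_def)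
    finally show "emeasure fejer (space fejer) = 1" .
  qed
  then show ?thesis
    by (simp add: real_distribution_def real_distribution_axioms_def fejer_def)
qed

interpretation fejer: real_distribution fejer
  by (rule real_distribution_fejer)

lemma integral_fejer:
  fixes f :: "real \<Rightarrow> 'a::{banach, second_countable_topology}"
  assumes [measurable]: "f \<in> borel_measurable borel"
  shows "(\<integral>s. f s \<partial>fejer) = (\<integral>s. (fejer_fun s / fejer_const) *\<^sub>R f s \<partial>lborel)"
  unfolding fejer_def using fejer_const_pos by (subst integral_density) auto

text \<open>The product (1 - cos s) cos(x s) is a combination of terms 1 - cos(a s) with a = 1 + x,
  1 - x and x. Their integrals give (\<bar>1 + x\<bar> + \<bar>1 - x\<bar>) / 2 - \<bar>x\<bar>,
  which is the triangle; the sine part vanishes by oddness.\<close>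

lemma char_fejer: "(\<integral>s. cis (x * s) \<partial>fejer) = of_real (tri x)"
proof -
  have int: "integrable fejer (\<lambda>s. cis (x * s))"
    by (rule fejer.integrable_bounded[where C=1]) auto
  have re: "(\<integral>s. cos (x * s) \<partial>fejer) = tri x"
  proof -
    have "(\<integral>s. cos (x * s) \<partial>fejer) = (\<integral>s. (1/2 * ((1 - cos ((1+x) * s)) / s\<^sup>2) +
        1/2 * ((1 - cos ((1-x) * s)) / s\<^sup>2) - (1 - cos (x * s)) / s\<^sup>2) / fejer_const \<partial>lborel)"
    proof (subst integral_fejer, simp, intro Bochner_Integration.integral_cong refl)
      fix s :: real
      have "1/2 * (1 - cos ((1+x) * s)) + 1/2 * (1 - cos ((1-x) * s)) - (1 - cos (x * s)) = (1 - cos s) * cos (x * s)"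
        by (simp add: distrib_right left_diff_distrib cos_add cos_diff)
          (simp add: algebra_simps add_divide_distrib diff_divide_distrib)
      note H = this
      have split: "(1/2 * A + 1/2 * B - D) / q / c = (1/2 * (A / q) + 1/2 * (B / q) - D / q) / c" for A B D q c :: real
        by (simp add: add_divide_distrib diff_divide_distrib)
      have "(fejer_fun s / fejer_const) *\<^sub>R cos (x * s) = (1 - cos s) * cos (x * s) / s\<^sup>2 / fejer_const"
        by (simp add: fejer_fun_def)
      also have "\<dots> = (1/2 * (1 - cos ((1+x) * s)) + 1/2 * (1 - cos ((1-x) * s)) - (1 - cos (x * s))) / s\<^sup>2 / fejer_const"
        by (simp only: H)
      also have "\<dots> = (1/2 * ((1 - cos ((1+x) * s)) / s\<^sup>2) +
        1/2 * ((1 - cos ((1-x) * s)) / s\<^sup>2) - (1 - cos (x * s)) / s\<^sup>2) / fejer_const"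
        by (rule split)
      finally show "(fejer_fun s / fejer_const) *\<^sub>R cos (x * s) = (1/2 * ((1 - cos ((1+x) * s)) / s\<^sup>2) +
        1/2 * ((1 - cos ((1-x) * s)) / s\<^sup>2) - (1 - cos (x * s)) / s\<^sup>2) / fejer_const" .
    qed
    also have "\<dots> = (1/2 * (\<bar>1+x\<bar> * fejer_const) + 1/2 * (\<bar>1-x\<bar> * fejer_const) - \<bar>x\<bar> * fejer_const) / fejer_const"
    proof -
      have "(\<integral>s. 1/2 * ((1 - cos ((1+x) * s)) / s\<^sup>2) + 1/2 * ((1 - cos ((1-x) * s)) / s\<^sup>2) - (1 - cos (x * s)) / s\<^sup>2 \<partial>lborel)
        = 1/2 * (\<integral>s. (1 - cos ((1+x) * s)) / s\<^sup>2 \<partial>lborel) + 1/2 * (\<integral>s. (1 - cos ((1-x) * s)) / s\<^sup>2 \<partial>lborel)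
          - (\<integral>s. (1 - cos (x * s)) / s\<^sup>2 \<partial>lborel)"
        by (subst Bochner_Integration.integral_diff Bochner_Integration.integral_add integral_mult_right_zero;
            (intro Bochner_Integration.integrable_add integrable_mult_right integrable_one_minus_cos refl)?)+
      then show ?thesis
        by (simp only: integral_divide_zero integral_one_minus_cos)
    qed
    also have "\<dots> = tri x" using fejer_const_pos
      by (simp add: tri_def field_simps abs_if max_def)
    finally show ?thesis .
  qed
  have im: "(\<integral>s. sin (x * s) \<partial>fejer) = 0"
  proof -
    have "(\<integral>s. sin (x * s) \<partial>fejer) = (\<integral>s. (fejer_fun s / fejer_const) * sin (x * s) \<partial>lborel)"
      by (subst integral_fejer) auto
    note X = this
    have "(\<integral>s. (fejer_fun s / fejer_const) * sin (x * s) \<partial>lborel) = \<bar>-1\<bar> *\<^sub>R (\<integral>s. (fejer_fun (0 + -1 * s) / fejer_const) * sin (x * (0 + -1 * s)) \<partial>lborel)"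
      by (rule lborel_integral_real_affine) simp
    also have "\<dots> = - (\<integral>s. (fejer_fun s / fejer_const) * sin (x * s) \<partial>lborel)"
      by simp
    finally show ?thesis using X by simp
  qed
  show ?thesis
  proof (rule complex_eqI)
    show "Re (\<integral>s. cis (x * s) \<partial>fejer) = Re (of_real (tri x))"
      using integral_Re[OF int] re by simp
    show "Im (\<integral>s. cis (x * s) \<partial>fejer) = Im (of_real (tri x))"
      using integral_Im[OF int] im by simp
  qed
qed

section \<open>Approximate identities\<close>

lemma (in real_distribution) tail_small:
  assumes "e > 0"
  obtains R where "R > 0" "prob {s. \<bar>s\<bar> \<ge> R} \<le> e"
proof -
  have "(\<lambda>n. prob {s. \<bar>s\<bar> \<ge> real n}) \<longlonglongrightarrow> prob (\<Inter>n. {s. \<bar>s\<bar> \<ge> real n})"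
    by (rule finite_Lim_measure_decseq) (auto simp: decseq_def intro: order_trans[rotated])
  moreover have "(\<Inter>n. {s. \<bar>s\<bar> \<ge> real n}) = {}"
  proof -
    have "\<exists>n. \<not> real n \<le> \<bar>x\<bar>" for x using reals_Archimedean2[of "\<bar>x\<bar>"] by (simp add: not_le)
    then show ?thesis by auto
  qed
  ultimately have "(\<lambda>n. prob {s. \<bar>s\<bar> \<ge> real n}) \<longlonglongrightarrow> 0" by simp
  then have "\<forall>\<^sub>F n in sequentially. prob {s. \<bar>s\<bar> \<ge> real n} < e" using assms by (rule order_tendstoD)
  moreover have "\<forall>\<^sub>F n in sequentially. n > (0::nat)" by (rule eventually_gt_at_top)
  ultimately have "\<forall>\<^sub>F n in sequentially. n > 0 \<and> prob {s. \<bar>s\<bar> \<ge> real n} < e" by eventually_elim simp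
  from eventually_happens'[OF _ this] show ?thesis using that[of "real _"] by (auto intro: less_imp_le)
qed

text \<open>The scale \<open>a0\<close> depends on \<open>g\<close> only through the bound
  \<open>C\<close> and the local modulus \<open>d\<close>, so that one scale serves all Riesz sums
  in \<open>riesz_uniformly_Cauchy\<close>. The tail beyond \<open>R\<close> costs 2 C times e/(4
  C).\<close>

lemma (in real_distribution) approximate_identity:
  assumes "C > 0" "e > 0" "d > 0"
  obtains a0 where "a0 > 0"
    "\<And>a (g :: real \<Rightarrow> complex) t. \<bar>a\<bar> \<le> a0 \<Longrightarrow> g \<in> borel_measurable borel \<Longrightarrow> (\<And>x. norm (g x) \<le> C) \<Longrightarrow>
      (\<And>u. \<bar>u\<bar> < d \<Longrightarrow> norm (g (t + u) - g t) \<le> e / 2) \<Longrightarrow>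
      norm ((\<integral>s. g (t + a * s) \<partial>M) - g t) \<le> e"
proof -
  have "e / (4 * C) > 0" using assms by simp
  then obtain R where R: "R > 0" "prob {s. \<bar>s\<bar> \<ge> R} \<le> e / (4 * C)" by (rule tail_small)
  define a0 where "a0 = d / (2 * R)"
  have "a0 > 0" using R assms by (simp add: a0_def)
  moreover have "norm ((\<integral>s. g (t + a * s) \<partial>M) - g t) \<le> e"
    if a: "\<bar>a\<bar> \<le> a0" and [measurable]: "g \<in> borel_measurable borel" and C: "\<And>x. norm (g x) \<le> C"
      and g: "\<And>u. \<bar>u\<bar> < d \<Longrightarrow> norm (g (t + u) - g t) \<le> e / 2" for a t and g :: "real \<Rightarrow> complex"
  proof -
    have i: "integrable M (\<lambda>s. g (t + a * s))" using C by (intro integrable_bounded[where C=C]) auto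
    have "(\<integral>s. g (t + a * s) \<partial>M) - g t = (\<integral>s. g (t + a * s) - g t \<partial>M)"
      using i prob_space by simp
    also have "norm \<dots> \<le> (\<integral>s. norm (g (t + a * s) - g t) \<partial>M)" by (rule integral_norm_bound)
    also have "\<dots> \<le> (\<integral>s. e / 2 + 2 * C * indicator {s. \<bar>s\<bar> \<ge> R} s \<partial>M)"
    proof (rule integral_mono)
      fix s
      have "norm (g (t + a * s) - g t) \<le> e / 2" if "\<bar>s\<bar> < R"
      proof (rule g)
        have "\<bar>a * s\<bar> \<le> a0 * R" unfolding abs_mult using a that by (intro mult_mono) auto
        also have "\<dots> < d" using R assms by (simp add: a0_def)
        finally show "\<bar>a * s\<bar> < d" .
      qed
      moreover have "norm (g (t + a * s) - g t) \<le> e / 2 + 2 * C"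
        using norm_triangle_ineq4[of "g (t + a * s)" "g t"] C[of "t + a * s"] C[of t] assms by simp
      ultimately show "norm (g (t + a * s) - g t) \<le> e / 2 + 2 * C * indicator {s. \<bar>s\<bar> \<ge> R} s"
        by (auto split: split_indicator)
    next
      show "integrable M (\<lambda>s. norm (g (t + a * s) - g t))"
        using i by (intro integrable_norm Bochner_Integration.integrable_diff) auto
      show "integrable M (\<lambda>s. e / 2 + 2 * C * indicator {s. \<bar>s\<bar> \<ge> R} s)"
        by (intro Bochner_Integration.integrable_add integrable_mult_right) (auto simp: emeasure_eq_measure)
    qed
    also have "\<dots> = e / 2 + 2 * C * prob {s. \<bar>s\<bar> \<ge> R}"
      using prob_space by (subst Bochner_Integration.integral_add) (auto simp: emeasure_eq_measure)
    also have "\<dots> \<le> e / 2 + 2 * C * (e / (4 * C))" using R assms by (intro add_left_mono mult_left_mono) auto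
    also have "\<dots> = e" using assms by (simp add: field_simps)
    finally show ?thesis .
  qed
  ultimately show ?thesis using that by blast
qed

lemma bochner_ap_approximate_identity:
  assumes g: "bochner_ap g" and "real_distribution M" and "e > 0"
  obtains a0 where "a0 > 0"
    "\<And>a t. \<bar>a\<bar> \<le> a0 \<Longrightarrow> norm ((\<integral>s. g (t + a * s) \<partial>M) - g t) \<le> e"
proof -
  interpret real_distribution M by fact
  obtain C where C: "C > 0" "\<And>x. norm (g x) \<le> C" using bochner_ap_bounded[OF g] by blast
  have "e / 2 > 0" using \<open>e > 0\<close> by simp
  from bochner_ap_uniformly_continuous[OF g this] obtain d
    where d: "d > 0" "\<And>x y. \<bar>y - x\<bar> < d \<Longrightarrow> norm (g y - g x) \<le> e / 2" by blast
  obtain a0 where a0: "a0 > 0" "\<And>a g t. \<bar>a\<bar> \<le> a0 \<Longrightarrow> g \<in> borel_measurable borel \<Longrightarrow> (\<And>x. norm (g x :: complex) \<le> C) \<Longrightarrow>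
      (\<And>u. \<bar>u\<bar> < d \<Longrightarrow> norm (g (t + u) - g t) \<le> e / 2) \<Longrightarrow> norm ((\<integral>s. g (t + a * s) \<partial>M) - g t) \<le> e"
    using approximate_identity[OF C(1) \<open>e > 0\<close> d(1)] by blast
  show ?thesis
    by (rule that[OF a0(1)], rule a0(2)) (use C d bochner_ap_measurable[OF g] in auto)
qed

section \<open>The triangular distribution, dual to the Fejer kernel\<close>

definition tri_dist :: "real measure" where
  "tri_dist = density lborel (\<lambda>x. ennreal (tri x))"

text \<open>The Fejer kernel normalized and continuous at 0: the factor 2 matches the limit 1/2 of
  (1 - cos y) / \<open>y\<^sup>2\<close>. In this form it is the transform of \<open>tri\<close> at
  every point.\<close>

definition fejer_cont :: "real \<Rightarrow> real" where
  "fejer_cont y = (if y = 0 then 1 else 2 * fejer_fun y)"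

lemma measurable_tri [measurable]: "tri \<in> borel_measurable borel"
  unfolding tri_def[abs_def] by measurable

lemma measurable_fejer_cont [measurable]: "fejer_cont \<in> borel_measurable borel"
  unfolding fejer_cont_def[abs_def] by measurable

lemma fejer_cont_nonneg [simp]: "fejer_cont y \<ge> 0"
  by (simp add: fejer_cont_def)

lemma fejer_cont_le_1: "fejer_cont y \<le> 1"
  using one_minus_cos_le[of y] by (auto simp: fejer_cont_def fejer_fun_def divide_simps)

text \<open>Integration by parts on [0,1], then evenness of the cosine part and oddness of the sine
  part. The case y = 0 is separate because the antiderivative \<open>H\<close> divides by
  \<open>y\<close>.\<close>

lemma has_bochner_integral_tri_cis:
  "has_bochner_integral lborel (\<lambda>x. tri x *\<^sub>R cis (x * y)) (of_real (fejer_cont y))"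
proof -
  have int: "integrable lborel (\<lambda>x. tri x *\<^sub>R cis (x * y))"
  proof (rule Bochner_Integration.integrable_bound)
    show "integrable lborel (\<lambda>x. indicator {-1..1::real} x :: real)" by simp
    show "AE x in lborel. norm (tri x *\<^sub>R cis (x * y)) \<le> norm (indicator {-1..1} x :: real)"
      by (intro AE_I2) (auto simp: tri_def split: split_indicator)
  qed measurable
  have 0: "((\<lambda>x. (1 - x) * cos (x * y)) has_integral (if y = 0 then 1/2 else (1 - cos y) / y\<^sup>2)) {0..1}"
  proof (cases "y = 0")
    case True
    have "((\<lambda>x. 1 - x) has_integral ((1 - 1\<^sup>2/2) - (0 - 0\<^sup>2/2))) {0..1::real}"
      by (intro fundamental_theorem_of_calculus)
        (auto intro!: derivative_eq_intros simp flip: has_real_derivative_iff_has_vector_derivative)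
    then show ?thesis using True by simp
  next
    case False
    define H where "H x = (1 - x) * sin (x * y) / y - cos (x * y) / y\<^sup>2" for x
    have "((\<lambda>x. (1 - x) * cos (x * y)) has_integral (H 1 - H 0)) {0..1}"
    proof (rule fundamental_theorem_of_calculus)
      fix x :: real
      have "(H has_real_derivative (1 - x) * cos (x * y)) (at x within {0..1})"
        unfolding H_def using False
        by (auto intro!: derivative_eq_intros simp: field_simps power2_eq_square)
      then show "(H has_vector_derivative (1 - x) * cos (x * y)) (at x within {0..1})"
        by (simp add: has_real_derivative_iff_has_vector_derivative)
    qed simp
    moreover have "H 1 - H 0 = (1 - cos y) / y\<^sup>2" by (simp add: H_def diff_divide_distrib)
    ultimately show ?thesis using False by simp
  qed
  have pos: "((\<lambda>x. tri x * cos (x * y)) has_integral (if y = 0 then 1/2 else (1 - cos y) / y\<^sup>2)) {0..1}"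
    by (rule has_integral_eq[OF _ 0]) (auto simp: tri_def)
  have "((\<lambda>x. tri (-x) * cos ((-x) * y)) has_integral (if y = 0 then 1/2 else (1 - cos y) / y\<^sup>2)) {-1..-0}"
    using pos by (subst has_integral_reflect_real) auto
  then have neg: "((\<lambda>x. tri x * cos (x * y)) has_integral (if y = 0 then 1/2 else (1 - cos y) / y\<^sup>2)) {-1..0}"
    by simp
  have "((\<lambda>x. tri x * cos (x * y)) has_integral
      (if y = 0 then 1/2 else (1 - cos y) / y\<^sup>2) + (if y = 0 then 1/2 else (1 - cos y) / y\<^sup>2)) {-1..1}"
    by (rule has_integral_combine[OF _ _ neg pos]) auto
  then have "((\<lambda>x. tri x * cos (x * y)) has_integral fejer_cont y) {-1..1}"
    by (simp add: fejer_cont_def fejer_fun_def split: if_splits)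
  then have "((\<lambda>x. tri x * cos (x * y)) has_integral fejer_cont y) UNIV"
    by (rule has_integral_on_superset) (auto simp: tri_def)
  moreover have "((\<lambda>x. tri x * cos (x * y)) has_integral (\<integral>x. tri x * cos (x * y) \<partial>lborel)) UNIV"
    using integrable_Re[OF int] by (intro has_integral_integral_lborel) simp
  ultimately have re: "(\<integral>x. tri x * cos (x * y) \<partial>lborel) = fejer_cont y"
    using has_integral_unique by blast
  have "(\<integral>x. tri x * sin (x * y) \<partial>lborel) = \<bar>-1\<bar> *\<^sub>R (\<integral>x. tri (0 + -1 * x) * sin ((0 + -1 * x) * y) \<partial>lborel)"
    by (rule lborel_integral_real_affine) simp
  then have im: "(\<integral>x. tri x * sin (x * y) \<partial>lborel) = 0" by simp
  have "(\<integral>x. tri x *\<^sub>R cis (x * y) \<partial>lborel) = of_real (fejer_cont y)"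
    by (rule complex_eqI)
      (use re im integral_Re[OF int] integral_Im[OF int] in simp_all)
  with int show ?thesis by (simp add: has_bochner_integral_iff)
qed

lemma real_distribution_tri_dist: "real_distribution tri_dist"
proof -
  have "(\<lambda>x. tri x *\<^sub>R cis (x * 0)) = (\<lambda>x. complex_of_real (tri x))"
    by (simp add: fun_eq_iff scaleR_conv_of_real)
  with has_bochner_integral_tri_cis[of 0] have "has_bochner_integral lborel (\<lambda>x. Re (complex_of_real (tri x))) (Re 1)"
    by (intro has_bochner_integral_Re) (simp add: fejer_cont_def)
  then have *: "integrable lborel tri" "(\<integral>x. tri x \<partial>lborel) = 1" by (auto simp: has_bochner_integral_iff)
  have "prob_space tri_dist"
  proof
    have "emeasure tri_dist (space tri_dist) = (\<integral>\<^sup>+s. ennreal (tri s) \<partial>lborel)"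
      unfolding tri_dist_def by (subst emeasure_density) auto
    also have "\<dots> = ennreal (\<integral>s. tri s \<partial>lborel)"
      using * by (intro nn_integral_eq_integral) auto
    also have "\<dots> = 1" using * by simp
    finally show "emeasure tri_dist (space tri_dist) = 1" .
  qed
  then show ?thesis
    by (simp add: real_distribution_def real_distribution_axioms_def tri_dist_def)
qed

lemma char_tri_dist: "(\<integral>x. cis (x * y) \<partial>tri_dist) = of_real (fejer_cont y)"
  using has_bochner_integral_tri_cis[of y] unfolding tri_dist_def
  by (subst integral_density) (auto simp: has_bochner_integral_iff)

lemma AE_tri_dist: "AE x in tri_dist. \<bar>x\<bar> \<le> 1"
  unfolding tri_dist_def by (subst AE_density) (auto simp: tri_def)

lemma AE_fejer_cont: "AE y in lborel. fejer_cont y = 2 * fejer_fun y"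
  using AE_lborel_singleton[of 0] by eventually_elim (simp add: fejer_cont_def)

lemma integrable_fejer_cont: "integrable lborel fejer_cont"
  using integrable_fejer_fun AE_fejer_cont
  by (subst integrable_cong_AE[where g="\<lambda>y. 2 * fejer_fun y"]) auto

lemma integral_fejer_cont:
  fixes f :: "real \<Rightarrow> complex"
  assumes [measurable]: "f \<in> borel_measurable borel"
  shows "(\<integral>y. fejer_cont y *\<^sub>R f y \<partial>lborel) = (2 * fejer_const) *\<^sub>R (\<integral>y. f y \<partial>fejer)"
proof -
  have "(\<integral>y. fejer_cont y *\<^sub>R f y \<partial>lborel) = (\<integral>y. (2 * fejer_const) *\<^sub>R ((fejer_fun y / fejer_const) *\<^sub>R f y) \<partial>lborel)"
    using AE_fejer_cont fejer_const_pos by (intro integral_cong_AE) auto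
  then show ?thesis by (simp only: integral_scaleR_right integral_fejer[OF assms])
qed

section \<open>Uniqueness of Bohr coefficients\<close>

text \<open>Each average commutes with the integral by Fubini, and dominated convergence along
  integer lengths does the rest. Almost periodicity of the integrated function is a hypothesis
  because it does not follow: \<open>cis (s * t)\<close> integrated over \<open>s\<close> against
  \<open>unif\<close> tends to 0 as \<open>t\<close> grows.\<close>

lemma mean_integral_prob_space:
  fixes f :: "'a \<Rightarrow> real \<Rightarrow> complex"
  assumes "prob_space M" and [measurable]: "case_prod f \<in> borel_measurable (M \<Otimes>\<^sub>M borel)"
    and C: "\<And>s t. norm (f s t) \<le> C" and f: "\<And>s. bochner_ap (f s)" and int: "bochner_ap (\<lambda>t. \<integral>s. f s t \<partial>M)"
  shows "mean (\<lambda>t. \<integral>s. f s t \<partial>M) = (\<integral>s. mean (f s) \<partial>M)"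
proof -
  interpret prob_space M by fact
  have [measurable]: "f s \<in> borel_measurable borel" for s by (intro bochner_ap_measurable f)
  have swap: "avg (\<lambda>t. \<integral>s. f s t \<partial>M) T 0 = (\<integral>s. avg (f s) T 0 \<partial>M)" for T
  proof -
    have "(\<lambda>(u, s). f s (0 + T * u)) \<in> borel_measurable (unif \<Otimes>\<^sub>M M)" by measurable
    then show ?thesis unfolding avg_def
      by (rule pair_prob_space_swap[OF unif.prob_space_axioms assms(1)]) (rule C)
  qed
  have seq: "(\<lambda>n. avg h (real n) 0) \<longlonglongrightarrow> mean h" if "bochner_ap h" for h
    using tendsto_mean[OF that] filterlim_real_sequentially by (rule filterlim_compose)
  have m: "(\<lambda>s. avg (f s) T 0) \<in> borel_measurable M" for T unfolding avg_def by measurable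
  have "(\<lambda>n. \<integral>s. avg (f s) (real n) 0 \<partial>M) \<longlonglongrightarrow> (\<integral>s. mean (f s) \<partial>M)"
  proof (rule integral_dominated_convergence[where w="\<lambda>_. C"])
    show "(\<lambda>s. mean (f s)) \<in> borel_measurable M"
      by (rule borel_measurable_LIMSEQ_metric[OF m seq[OF f]])
    show "AE s in M. norm (avg (f s) (real n) 0) \<le> C" for n
      by (intro AE_I2 norm_avg_le C) measurable
  qed (auto intro: m seq f)
  then have "(\<lambda>n. avg (\<lambda>t. \<integral>s. f s t \<partial>M) (real n) 0) \<longlonglongrightarrow> (\<integral>s. mean (f s) \<partial>M)"
    by (simp add: swap)
  then show ?thesis using seq[OF int] LIMSEQ_unique by blast
qed

lemma mean_integral:
  fixes f :: "real \<Rightarrow> real \<Rightarrow> complex"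
  assumes "real_distribution M" and "case_prod f \<in> borel_measurable (borel \<Otimes>\<^sub>M borel)"
    and C: "\<And>s t. norm (f s t) \<le> C" and f: "\<And>s. bochner_ap (f s)" and int: "bochner_ap (\<lambda>t. \<integral>s. f s t \<partial>M)"
  shows "mean (\<lambda>t. \<integral>s. f s t \<partial>M) = (\<integral>s. mean (f s) \<partial>M)"
proof (rule mean_integral_prob_space[OF _ _ C f int])
  interpret real_distribution M by fact
  show "prob_space M" by unfold_locales
  show "case_prod f \<in> borel_measurable (M \<Otimes>\<^sub>M borel)"
    using assms(2) by (simp cong: measurable_cong_sets sets_pair_measure_cong)
qed

lemma mean_cnj: "bochner_ap f \<Longrightarrow> mean (\<lambda>x. cnj (f x)) = cnj (mean f)"
  using tendsto_cnj[OF tendsto_mean[of f 0]]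
  by (intro mean_eqI[of _ 0] bochner_ap_cnj) (simp_all add: avg_def)

text \<open>Modulation translates the spectrum, so facts proved for the frequency 0 hold at every
  frequency.\<close>

lemma corr_modulate:
  assumes "bochner_ap g"
  shows "corr (\<lambda>t. g t * cis (x * t)) s = corr g s * cis (x * s)"
proof -
  have "cis (x * (t + s)) * cnj (cis (x * t)) = cis (x * s)" for t
    by (simp add: cis_cnj cis_mult algebra_simps)
  then have "(g (t + s) * cis (x * (t + s))) * cnj (g t * cis (x * t)) = cis (x * s) * (g (t + s) * cnj (g t))" for t
    by (metis (no_types, lifting) complex_cnj_mult mult.assoc mult.commute)
  then have "corr (\<lambda>t. g t * cis (x * t)) s = mean (\<lambda>t. cis (x * s) * (g (t + s) * cnj (g t)))"
    unfolding corr_def by presburger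
  also have "\<dots> = cis (x * s) * corr g s"
    unfolding corr_def by (intro mean_cmult bochner_ap_mult bochner_ap_shift bochner_ap_cnj assms)
  finally show ?thesis by (simp only: mult.commute)
qed

text \<open>The square is expanded and the mean moved inside. The left side is visibly nonnegative:
  this is how positive definiteness of the correlation enters.\<close>

lemma mean_avg_norm_sq:
  assumes g: "bochner_ap g"
  shows "mean (\<lambda>t. avg g S t * cnj (avg g S t)) = (\<integral>u'. \<integral>u. corr g (S * (u - u')) \<partial>unif \<partial>unif)"
proof -
  obtain C where C: "C > 0" "\<And>x. norm (g x) \<le> C" using bochner_ap_bounded[OF g] by blast
  have [measurable]: "g \<in> borel_measurable borel" by (rule bochner_ap_measurable) fact
  have [measurable]: "avg g S \<in> borel_measurable borel" by (intro bochner_ap_measurable bochner_ap_avg g)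
  have bnd: "norm (a * cnj b) \<le> C * C" if "norm a \<le> C" "norm b \<le> C" for a b
    using that C by (simp add: norm_mult mult_mono)
  have inner: "(\<lambda>t. avg g S t * cnj (g (t + b))) = (\<lambda>t. \<integral>u. g (t + S * u) * cnj (g (t + b)) \<partial>unif)" for b
    by (simp add: avg_def)
  have outer: "(\<lambda>t. avg g S t * cnj (avg g S t)) = (\<lambda>t. \<integral>u'. avg g S t * cnj (g (t + S * u')) \<partial>unif)"
    by (simp add: avg_def[of g S])
  have 1: "mean (\<lambda>t. g (t + a) * cnj (g (t + b))) = corr g (a - b)" for a b
  proof -
    have "corr g (a - b) = mean (\<lambda>t. g (t + b + (a - b)) * cnj (g (t + b)))"
      unfolding corr_def
      by (rule mean_shift[of "\<lambda>t. g (t + (a - b)) * cnj (g t)" b, symmetric]) (intro bochner_ap_mult bochner_ap_shift bochner_ap_cnj g)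
    then show ?thesis by simp
  qed
  have 2: "mean (\<lambda>t. avg g S t * cnj (g (t + b))) = (\<integral>u. corr g (S * u - b) \<partial>unif)" for b
  proof -
    have "mean (\<lambda>t. avg g S t * cnj (g (t + b))) = (\<integral>u. mean (\<lambda>t. g (t + S * u) * cnj (g (t + b))) \<partial>unif)"
      unfolding inner
    proof (rule mean_integral[OF real_distribution_unif, where C="C * C"])
      show "bochner_ap (\<lambda>t. \<integral>u. g (t + S * u) * cnj (g (t + b)) \<partial>unif)"
        unfolding inner[symmetric] by (intro bochner_ap_mult bochner_ap_avg bochner_ap_cnj bochner_ap_shift g)
    qed (auto intro!: bochner_ap_mult bochner_ap_cnj bochner_ap_shift g bnd C)
    then show ?thesis by (simp only: 1)
  qed
  have "mean (\<lambda>t. avg g S t * cnj (avg g S t)) = (\<integral>u'. mean (\<lambda>t. avg g S t * cnj (g (t + S * u'))) \<partial>unif)"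
    unfolding outer
  proof (rule mean_integral[OF real_distribution_unif, where C="C * C"])
    show "bochner_ap (\<lambda>t. \<integral>u'. avg g S t * cnj (g (t + S * u')) \<partial>unif)"
      unfolding outer[symmetric] by (intro bochner_ap_norm_sq bochner_ap_avg g)
  qed (auto intro!: bochner_ap_mult bochner_ap_cnj bochner_ap_shift bochner_ap_avg g bnd C norm_avg_le)
  then show ?thesis by (simp only: 2 right_diff_distrib)
qed

text \<open>Averaging the correlation over its argument averages only its first factor, and the
  averages of \<open>g\<close> tend to \<open>mean g\<close> uniformly.\<close>

lemma mean_corr_eq_0:
  assumes g: "bochner_ap g" and 0: "mean g = 0"
  shows "mean (corr g) = 0"
proof -
  obtain C where C: "C > 0" "\<And>x. norm (g x) \<le> C" using bochner_ap_bounded[OF g] by blast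
  have [measurable]: "g \<in> borel_measurable borel" by (rule bochner_ap_measurable) fact
  have bnd: "norm (a * cnj b) \<le> C * C" if "norm a \<le> C" "norm b \<le> C" for a b
    using that C by (simp add: norm_mult mult_mono)
  have inner: "(\<lambda>t. avg g T t * cnj (g t)) = (\<lambda>t. \<integral>u. g (t + T * u) * cnj (g t) \<partial>unif)" for T
    by (simp add: avg_def)
  have avg_corr: "avg (corr g) T 0 = mean (\<lambda>t. avg g T t * cnj (g t))" for T
  proof -
    have "avg (corr g) T 0 = (\<integral>u. mean (\<lambda>t. g (t + T * u) * cnj (g t)) \<partial>unif)"
      by (simp add: avg_def corr_def)
    also have "\<dots> = mean (\<lambda>t. avg g T t * cnj (g t))"
      unfolding inner
    proof (rule mean_integral[OF real_distribution_unif, where C="C * C", symmetric])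
      show "bochner_ap (\<lambda>t. \<integral>u. g (t + T * u) * cnj (g t) \<partial>unif)"
        unfolding inner[symmetric] by (intro bochner_ap_mult bochner_ap_avg bochner_ap_cnj g)
    qed (auto intro!: bochner_ap_mult bochner_ap_cnj bochner_ap_shift g bnd C)
    finally show ?thesis .
  qed
  have "((\<lambda>T. avg (corr g) T 0) \<longlongrightarrow> 0) at_top"
  proof (rule tendstoI)
    fix e :: real assume "e > 0"
    then have e: "e / (2 * C) > 0" using C by simp
    have "\<forall>\<^sub>F T in at_top. \<forall>t\<in>UNIV. dist (avg g T t) (mean g) < e / (2 * C)"
      by (rule uniform_limitD[OF mean_uniform_limit[OF g] e])
    then show "\<forall>\<^sub>F T in at_top. dist (avg (corr g) T 0) 0 < e"
    proof eventually_elim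
      case (elim T)
      have "norm (mean (\<lambda>t. avg g T t * cnj (g t))) \<le> e / (2 * C) * C"
      proof (intro norm_mean_le bochner_ap_mult bochner_ap_avg bochner_ap_cnj g)
        fix t show "norm (avg g T t * cnj (g t)) \<le> e / (2 * C) * C"
          unfolding norm_mult using elim C e by (intro mult_mono) (auto simp: 0 less_imp_le)
      qed
      also have "\<dots> < e" using C \<open>e > 0\<close> by simp
      finally show ?case by (simp add: avg_corr)
    qed
  qed
  then show ?thesis by (rule mean_eqI[OF bochner_ap_corr[OF g]])
qed

text \<open>For independent uniform \<open>u\<close> and \<open>u'\<close> the difference
  \<open>u - u'\<close> has density at most 1/2, attained and continuous at 0. The factor
  \<open>S\<close> compensates for the concentration of \<open>f (S * (u - u'))\<close> near
  0.\<close>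

lemma
  fixes f :: "real \<Rightarrow> complex"
  assumes int: "integrable lborel f" and [measurable]: "f \<in> borel_measurable borel"
  shows norm_unif_difference_le:
      "S > 0 \<Longrightarrow> norm (S *\<^sub>R (\<integral>u'. \<integral>u. f (S * (u - u')) \<partial>unif \<partial>unif)) \<le> (\<integral>y. norm (f y) \<partial>lborel) / 2"
    and tendsto_unif_difference:
      "(\<lambda>n. real (Suc n) *\<^sub>R (\<integral>u'. \<integral>u. f (real (Suc n) * (u - u')) \<partial>unif \<partial>unif)) \<longlonglongrightarrow> (\<integral>y. f y \<partial>lborel) / 2"
proof -
  \<comment> \<open>The inner integral after substituting y = S (u - u'), with the factor
    \<open>S\<close> absorbed; for \<bar>u'\<bar> < 1 its indicator tends to 1 at every
    \<open>y\<close>.\<close>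
  define J where "J S u' = (\<integral>y. (indicator {-1..1} (u' + y / S) / 2) *\<^sub>R f y \<partial>lborel)" for S u' :: real
  have J: "S *\<^sub>R (\<integral>u'. \<integral>u. f (S * (u - u')) \<partial>unif \<partial>unif) = (\<integral>u'. J S u' \<partial>unif)" if "S > 0" for S
  proof -
    have "S *\<^sub>R (\<integral>u. f (S * (u - u')) \<partial>unif) = J S u'" for u'
    proof -
      have "(\<integral>u. f (S * (u - u')) \<partial>unif) = (\<integral>u. (indicator {-1..1} u / 2) *\<^sub>R f (S * (u - u')) \<partial>lborel)"
        by (rule integral_unif) measurable
      also have "\<dots> = \<bar>1/S\<bar> *\<^sub>R (\<integral>y. (indicator {-1..1} (u' + 1/S * y) / 2) *\<^sub>R f (S * (u' + 1/S * y - u')) \<partial>lborel)"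
        by (rule lborel_integral_real_affine) (use that in simp)
      also have "\<dots> = (1/S) *\<^sub>R J S u'" using that by (simp add: J_def)
      finally show ?thesis using that by simp
    qed
    then show ?thesis by (simp flip: integral_scaleR_right)
  qed
  have [measurable]: "J S \<in> borel_measurable borel" for S unfolding J_def by measurable
  have bnd: "norm (J S u') \<le> (\<integral>y. norm (f y) \<partial>lborel) / 2" for S u'
  proof -
    have "norm (J S u') \<le> (\<integral>y. norm (f y) / 2 \<partial>lborel)" unfolding J_def
      by (rule Bochner_Integration.integral_norm_bound_integral)
        (auto intro!: integrable_divide integrable_norm int Bochner_Integration.integrable_bound[OF int] split: split_indicator)
    then show ?thesis by simp
  qed
  show "norm (S *\<^sub>R (\<integral>u'. \<integral>u. f (S * (u - u')) \<partial>unif \<partial>unif)) \<le> (\<integral>y. norm (f y) \<partial>lborel) / 2" if "S > 0"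
    unfolding J[OF that] by (rule unif.norm_integral_le[OF _ bnd]) measurable
  have lim: "(\<lambda>n. J (real (Suc n)) u') \<longlonglongrightarrow> (\<integral>y. f y \<partial>lborel) / 2" if "\<bar>u'\<bar> < 1" for u'
  proof -
    have "(\<lambda>n. J (real (Suc n)) u') \<longlonglongrightarrow> (\<integral>y. (1/2) *\<^sub>R f y \<partial>lborel)"
      unfolding J_def
    proof (rule integral_dominated_convergence[where w="\<lambda>y. norm (f y)"])
      show "AE y in lborel. (\<lambda>n. (indicator {-1..1} (u' + y / real (Suc n)) / 2) *\<^sub>R f y) \<longlonglongrightarrow> (1/2) *\<^sub>R f y"
      proof (rule AE_I2)
        fix y :: real
        have "(\<lambda>n. u' + y / real (Suc n)) \<longlonglongrightarrow> u' + 0"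
          by (intro tendsto_intros LIMSEQ_Suc lim_const_over_n)
        moreover have "u' + 0 \<in> {-1<..<1}" using that by auto
        ultimately have "\<forall>\<^sub>F n in sequentially. u' + y / real (Suc n) \<in> {-1<..<1}"
          by (intro topological_tendstoD) auto
        then have "\<forall>\<^sub>F n in sequentially. (indicator {-1..1} (u' + y / real (Suc n)) / 2) *\<^sub>R f y = (1/2) *\<^sub>R f y"
          by eventually_elim (auto split: split_indicator)
        then show "(\<lambda>n. (indicator {-1..1} (u' + y / real (Suc n)) / 2) *\<^sub>R f y) \<longlonglongrightarrow> (1/2) *\<^sub>R f y"
          by (rule tendsto_eventually)
      qed
      show "AE y in lborel. norm ((indicator {-1..1} (u' + y / real (Suc n)) / 2) *\<^sub>R f y) \<le> norm (f y)" for n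
        by (intro AE_I2) (auto split: split_indicator)
    qed (use int in auto)
    then show ?thesis by (simp add: scaleR_conv_of_real)
  qed
  have "(\<lambda>n. \<integral>u'. J (real (Suc n)) u' \<partial>unif) \<longlonglongrightarrow> (\<integral>u'. (\<integral>y. f y \<partial>lborel) / 2 \<partial>unif)"
  proof (rule integral_dominated_convergence[where w="\<lambda>_. (\<integral>y. norm (f y) \<partial>lborel) / 2"])
    show "AE u' in unif. (\<lambda>n. J (real (Suc n)) u') \<longlonglongrightarrow> (\<integral>y. f y \<partial>lborel) / 2"
      using AE_unif' by eventually_elim (rule lim)
  qed (use bnd in auto)
  then show "(\<lambda>n. real (Suc n) *\<^sub>R (\<integral>u'. \<integral>u. f (real (Suc n) * (u - u')) \<partial>unif \<partial>unif)) \<longlonglongrightarrow> (\<integral>y. f y \<partial>lborel) / 2"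
    using unif.prob_space by (simp only: J of_nat_0_less_iff zero_less_Suc) simp
qed

text \<open>
  Wiener's argument: the correlation \<open>\<phi>\<close> is positive definite, hence \<open>Q S x\<close> below is nonnegative and
  serves as an approximate spectral measure of \<open>\<phi>\<close> after multiplication by \<open>S\<close>. Its total mass on a
  bounded set of frequencies is bounded, while the means of \<open>\<phi>\<close> against characters are uniformly
  small there.
\<close>

lemma mean_corr_convolution_fejer:
  assumes g: "bochner_ap g" and zero: "\<And>x. mean (\<lambda>t. g t * cis (x * t)) = 0" and "c > 0"
  shows "mean (\<lambda>t. cnj (corr g t) * (\<integral>v. corr g (t + c * v) \<partial>fejer)) = 0"
proof -
  define \<phi> where "\<phi> = corr g"
  have \<phi>: "bochner_ap \<phi>" unfolding \<phi>_def by (rule bochner_ap_corr) fact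
  have [measurable]: "\<phi> \<in> borel_measurable borel" by (rule bochner_ap_measurable) fact
  obtain C where C: "C > 0" "\<And>x. norm (\<phi> x) \<le> C" using bochner_ap_bounded[OF \<phi>] by blast
  interpret tri_dist: real_distribution tri_dist by (rule real_distribution_tri_dist)
  have fc: "norm (\<phi> w * of_real (fejer_cont v)) \<le> C" for w v
    using mult_mono[OF C(2)[of w] fejer_cont_le_1[of v]] C by (simp add: norm_mult)
  have bcis: "norm (\<phi> w * cis y) \<le> C" for w y using C by (simp add: norm_mult)
  have \<phi>_zero: "mean (\<lambda>t. \<phi> t * cis (x * t)) = 0" for x
  proof -
    have "(\<lambda>t. \<phi> t * cis (x * t)) = corr (\<lambda>t. g t * cis (x * t))"
      unfolding \<phi>_def by (intro ext corr_modulate[OF g, symmetric])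
    then show ?thesis using mean_corr_eq_0[OF bochner_ap_mult[OF g bochner_ap_cis] zero, of x] by simp
  qed
  define Q where "Q S x = (\<integral>u'. \<integral>u. \<phi> (S * (u - u')) * cis (x * (S * (u - u'))) \<partial>unif \<partial>unif)" for S x
  have Q_mean: "Q S x = mean (\<lambda>t. avg (\<lambda>t. g t * cis (x * t)) S t * cnj (avg (\<lambda>t. g t * cis (x * t)) S t))" for S x
    unfolding Q_def \<phi>_def corr_modulate[OF g, symmetric]
    by (rule mean_avg_norm_sq[symmetric]) (intro bochner_ap_mult bochner_ap_cis g)
  have Q_pos: "Re (Q S x) \<ge> 0" "norm (Q S x) = Re (Q S x)" for S x
  proof -
    let ?h = "\<lambda>t. avg (\<lambda>t. g t * cis (x * t)) S t * cnj (avg (\<lambda>t. g t * cis (x * t)) S t)"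
    have h: "bochner_ap ?h" by (intro bochner_ap_norm_sq bochner_ap_avg bochner_ap_mult bochner_ap_cis g)
    show re: "Re (Q S x) \<ge> 0"
      unfolding Q_mean by (rule Re_mean_ge[OF h]) (simp add: mult.commute[of _ "cnj _"])
    have "cnj (Q S x) = Q S x"
      unfolding Q_mean by (subst mean_cnj[OF h, symmetric]) (simp add: mult.commute)
    then have "Im (Q S x) = 0" by (simp add: complex_eq_iff)
    then show "norm (Q S x) = Re (Q S x)" using re by (simp add: norm_complex_def)
  qed
  have [measurable]: "Q S \<in> borel_measurable borel" for S unfolding Q_def by measurable
  have Q_bnd: "norm (Q S x) \<le> C" for S x
    unfolding Q_def by (intro unif.norm_integral_le bcis) measurable
  \<comment> \<open>The transform of \<open>Q S\<close> weighted by a triangle on the band of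
    frequencies up to 1/c. On the time side the weight becomes a Fejer kernel of width
    \<open>c\<close> around \<open>z\<close>, so that \<open>S * V S z\<close> approximates the
    smoothed correlation.\<close>
  define V where "V S z = (\<integral>u'. \<integral>u. \<phi> (S * (u - u')) * of_real (fejer_cont ((S * (u - u') - z) / c)) \<partial>unif \<partial>unif)" for S z
  have [measurable]: "V S \<in> borel_measurable borel" for S unfolding V_def by measurable
  have V_bnd: "norm (V S x) \<le> C" for S x
    unfolding V_def by (intro unif.norm_integral_le fc) measurable
  have V: "(\<integral>x. Q S (x / c) * cis (- (x / c * z)) \<partial>tri_dist) = V S z" for S z
  proof -
    have "(\<integral>x. Q S (x / c) * cis (- (x / c * z)) \<partial>tri_dist) =
      (\<integral>x. \<integral>u'. \<integral>u. \<phi> (S * (u - u')) * cis (x * ((S * (u - u') - z) / c)) \<partial>unif \<partial>unif \<partial>tri_dist)"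
    proof (rule Bochner_Integration.integral_cong[OF refl])
      fix x
      have "Q S (x / c) * cis (- (x / c * z)) = (\<integral>u'. \<integral>u. \<phi> (S * (u - u')) * cis (x / c * (S * (u - u'))) * cis (- (x / c * z)) \<partial>unif \<partial>unif)"
        unfolding Q_def by simp
      also have "\<dots> = (\<integral>u'. \<integral>u. \<phi> (S * (u - u')) * cis (x * ((S * (u - u') - z) / c)) \<partial>unif \<partial>unif)"
        by (simp only: mult.assoc cis_mult) (simp add: diff_divide_distrib right_diff_distrib)
      finally show "Q S (x / c) * cis (- (x / c * z)) = \<dots>" .
    qed
    also have "\<dots> = (\<integral>u'. \<integral>x. \<integral>u. \<phi> (S * (u - u')) * cis (x * ((S * (u - u') - z) / c)) \<partial>unif \<partial>tri_dist \<partial>unif)"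
      by (rule pair_real_distribution_swap[OF real_distribution_tri_dist real_distribution_unif, where C=C])
        (measurable, intro unif.norm_integral_le bcis, measurable)
    also have "\<dots> = (\<integral>u'. \<integral>u. \<integral>x. \<phi> (S * (u - u')) * cis (x * ((S * (u - u') - z) / c)) \<partial>tri_dist \<partial>unif \<partial>unif)"
      by (intro Bochner_Integration.integral_cong refl
          pair_real_distribution_swap[OF real_distribution_tri_dist real_distribution_unif, where C=C])
        (measurable, rule bcis)
    also have "\<dots> = V S z" by (simp only: V_def char_tri_dist integral_mult_right_zero)
    finally show ?thesis .
  qed
  \<comment> \<open>The Fejer weight makes the merely bounded correlation integrable, as the lemmas
    on \<open>u - u'\<close> require. All three facts come from the substitution w = z + c
    v.\<close>
  have int\<psi>: "integrable lborel (\<lambda>w. \<phi> w * of_real (fejer_cont ((w - z) / c)))"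
    and lim\<psi>: "(\<integral>w. \<phi> w * of_real (fejer_cont ((w - z) / c)) \<partial>lborel) = (2 * c * fejer_const) *\<^sub>R (\<integral>v. \<phi> (z + c * v) \<partial>fejer)"
    and norm\<psi>: "(\<integral>w. norm (\<phi> w * of_real (fejer_cont ((w - z) / c))) \<partial>lborel) \<le> 2 * c * fejer_const * C" for z
  proof -
    have i0: "integrable lborel (\<lambda>v. fejer_cont v *\<^sub>R \<phi> (z + c * v))"
      by (rule Bochner_Integration.integrable_bound[OF integrable_mult_right[OF integrable_fejer_cont, of C]])
        (use C in \<open>auto intro!: AE_I2 simp: abs_mult mult.commute[of C] mult_left_mono\<close>)
    have eq: "\<phi> (z + c * v) * of_real (fejer_cont ((z + c * v - z) / c)) = fejer_cont v *\<^sub>R \<phi> (z + c * v)" for v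
      using \<open>c > 0\<close> by (simp add: scaleR_conv_of_real mult.commute)
    have "integrable lborel (\<lambda>v. \<phi> (z + c * v) * of_real (fejer_cont ((z + c * v - z) / c)))"
      unfolding eq by (rule i0)
    then show "integrable lborel (\<lambda>w. \<phi> w * of_real (fejer_cont ((w - z) / c)))"
      using \<open>c > 0\<close> lborel_integrable_real_affine_iff[of c "\<lambda>w. \<phi> w * of_real (fejer_cont ((w - z) / c))" z] by simp
    have "(\<integral>w. \<phi> w * of_real (fejer_cont ((w - z) / c)) \<partial>lborel) =
        \<bar>c\<bar> *\<^sub>R (\<integral>v. \<phi> (z + c * v) * of_real (fejer_cont ((z + c * v - z) / c)) \<partial>lborel)"
      by (rule lborel_integral_real_affine) (use \<open>c > 0\<close> in simp)
    also have "\<dots> = c *\<^sub>R ((2 * fejer_const) *\<^sub>R (\<integral>v. \<phi> (z + c * v) \<partial>fejer))"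
      unfolding eq using \<open>c > 0\<close> by (subst integral_fejer_cont) auto
    finally show "(\<integral>w. \<phi> w * of_real (fejer_cont ((w - z) / c)) \<partial>lborel) = (2 * c * fejer_const) *\<^sub>R (\<integral>v. \<phi> (z + c * v) \<partial>fejer)"
      by (simp add: mult_ac)
    have "(\<integral>w. norm (\<phi> w * of_real (fejer_cont ((w - z) / c))) \<partial>lborel) =
        \<bar>c\<bar> *\<^sub>R (\<integral>v. norm (\<phi> (z + c * v) * of_real (fejer_cont ((z + c * v - z) / c))) \<partial>lborel)"
      by (rule lborel_integral_real_affine) (use \<open>c > 0\<close> in simp)
    also have "\<dots> = c * (\<integral>v. norm (fejer_cont v *\<^sub>R \<phi> (z + c * v)) \<partial>lborel)"
      unfolding eq using \<open>c > 0\<close> by simp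
    also have "\<dots> \<le> c * (\<integral>v. C * fejer_cont v \<partial>lborel)"
      using \<open>c > 0\<close> integrable_norm[OF i0] C integrable_fejer_cont
      by (intro mult_left_mono integral_mono) (auto simp: mult.commute[of C] mult_left_mono)
    also have "(\<integral>v. C * fejer_cont v \<partial>lborel) = C * (2 * fejer_const)"
    proof -
      have "(\<integral>v. fejer_cont v \<partial>lborel) = (\<integral>v. 2 * fejer_fun v \<partial>lborel)"
        using AE_fejer_cont by (intro integral_cong_AE) auto
      then show ?thesis by (simp add: fejer_const_def)
    qed
    finally show "(\<integral>w. norm (\<phi> w * of_real (fejer_cont ((w - z) / c))) \<partial>lborel) \<le> 2 * c * fejer_const * C"
      by (simp add: mult_ac)
  qed
  define \<phi>c where "\<phi>c z = (\<integral>v. \<phi> (z + c * v) \<partial>fejer)" for z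
  have \<phi>c: "bochner_ap \<phi>c" unfolding \<phi>c_def by (rule bochner_ap_convolution[OF \<phi> real_distribution_fejer])
  have V_lim: "(\<lambda>n. real (Suc n) *\<^sub>R V (real (Suc n)) z) \<longlonglongrightarrow> (c * fejer_const) *\<^sub>R \<phi>c z" for z
    using tendsto_unif_difference[OF int\<psi>[of z]]
    by (simp add: V_def lim\<psi> \<phi>c_def scaleR_conv_of_real mult.assoc)
  have SV_bnd: "norm (S *\<^sub>R V S z) \<le> c * fejer_const * C" if "S > 0" for S z
    using norm_unif_difference_le[OF int\<psi>[of z] _ that] norm\<psi>[of z] by (simp add: V_def)
  have small: "norm (mean (\<lambda>t. cnj (\<phi> t) * \<phi>c t)) \<le> C * e" if e: "e > 0" for e
  proof -
    obtain T0 where T0: "T0 > 0" "\<And>T x t. T \<ge> T0 \<Longrightarrow> \<bar>x\<bar> \<le> 1 / c \<Longrightarrow> norm (avg (\<lambda>t. \<phi> t * cis (x * t)) T t) \<le> e"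
      using avg_uniformly_small[OF \<phi> \<phi>_zero e] by blast
    have "norm (avg (\<lambda>t. cnj (\<phi> t) * \<phi>c t) T 0) \<le> C * e" if T: "T \<ge> T0" for T
    proof -
      define r where "r x = avg (\<lambda>t. \<phi> t * cis (x * t)) T 0" for x
      have r_eq: "cnj (r x) = (\<integral>s. cnj (\<phi> (T * s)) * cis (- (x * (T * s))) \<partial>unif)" for x
        unfolding r_def avg_def by (simp only: Bochner_Integration.integral_cnj[symmetric] complex_cnj_mult cis_cnj add_0)
      have [measurable]: "r \<in> borel_measurable borel" unfolding r_def avg_def by measurable
      have r_bnd: "norm (r x) \<le> C" for x
        unfolding r_def using C by (intro norm_avg_le) (auto simp: norm_mult)
      \<comment> \<open>A Parseval identity: pairing \<open>Q S\<close> with the average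
        \<open>r\<close> over the frequency band equals pairing \<open>V S\<close> with the
        correlation over time.\<close>
      have Z: "(\<integral>x. Q S (x / c) * cnj (r (x / c)) \<partial>tri_dist) = (\<integral>s. cnj (\<phi> (T * s)) * V S (T * s) \<partial>unif)" for S
      proof -
        have "(\<integral>x. Q S (x / c) * cnj (r (x / c)) \<partial>tri_dist) =
            (\<integral>x. \<integral>s. cnj (\<phi> (T * s)) * (Q S (x / c) * cis (- (x / c * (T * s)))) \<partial>unif \<partial>tri_dist)"
          unfolding r_eq by (simp add: mult_ac flip: integral_mult_right_zero)
        also have "\<dots> = (\<integral>s. \<integral>x. cnj (\<phi> (T * s)) * (Q S (x / c) * cis (- (x / c * (T * s)))) \<partial>tri_dist \<partial>unif)"
        proof (rule pair_real_distribution_swap[OF real_distribution_tri_dist real_distribution_unif, where C="C * C"])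
          show "norm (cnj (\<phi> (T * s)) * (Q S (x / c) * cis (- (x / c * (T * s))))) \<le> C * C" for x s
            using C Q_bnd by (simp add: norm_mult mult_mono)
        qed measurable
        also have "\<dots> = (\<integral>s. cnj (\<phi> (T * s)) * V S (T * s) \<partial>unif)"
          by (simp only: V integral_mult_right_zero)
        finally show ?thesis .
      qed
      \<comment> \<open>As \<open>Q S\<close> is nonnegative, the integral of its modulus is its
        total mass \<open>V S 0\<close>, which after multiplication by \<open>S\<close> stays
        bounded; on the band \<open>r\<close> is at most \<open>e\<close>.\<close>
      have Z_bnd: "norm (S *\<^sub>R (\<integral>x. Q S (x / c) * cnj (r (x / c)) \<partial>tri_dist)) \<le> e * (c * fejer_const * C)" if "S > 0" for S
      proof -
        have iQ: "integrable tri_dist (\<lambda>x. Q S (x / c))"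
          using Q_bnd by (intro tri_dist.integrable_bounded[where C=C]) auto
        have "norm (\<integral>x. Q S (x / c) * cnj (r (x / c)) \<partial>tri_dist) \<le> (\<integral>x. norm (Q S (x / c) * cnj (r (x / c))) \<partial>tri_dist)"
          by (rule integral_norm_bound)
        also have "\<dots> \<le> (\<integral>x. e * Re (Q S (x / c)) \<partial>tri_dist)"
        proof (rule integral_mono_AE)
          show "integrable tri_dist (\<lambda>x. norm (Q S (x / c) * cnj (r (x / c))))"
            using C Q_bnd r_bnd by (intro tri_dist.integrable_bounded[where C="C*C"]) (auto simp: norm_mult mult_mono)
          show "integrable tri_dist (\<lambda>x. e * Re (Q S (x / c)))" using iQ by (intro integrable_mult_right integrable_Re)
          show "AE x in tri_dist. norm (Q S (x / c) * cnj (r (x / c))) \<le> e * Re (Q S (x / c))"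
            using AE_tri_dist
          proof eventually_elim
            case (elim x)
            have "norm (r (x / c)) \<le> e"
              unfolding r_def by (rule T0(2)[OF T]) (use elim \<open>c > 0\<close> in \<open>simp add: abs_div divide_right_mono\<close>)
            then show ?case
              using Q_pos[of S "x / c"] by (simp add: norm_mult mult.commute[of e] mult_left_mono)
          qed
        qed
        also have "\<dots> = e * Re (V S 0)" using V[of S 0] iQ by (simp add: integral_Re)
        finally have 1: "norm (\<integral>x. Q S (x / c) * cnj (r (x / c)) \<partial>tri_dist) \<le> e * Re (V S 0)" .
        have "S * Re (V S 0) \<le> c * fejer_const * C"
          using SV_bnd[OF that, of 0] complex_Re_le_cmod[of "S *\<^sub>R V S 0"] by simp
        then have "S * (e * Re (V S 0)) \<le> e * (c * fejer_const * C)"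
          using \<open>e > 0\<close> by (simp add: mult.left_commute[of S])
        moreover have "norm (S *\<^sub>R (\<integral>x. Q S (x / c) * cnj (r (x / c)) \<partial>tri_dist)) \<le> S * (e * Re (V S 0))"
          using 1 that by (simp add: mult_left_mono)
        ultimately show ?thesis by linarith
      qed
      have [measurable]: "\<phi>c \<in> borel_measurable borel" by (intro bochner_ap_measurable \<phi>c)
      \<comment> \<open>The length \<open>T\<close> is fixed while \<open>S\<close> grows. The limit
        carries the same factor \<open>c * fejer_const\<close> as the bound, so that the two
        cancel.\<close>
      have "(\<lambda>n. \<integral>s. cnj (\<phi> (T * s)) * (real (Suc n) *\<^sub>R V (real (Suc n)) (T * s)) \<partial>unif) \<longlonglongrightarrow>
          (\<integral>s. cnj (\<phi> (T * s)) * ((c * fejer_const) *\<^sub>R \<phi>c (T * s)) \<partial>unif)"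
      proof (rule integral_dominated_convergence[where w="\<lambda>_. C * (c * fejer_const * C)"])
        show "AE s in unif. norm (cnj (\<phi> (T * s)) * (real (Suc n) *\<^sub>R V (real (Suc n)) (T * s))) \<le> C * (c * fejer_const * C)" for n
          unfolding norm_mult using C SV_bnd[of "real (Suc n)"] by (intro AE_I2 mult_mono) auto
        show "AE s in unif. (\<lambda>n. cnj (\<phi> (T * s)) * (real (Suc n) *\<^sub>R V (real (Suc n)) (T * s))) \<longlonglongrightarrow>
            cnj (\<phi> (T * s)) * ((c * fejer_const) *\<^sub>R \<phi>c (T * s))"
          by (intro AE_I2 tendsto_mult_left V_lim)
      qed auto
      also have "(\<lambda>n. \<integral>s. cnj (\<phi> (T * s)) * (real (Suc n) *\<^sub>R V (real (Suc n)) (T * s)) \<partial>unif) =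
          (\<lambda>n. real (Suc n) *\<^sub>R (\<integral>x. Q (real (Suc n)) (x / c) * cnj (r (x / c)) \<partial>tri_dist))"
        unfolding Z by (simp flip: integral_scaleR_right)
      finally have "norm (\<integral>s. cnj (\<phi> (T * s)) * ((c * fejer_const) *\<^sub>R \<phi>c (T * s)) \<partial>unif) \<le> e * (c * fejer_const * C)"
        by (intro tendsto_upperbound[OF tendsto_norm]) (auto intro!: always_eventually Z_bnd simp del: of_nat_Suc)
      also have "(\<integral>s. cnj (\<phi> (T * s)) * ((c * fejer_const) *\<^sub>R \<phi>c (T * s)) \<partial>unif) =
          (c * fejer_const) *\<^sub>R avg (\<lambda>t. cnj (\<phi> t) * \<phi>c t) T 0"
        by (simp add: avg_def)
      finally show ?thesis using \<open>c > 0\<close> fejer_const_pos by (simp add: mult_ac)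
    qed
    then have "\<forall>\<^sub>F T in at_top. norm (avg (\<lambda>t. cnj (\<phi> t) * \<phi>c t) T 0) \<le> C * e"
      by (auto simp: eventually_at_top_linorder)
    then show ?thesis
      by (intro tendsto_upperbound[OF tendsto_norm[OF tendsto_mean[of _ 0]]]) (auto intro!: bochner_ap_mult bochner_ap_cnj \<phi> \<phi>c)
  qed
  have "norm (mean (\<lambda>t. cnj (\<phi> t) * \<phi>c t)) \<le> e" if "e > 0" for e
    using small[of "e / C"] that C by simp
  then have "norm (mean (\<lambda>t. cnj (\<phi> t) * \<phi>c t)) \<le> 0" by (rule field_le_epsilon[where y=0, simplified])
  then show ?thesis by (simp add: \<phi>_def \<phi>c_def)
qed

text \<open>The correlation is orthogonal to its own Fejer smoothings, which converge to it
  uniformly; hence its mean square is 0 and it vanishes. Its value at 0 is the mean square of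
  \<open>g\<close>, so \<open>mean_norm_sq_eq_0\<close> applies a second time.\<close>

theorem bochner_ap_uniqueness:
  assumes g: "bochner_ap g" and zero: "\<And>x. mean (\<lambda>t. g t * cis (x * t)) = 0"
  shows "g t = 0"
proof -
  define \<phi> where "\<phi> = corr g"
  have \<phi>: "bochner_ap \<phi>" unfolding \<phi>_def by (rule bochner_ap_corr) fact
  obtain C where C: "C > 0" "\<And>x. norm (\<phi> x) \<le> C" using bochner_ap_bounded[OF \<phi>] by blast
  have "norm (mean (\<lambda>t. \<phi> t * cnj (\<phi> t))) \<le> e" if "e > 0" for e
  proof -
    have "e / C > 0" using that C by simp
    from bochner_ap_approximate_identity[OF \<phi> real_distribution_fejer this] obtain c
      where c: "c > 0" "\<And>t. norm ((\<integral>s. \<phi> (t + c * s) \<partial>fejer) - \<phi> t) \<le> e / C"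
      by (metis abs_of_pos order_refl)
    have "norm (mean (\<lambda>t. \<phi> t * cnj (\<phi> t)) - mean (\<lambda>t. cnj (\<phi> t) * (\<integral>s. \<phi> (t + c * s) \<partial>fejer))) \<le> C * (e / C)"
    proof (rule norm_mean_diff_le)
      fix t
      have "\<phi> t * cnj (\<phi> t) - cnj (\<phi> t) * (\<integral>s. \<phi> (t + c * s) \<partial>fejer) = cnj (\<phi> t) * (\<phi> t - (\<integral>s. \<phi> (t + c * s) \<partial>fejer))"
        by (simp add: algebra_simps)
      also have "norm \<dots> \<le> C * (e / C)"
        unfolding norm_mult by (rule mult_mono) (use C c in \<open>auto simp: norm_minus_commute\<close>)
      finally show "norm (\<phi> t * cnj (\<phi> t) - cnj (\<phi> t) * (\<integral>s. \<phi> (t + c * s) \<partial>fejer)) \<le> C * (e / C)" .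
    qed (intro bochner_ap_mult bochner_ap_cnj \<phi> bochner_ap_convolution[OF \<phi> real_distribution_fejer])+
    then show ?thesis
      using mean_corr_convolution_fejer[OF g zero c(1)] C by (simp add: \<phi>_def)
  qed
  then have "norm (mean (\<lambda>t. \<phi> t * cnj (\<phi> t))) \<le> 0" by (rule field_le_epsilon[where y=0, simplified])
  then have "\<phi> 0 = 0" by (intro mean_norm_sq_eq_0[OF \<phi>]) simp
  then show ?thesis by (intro mean_norm_sq_eq_0[OF g]) (simp add: \<phi>_def corr_def)
qed

section \<open>Riesz sums and bounded functions on the half-plane\<close>

text \<open>Both sides are almost periodic, and both have the Bohr coefficients of \<open>g\<close>
  multiplied by \<open>tri (y / N)\<close>, which is 0 for \<bar>y\<bar> \<ge> N; uniqueness
  identifies them.\<close>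

lemma bochner_ap_fejer_sum:
  assumes g: "bochner_ap g" and "N > 0" and fin: "finite (L \<inter> {-N<..<N})"
    and zero: "\<And>x. x \<notin> L \<Longrightarrow> mean (\<lambda>t. g t * cis (x * t)) = 0"
  shows "(\<integral>s. g (t + s / N) \<partial>fejer) =
    (\<Sum>x\<in>L \<inter> {-N<..<N}. of_real (tri (x / N)) * mean (\<lambda>t. g t * cis (x * t)) * cis (- (x * t)))"
proof -
  define A where "A x = mean (\<lambda>t. g t * cis (x * t))" for x
  define conv where "conv t = (\<integral>s. g (t + s / N) \<partial>fejer)" for t
  define P where "P t = (\<Sum>x\<in>L \<inter> {-N<..<N}. of_real (tri (x / N)) * A x * cis (- (x * t)))" for t
  have [measurable]: "g \<in> borel_measurable borel" by (rule bochner_ap_measurable) fact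
  obtain C where C: "\<And>x. norm (g x) \<le> C" using bochner_ap_bounded[OF g] by blast
  have conv: "bochner_ap conv"
    unfolding conv_def using bochner_ap_convolution[OF g real_distribution_fejer, of "1/N"] by simp
  have apcis: "bochner_ap (\<lambda>t. cis (- (x * t)))" for x using bochner_ap_cis[of "-x"] by simp
  have P: "bochner_ap P" unfolding P_def by (intro bochner_ap_sum bochner_ap_cmult apcis)
  have mconv: "mean (\<lambda>t. conv t * cis (y * t)) = of_real (tri (y / N)) * A y" for y
  proof -
    have eq: "conv t * cis (y * t) = (\<integral>s. g (t + s / N) * cis (y * t) \<partial>fejer)" for t
      by (simp add: conv_def)
    have 1: "mean (\<lambda>t. g (t + a) * cis (y * t)) = A y * cis (- (y * a))" for a
    proof -
      have "mean (\<lambda>t. g (t + a) * cis (y * t)) = mean (\<lambda>t. cis (- (y * a)) * (g (t + a) * cis (y * (t + a))))"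
        by (simp add: distrib_left mult.left_commute[of _ "g _"] cis_mult)
      also have "\<dots> = cis (- (y * a)) * mean (\<lambda>t. g (t + a) * cis (y * (t + a)))"
        by (intro mean_cmult bochner_ap_shift[of "\<lambda>t. g t * cis (y * t)" a] bochner_ap_mult bochner_ap_cis g)
      also have "mean (\<lambda>t. g (t + a) * cis (y * (t + a))) = A y"
        unfolding A_def by (rule mean_shift) (intro bochner_ap_mult bochner_ap_cis g)
      finally show ?thesis by (simp add: mult.commute)
    qed
    have "mean (\<lambda>t. conv t * cis (y * t)) = (\<integral>s. mean (\<lambda>t. g (t + s / N) * cis (y * t)) \<partial>fejer)"
      unfolding eq
    proof (rule mean_integral[OF real_distribution_fejer, where C=C])
      show "bochner_ap (\<lambda>t. \<integral>s. g (t + s / N) * cis (y * t) \<partial>fejer)"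
        unfolding eq[symmetric] by (intro bochner_ap_mult bochner_ap_cis conv)
    qed (use C in \<open>auto intro!: bochner_ap_mult bochner_ap_cis bochner_ap_shift g simp: norm_mult\<close>)
    also have "\<dots> = A y * (\<integral>s. cis ((- y / N) * s) \<partial>fejer)"
      by (simp add: 1)
    finally show ?thesis unfolding char_fejer by simp
  qed
  have mP: "mean (\<lambda>t. P t * cis (y * t)) = of_real (tri (y / N)) * A y" for y
  proof -
    have "P t * cis (y * t) = (\<Sum>x\<in>L \<inter> {-N<..<N}. of_real (tri (x / N)) * A x * cis ((y - x) * t))" for t
      by (simp add: P_def sum_distrib_right mult.assoc cis_mult left_diff_distrib)
    then have "mean (\<lambda>t. P t * cis (y * t)) =
        (\<Sum>x\<in>L \<inter> {-N<..<N}. mean (\<lambda>t. of_real (tri (x / N)) * A x * cis ((y - x) * t)))"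
      by (simp only:) (intro mean_sum bochner_ap_cmult bochner_ap_cis)
    also have "\<dots> = (\<Sum>x\<in>L \<inter> {-N<..<N}. if x = y then of_real (tri (y / N)) * A y else 0)"
      by (intro sum.cong refl) (simp only: mean_cmult[OF bochner_ap_cis] mean_cis, simp)
    also have "\<dots> = of_real (tri (y / N)) * A y"
    proof (cases "y \<in> L \<inter> {-N<..<N}")
      case False
      then have "A y = 0 \<or> tri (y / N) = 0"
      proof (cases "y \<in> L")
        case True
        then have "\<bar>y\<bar> \<ge> N" using False by auto
        then show ?thesis using \<open>N > 0\<close> by (intro disjI2 tri_eq_0) (simp add: abs_div)
      qed (simp add: A_def zero)
      with fin False show ?thesis by auto
    qed (use fin in simp)
    finally show ?thesis .
  qed
  have "conv t - P t = 0"
  proof (rule bochner_ap_uniqueness)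
    show "bochner_ap (\<lambda>t. conv t - P t)" by (intro bochner_ap_diff conv P)
    show "mean (\<lambda>t. (conv t - P t) * cis (x * t)) = 0" for x
      using mean_diff[of "\<lambda>t. conv t * cis (x * t)" "\<lambda>t. P t * cis (x * t)"]
      by (simp add: left_diff_distrib bochner_ap_mult bochner_ap_cis conv P mconv mP)
  qed
  then show ?thesis by (simp add: conv_def P_def A_def)
qed

section \<open>Riesz sums along a frequency\<close>

lemma frequency_inj: "frequency freq \<Longrightarrow> inj freq"
  by (simp add: frequency_def strict_mono_imp_inj_on)

lemma frequency_finite:
  assumes "frequency freq" shows "finite {n. freq n < N}"
proof -
  obtain m where m: "freq m > N"
    using assms unfolding frequency_def bdd_above_def by (auto simp: not_le)
  have "{n. freq n < N} \<subseteq> {..m}"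
  proof
    fix n assume "n \<in> {n. freq n < N}"
    then have "freq n < freq m" using m by simp
    then show "n \<in> {..m}" using assms unfolding frequency_def
      by (simp add: strict_mono_less less_imp_le)
  qed
  then show ?thesis by (rule finite_subset) simp
qed

text \<open>For a frequency and \<open>N > 0\<close> the weights are 1 - freq n / N; the notation
  with \<open>tri\<close> makes them literally the multipliers of \<open>char_fejer\<close>.\<close>

definition riesz :: "(nat \<Rightarrow> real) \<Rightarrow> (nat \<Rightarrow> complex) \<Rightarrow> real \<Rightarrow> complex \<Rightarrow> complex" where
  "riesz freq a N z = (\<Sum>n | freq n < N. of_real (tri (freq n / N)) * a n * exp (- of_real (freq n) * z))"

lemma exp_Complex: "exp (- of_real x * Complex s t) = of_real (exp (- (s * x))) * cis (- (x * t))"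
  by (simp add: exp_eq_polar mult.commute)

text \<open>The exponential in the coefficients lets one lemma serve vertical lines (s > 0) and
  orbits in the group (s = 0).\<close>

lemma bochner_ap_fejer_riesz:
  assumes freq: "frequency freq" and g: "bochner_ap g" and "N > 0"
    and zero: "\<And>x. x \<notin> range freq \<Longrightarrow> mean (\<lambda>t. g t * cis (x * t)) = 0"
    and a: "\<And>n. mean (\<lambda>t. g t * cis (freq n * t)) = a n * of_real (exp (- (s * freq n)))"
  shows "(\<integral>u. g (t + u / N) \<partial>fejer) = riesz freq a N (Complex s t)"
proof -
  have nn: "freq n \<ge> 0" for n using freq by (simp add: frequency_def)
  have im: "range freq \<inter> {-N<..<N} = freq ` {n. freq n < N}"
  proof -
    have "-N < freq n" for n using nn[of n] \<open>N > 0\<close> by linarith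
    then show ?thesis by auto
  qed
  have inj: "inj_on freq A" for A using frequency_inj[OF freq] by (rule inj_on_subset) simp
  have "(\<integral>u. g (t + u / N) \<partial>fejer) =
    (\<Sum>x\<in>range freq \<inter> {-N<..<N}. of_real (tri (x / N)) * mean (\<lambda>t. g t * cis (x * t)) * cis (- (x * t)))"
    by (rule bochner_ap_fejer_sum[OF g \<open>N > 0\<close> _ zero]) (auto simp: im frequency_finite[OF freq])
  also have "\<dots> = riesz freq a N (Complex s t)"
    unfolding im riesz_def by (subst sum.reindex[OF inj]) (simp only: o_def a exp_Complex mult.assoc)
  finally show ?thesis .
qed

text \<open>An almost period brings any translation into [0,l], where uniform continuity gives a
  finite net. Conversely, if the translations by \<open>a + L\<close> and by a net point
  \<open>b\<close> nearly agree, then \<open>a + L - b\<close> is an almost period, and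
  \<bar>b\<bar> < L places it in the required interval.\<close>

lemma uniformly_almost_periodic_iff: "uniformly_almost_periodic g \<longleftrightarrow> bochner_ap g"
proof
  assume u: "uniformly_almost_periodic g"
  then have cont: "continuous_on UNIV g" by (simp add: uniformly_almost_periodic_def)
  have per: "\<exists>l>0. \<forall>a. \<exists>\<tau>. a < \<tau> \<and> \<tau> < a + l \<and> (\<forall>x. norm (g (x + \<tau>) - g x) \<le> e)" if "e > 0" for e
  proof -
    have "norm (g (x + \<tau>) - g x) \<le> e" if "(SUP x. ereal (norm (g (x + \<tau>) - g x))) < ereal e" for x \<tau>
    proof -
      have "ereal (norm (g (x + \<tau>) - g x)) \<le> (SUP x. ereal (norm (g (x + \<tau>) - g x)))"
        by (rule SUP_upper) simp
      then have "ereal (norm (g (x + \<tau>) - g x)) < ereal e" using that by (rule le_less_trans)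
      then show ?thesis by simp
    qed
    then show ?thesis using u that unfolding uniformly_almost_periodic_def
      by (metis greaterThanLessThan_iff)
  qed
  show "bochner_ap g" unfolding bochner_ap_def
  proof (intro conjI allI impI cont)
    fix e :: real assume "e > 0"
    then have e6: "e / 6 > 0" by simp
    obtain l where l: "l > 0" "\<And>a. \<exists>\<tau>. a < \<tau> \<and> \<tau> < a + l \<and> (\<forall>x. norm (g (x + \<tau>) - g x) \<le> e / 6)"
      using per[OF e6] by blast
    \<comment> \<open>The margin of width 1 leaves room for the second point of a pair whose first
      point lies in [0,l], since \<open>d \<le> 1\<close> below.\<close>
    have "uniformly_continuous_on {-1..l+1} g"
      by (intro compact_uniformly_continuous continuous_on_subset[OF cont]) auto
    then obtain d0 where d0: "d0 > 0" "\<And>x y. x \<in> {-1..l+1} \<Longrightarrow> y \<in> {-1..l+1} \<Longrightarrow> \<bar>y - x\<bar> < d0 \<Longrightarrow> norm (g y - g x) < e / 6"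
      using e6 unfolding uniformly_continuous_on_def dist_norm real_norm_def by metis
    define d where "d = min d0 1"
    have d: "d > 0" "d \<le> 1" "d \<le> d0" using d0 by (auto simp: d_def)
    have uc: "norm (g y - g x) \<le> e / 2" if xy: "\<bar>y - x\<bar> < d" for x y
    proof -
      obtain \<tau> where \<tau>: "-x < \<tau>" "\<tau> < -x + l" "\<And>x. norm (g (x + \<tau>) - g x) \<le> e / 6" using l(2)[of "-x"] by blast
      have "norm (g (y + \<tau>) - g (x + \<tau>)) < e / 6"
        by (rule d0(2)) (use \<tau> xy d in auto)
      then have "norm (g y - g (y + \<tau>)) + norm (g (y + \<tau>) - g (x + \<tau>)) + norm (g (x + \<tau>) - g x) \<le> e / 2"
        using \<tau>(3)[of y] \<tau>(3)[of x] by (simp add: norm_minus_commute)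
      moreover have "norm ((g y - g (y + \<tau>)) + (g (y + \<tau>) - g (x + \<tau>)) + (g (x + \<tau>) - g x)) \<le>
          norm (g y - g (y + \<tau>)) + norm (g (y + \<tau>) - g (x + \<tau>)) + norm (g (x + \<tau>) - g x)"
        by (intro norm_triangle_le add_right_mono) simp
      ultimately show ?thesis by simp
    qed
    have cov: "{0..l} \<subseteq> (\<Union>b\<in>{0..l}. ball b d)" using d by auto
    obtain B where B: "B \<subseteq> {0..l}" "finite B" "{0..l} \<subseteq> (\<Union>b\<in>B. ball b d)"
      by (rule compactE_image[OF compact_Icc _ cov]) (rule open_ball)
    show "\<exists>B. finite B \<and> (\<forall>t. \<exists>b\<in>B. \<forall>x. norm (g (x + t) - g (x + b)) \<le> e)"
    proof (intro exI[of _ B] conjI allI B(2))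
      fix t
      obtain \<tau> where \<tau>: "-t < \<tau>" "\<tau> < -t + l" "\<And>x. norm (g (x + \<tau>) - g x) \<le> e / 6" using l(2)[of "-t"] by blast
      have "t + \<tau> \<in> {0..l}" using \<tau> by auto
      then obtain b where b: "b \<in> B" "\<bar>(t + \<tau>) - b\<bar> < d"
        using B(3) by (auto simp: dist_real_def abs_minus_commute dest!: subsetD)
      have "norm (g (x + t) - g (x + b)) \<le> e" for x
      proof -
        have 1: "norm (g (x + (t + \<tau>)) - g (x + b)) \<le> e / 2" by (rule uc) (use b in simp)
        have 2: "norm (g (x + t) - g (x + (t + \<tau>))) \<le> e / 6"
          using \<tau>(3)[of "x + t"] by (simp add: add.assoc norm_minus_commute)
        show ?thesis using norm_triangle_mono[OF 2 1] \<open>e > 0\<close> by simp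
      qed
      then show "\<exists>b\<in>B. \<forall>x. norm (g (x + t) - g (x + b)) \<le> e" using b(1) by blast
    qed
  qed
next
  assume g: "bochner_ap g"
  show "uniformly_almost_periodic g" unfolding uniformly_almost_periodic_def
  proof (intro conjI allI impI bochner_ap_continuous g)
    fix e :: real assume "e > 0"
    then have e2: "e / 2 > 0" by simp
    obtain B where B: "finite B" "\<And>t. \<exists>b\<in>B. \<forall>x. norm (g (x + t) - g (x + b)) \<le> e / 2"
      using bochner_apE[OF g e2] by blast
    define L where "L = 1 + (\<Sum>b\<in>B. \<bar>b\<bar>)"
    have L: "L > 0" unfolding L_def by (simp add: add_pos_nonneg sum_nonneg)
    have "\<exists>\<tau>\<in>{a<..<a + 2 * L}. (SUP x. ereal (norm (g (x + \<tau>) - g x))) < ereal e" for a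
    proof -
      obtain b where b: "b \<in> B" "\<And>x. norm (g (x + (a + L)) - g (x + b)) \<le> e / 2" using B(2) by blast
      have "\<bar>b\<bar> < L" unfolding L_def using b B member_le_sum[of b B abs] by simp
      then have "a + L - b \<in> {a<..<a + 2 * L}" by auto
      moreover have "(SUP x. ereal (norm (g (x + (a + L - b)) - g x))) \<le> ereal (e / 2)"
      proof (rule SUP_least)
        fix x show "ereal (norm (g (x + (a + L - b)) - g x)) \<le> ereal (e / 2)"
          using b(2)[of "x - b"] by (simp add: algebra_simps)
      qed
      then have "(SUP x. ereal (norm (g (x + (a + L - b)) - g x))) < ereal e"
        by (rule le_less_trans) (use \<open>e > 0\<close> in simp)
      ultimately show ?thesis by blast
    qed
    then show "\<exists>l>0. \<forall>a. \<exists>\<tau>\<in>{a<..<a + l}. (SUP x. ereal (norm (g (x + \<tau>) - g x))) < ereal e"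
      using L by (intro exI[of _ "2 * L"]) simp
  qed
qed

section \<open>Bohr coefficients on the half-plane\<close>

lemma avg_eq_integral:
  assumes "continuous_on UNIV h" "T > 0"
  shows "avg h T 0 = of_real (1 / (2 * T)) * integral {-T..T} h"
proof -
  have [measurable]: "h \<in> borel_measurable borel" using assms by (simp add: borel_measurable_continuous_onI)
  have ind: "indicator {-1..1} (0 + 1 / T * y) = (indicator {-T..T} y :: real)" for y
    using assms by (auto split: split_indicator simp: field_simps)
  have "avg h T 0 = (\<integral>s. (indicator {-1..1} s / 2) *\<^sub>R h (0 + T * s) \<partial>lborel)"
    unfolding avg_def by (rule integral_unif) measurable
  also have "\<dots> = \<bar>1 / T\<bar> *\<^sub>R (\<integral>y. (indicator {-1..1} (0 + 1 / T * y) / 2) *\<^sub>R h (0 + T * (0 + 1 / T * y)) \<partial>lborel)"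
    by (rule lborel_integral_real_affine) (use assms in simp)
  also have "\<dots> = (1 / (2 * T)) *\<^sub>R (\<integral>y. indicator {-T..T} y *\<^sub>R h y \<partial>lborel)"
  proof -
    have "(\<integral>y. (indicator {-1..1} (0 + 1 / T * y) / 2) *\<^sub>R h (0 + T * (0 + 1 / T * y)) \<partial>lborel) =
      (\<integral>y. (1/2) *\<^sub>R (indicator {-T..T} y *\<^sub>R h y) \<partial>lborel)"
      unfolding ind using assms by simp
    also have "\<dots> = (1/2) *\<^sub>R (\<integral>y. indicator {-T..T} y *\<^sub>R h y \<partial>lborel)"
      by (rule integral_scaleR_right)
    finally show ?thesis using assms by simp
  qed
  also have "(\<integral>y. indicator {-T..T} y *\<^sub>R h y \<partial>lborel) = integral {-T..T} h"
  proof -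
    have "set_integrable lborel {-T..T} h"
      by (intro borel_integrable_atLeastAtMost') (use assms in \<open>auto intro: continuous_on_subset\<close>)
    from set_borel_integral_eq_integral(2)[OF this] show ?thesis
      by (simp add: set_lebesgue_integral_def)
  qed
  finally show ?thesis by (simp add: scaleR_conv_of_real)
qed

text \<open>The analytic part of membership in the Hardy space with an explicit bound, free of the
  extension by 0 and of the spectral condition; it passes directly to sums and multiples.\<close>

definition half_plane_ap :: "(complex \<Rightarrow> complex) \<Rightarrow> real \<Rightarrow> bool" where
  "half_plane_ap F C \<longleftrightarrow> F holomorphic_on right_half_plane \<and> (\<forall>z. Re z > 0 \<longrightarrow> norm (F z) \<le> C)
    \<and> (\<forall>\<sigma>>0. bochner_ap (vertical F \<sigma>))"

lemma convex_right_half_plane: "convex right_half_plane" and open_right_half_plane: "open right_half_plane"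
  unfolding right_half_plane_def by (rule convex_halfspace_Re_gt, rule open_halfspace_Re_gt)

text \<open>A primitive of \<open>F z exp (x z)\<close> takes the place of Cauchy's theorem on long rectangles.\<close>

lemma bohr_mean_independent:
  assumes F: "half_plane_ap F C" and s: "0 < s" "s < r"
  shows "of_real (exp (s * x)) * mean (\<lambda>t. vertical F s t * cis (x * t)) =
    of_real (exp (r * x)) * mean (\<lambda>t. vertical F r t * cis (x * t))"
proof -
  define G where "G z = F z * exp (z * of_real x)" for z
  define A where "A s = of_real (exp (s * x)) * mean (\<lambda>t. vertical F s t * cis (x * t))" for s
  have hol: "F holomorphic_on right_half_plane" and C: "\<And>z. Re z > 0 \<Longrightarrow> norm (F z) \<le> C"
    and bochner_ap: "\<And>\<sigma>. \<sigma> > 0 \<Longrightarrow> bochner_ap (vertical F \<sigma>)" using F by (auto simp: half_plane_ap_def)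
  have "G holomorphic_on right_half_plane" unfolding G_def by (intro holomorphic_intros hol)
  then obtain H where H: "\<And>z. z \<in> right_half_plane \<Longrightarrow> (H has_field_derivative G z) (at z within right_half_plane)"
    using holomorphic_convex_primitive'[OF convex_right_half_plane open_right_half_plane] by blast
  then have H: "(H has_field_derivative G z) (at z)" if "Re z > 0" for z
  proof -
    have "z \<in> right_half_plane" using that by (simp add: right_half_plane_def)
    with H[OF this] show ?thesis by (simp only: at_within_open[OF _ open_right_half_plane])
  qed
  have G_eq: "G (Complex \<sigma> t) = of_real (exp (\<sigma> * x)) * (vertical F \<sigma> t * cis (x * t))" for \<sigma> t
    by (simp add: G_def vertical_def exp_eq_polar mult_ac)
  have int: "of_real (exp (\<sigma> * x)) * avg (\<lambda>t. vertical F \<sigma> t * cis (x * t)) T 0 =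
      of_real (1 / (2 * T)) * ((H (Complex \<sigma> T) - H (Complex \<sigma> (-T))) / \<i>)" if "\<sigma> > 0" "T > 0" for \<sigma> T
  proof -
    have "((\<lambda>t. G (Complex \<sigma> t)) has_integral (H (Complex \<sigma> T) / \<i> - H (Complex \<sigma> (-T)) / \<i>)) {-T..T}"
    proof (rule fundamental_theorem_of_calculus)
      fix t
      have *: "((\<lambda>t. Complex \<sigma> t) has_vector_derivative \<i>) (at t within {-T..T})"
        unfolding Complex_eq by (auto intro!: derivative_eq_intros)
      have "((H \<circ> (\<lambda>t. Complex \<sigma> t)) has_vector_derivative (\<i> * G (Complex \<sigma> t))) (at t within {-T..T})"
        by (rule field_vector_diff_chain_within[OF *])
          (use H[of "Complex \<sigma> t"] that in \<open>auto intro: has_field_derivative_at_within\<close>)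
      then have "((\<lambda>t. H (Complex \<sigma> t) / \<i>) has_vector_derivative (\<i> * G (Complex \<sigma> t)) / \<i>) (at t within {-T..T})"
        by (intro has_vector_derivative_divide) (simp add: o_def)
      then show "((\<lambda>t. H (Complex \<sigma> t) / \<i>) has_vector_derivative G (Complex \<sigma> t)) (at t within {-T..T})"
        by simp
    qed (use that in simp)
    then have "integral {-T..T} (\<lambda>t. G (Complex \<sigma> t)) = (H (Complex \<sigma> T) - H (Complex \<sigma> (-T))) / \<i>"
      by (simp only: integral_unique diff_divide_distrib)
    moreover have "bochner_ap (\<lambda>t. G (Complex \<sigma> t))" unfolding G_eq by (intro bochner_ap_cmult bochner_ap_mult bochner_ap_cis bochner_ap that)
    from avg_eq_integral[OF bochner_ap_continuous[OF this] that(2)]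
    have "of_real (exp (\<sigma> * x)) * avg (\<lambda>t. vertical F \<sigma> t * cis (x * t)) T 0 =
        of_real (1 / (2 * T)) * integral {-T..T} (\<lambda>t. G (Complex \<sigma> t))"
      unfolding G_eq avg_cmult .
    ultimately show ?thesis by simp
  qed
  \<comment> \<open>Between the abscissae \<open>s\<close> and \<open>r\<close> the function
    \<open>G\<close> is bounded by C exp(\<bar>x\<bar> r), so \<open>K\<close> bounds the increment
    of its primitive across the strip. After division by 2 T both horizontal sides together
    contribute at most K / T.\<close>
  define K where "K = C * exp (\<bar>x\<bar> * r) * (r - s)"
  have C0: "C \<ge> 0" using C[of 1] norm_ge_zero order_trans by (metis one_complex.sel(1) zero_less_one)
  have Hb: "norm (H (Complex r y) - H (Complex s y)) \<le> K" for y
  proof -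
    define S where "S = {z. s \<le> Re z \<and> Re z \<le> r}"
    have "S = {z. s \<le> Re z} \<inter> {z. Re z \<le> r}" by (auto simp: S_def)
    then have "convex S" by (simp add: convex_Int convex_halfspace_Re_ge convex_halfspace_Re_le)
    then have "norm (H (Complex r y) - H (Complex s y)) \<le> C * exp (\<bar>x\<bar> * r) * norm (Complex r y - Complex s y)"
    proof (rule field_differentiable_bound[where f'=G])
      fix z assume z: "z \<in> S"
      then have "Re z > 0" using s by (auto simp: S_def)
      then show "(H has_field_derivative G z) (at z within S)"
        by (rule has_field_derivative_at_within[OF H])
      have "x * Re z \<le> \<bar>x\<bar> * r"
        using z s by (intro mult_mono) (auto simp: S_def)
      then show "norm (G z) \<le> C * exp (\<bar>x\<bar> * r)"
        unfolding G_def norm_mult using C[OF \<open>Re z > 0\<close>] C0 by (intro mult_mono) (auto simp: mult.commute)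
    qed (use s in \<open>auto simp: S_def\<close>)
    also have "norm (Complex r y - Complex s y) = r - s"
      using s by (simp add: cmod_def)
    finally show ?thesis by (simp add: K_def)
  qed
  have lim: "((\<lambda>T. of_real (exp (\<sigma> * x)) * avg (\<lambda>t. vertical F \<sigma> t * cis (x * t)) T 0) \<longlongrightarrow> A \<sigma>) at_top" if "\<sigma> > 0" for \<sigma>
    unfolding A_def by (intro tendsto_intros tendsto_mean bochner_ap_mult bochner_ap_cis bochner_ap that)
  have "((\<lambda>T. of_real (exp (r * x)) * avg (\<lambda>t. vertical F r t * cis (x * t)) T 0 -
      of_real (exp (s * x)) * avg (\<lambda>t. vertical F s t * cis (x * t)) T 0) \<longlongrightarrow> A r - A s) at_top"
    using s by (intro tendsto_diff lim) auto
  moreover have "((\<lambda>T. of_real (exp (r * x)) * avg (\<lambda>t. vertical F r t * cis (x * t)) T 0 -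
      of_real (exp (s * x)) * avg (\<lambda>t. vertical F s t * cis (x * t)) T 0) \<longlongrightarrow> 0) at_top"
  proof (rule Lim_null_comparison)
    show "((\<lambda>T. K * inverse T) \<longlongrightarrow> 0) at_top"
      by (intro tendsto_mult_right_zero tendsto_inverse_0_at_top filterlim_ident)
    show "\<forall>\<^sub>F T in at_top. norm (of_real (exp (r * x)) * avg (\<lambda>t. vertical F r t * cis (x * t)) T 0 -
      of_real (exp (s * x)) * avg (\<lambda>t. vertical F s t * cis (x * t)) T 0) \<le> K * inverse T"
      using eventually_gt_at_top[of 0]
    proof eventually_elim
      case (elim T)
      have "of_real (exp (r * x)) * avg (\<lambda>t. vertical F r t * cis (x * t)) T 0 -
          of_real (exp (s * x)) * avg (\<lambda>t. vertical F s t * cis (x * t)) T 0 =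
          of_real (1 / (2 * T)) * (((H (Complex r T) - H (Complex s T)) - (H (Complex r (-T)) - H (Complex s (-T)))) / \<i>)"
        unfolding int[OF s(1) elim] int[OF less_trans[OF s] elim] by (simp add: diff_divide_distrib algebra_simps)
      also have "norm \<dots> = 1 / (2 * T) * norm ((H (Complex r T) - H (Complex s T)) - (H (Complex r (-T)) - H (Complex s (-T))))"
        using elim by (simp add: norm_mult norm_divide)
      also have "\<dots> \<le> 1 / (2 * T) * (K + K)"
        using elim by (intro mult_left_mono order_trans[OF norm_triangle_ineq4] add_mono Hb) auto
      finally show ?case using elim by (simp add: field_simps)
    qed
  qed
  ultimately have "A r - A s = 0" using tendsto_unique trivial_limit_at_top_linorder by blast
  then show ?thesis by (simp add: A_def)
qed

lemma bohr_coeff_tendsto: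
  assumes F: "half_plane_ap F C" and "\<sigma> > 0"
  shows "((\<lambda>T. of_real (1 / (2 * T)) *
        integral {-T..T} (\<lambda>t. vertical F \<sigma> t * exp (Complex \<sigma> t * of_real x))) \<longlongrightarrow>
      of_real (exp (\<sigma> * x)) * mean (\<lambda>t. vertical F \<sigma> t * cis (x * t))) at_top"
proof (rule Lim_transform_eventually)
  have bochner_ap: "bochner_ap (\<lambda>t. vertical F \<sigma> t * cis (x * t))"
    using F \<open>\<sigma> > 0\<close> by (intro bochner_ap_mult bochner_ap_cis) (simp add: half_plane_ap_def)
  show "((\<lambda>T. of_real (exp (\<sigma> * x)) * avg (\<lambda>t. vertical F \<sigma> t * cis (x * t)) T 0) \<longlongrightarrow>
      of_real (exp (\<sigma> * x)) * mean (\<lambda>t. vertical F \<sigma> t * cis (x * t))) at_top"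
    by (intro tendsto_intros tendsto_mean bochner_ap)
  have eq: "vertical F \<sigma> t * exp (Complex \<sigma> t * of_real x) = of_real (exp (\<sigma> * x)) * (vertical F \<sigma> t * cis (x * t))" for t
    by (simp add: exp_eq_polar mult_ac)
  show "\<forall>\<^sub>F T in at_top. of_real (exp (\<sigma> * x)) * avg (\<lambda>t. vertical F \<sigma> t * cis (x * t)) T 0 =
      of_real (1 / (2 * T)) * integral {-T..T} (\<lambda>t. vertical F \<sigma> t * exp (Complex \<sigma> t * of_real x))"
    using eventually_gt_at_top[of 0]
  proof eventually_elim
    case (elim T)
    show ?case unfolding eq avg_cmult[symmetric]
      by (rule avg_eq_integral[OF bochner_ap_continuous[OF bochner_ap_cmult[OF bochner_ap]] elim])
  qed
qed

lemma bohr_coeff_eqI: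
  assumes F: "half_plane_ap F C" and lim: "\<And>\<sigma>. \<sigma> > 0 \<Longrightarrow> ((\<lambda>T. of_real (1 / (2 * T)) *
        integral {-T..T} (\<lambda>t. vertical F \<sigma> t * exp (Complex \<sigma> t * of_real x))) \<longlongrightarrow> a) at_top"
  shows "bohr_coeff F x = a"
  unfolding bohr_coeff_def
proof (rule the_equality)
  fix b assume "\<forall>\<sigma>>0. ((\<lambda>T. of_real (1 / (2 * T)) *
        integral {-T..T} (\<lambda>t. vertical F \<sigma> t * exp (Complex \<sigma> t * of_real x))) \<longlongrightarrow> b) at_top"
  from this[rule_format, OF zero_less_one] show "b = a"
    by (rule tendsto_unique[OF trivial_limit_at_top_linorder _ lim[OF zero_less_one]])
qed (use lim in blast)

lemma bohr_coeff_eq: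
  assumes F: "half_plane_ap F C" and "\<sigma> > 0"
  shows "bohr_coeff F x = of_real (exp (\<sigma> * x)) * mean (\<lambda>t. vertical F \<sigma> t * cis (x * t))"
proof (rule bohr_coeff_eqI[OF F])
  fix r :: real assume "r > 0"
  have "of_real (exp (r * x)) * mean (\<lambda>t. vertical F r t * cis (x * t)) =
      of_real (exp (\<sigma> * x)) * mean (\<lambda>t. vertical F \<sigma> t * cis (x * t))"
    using bohr_mean_independent[OF F \<open>r > 0\<close>] bohr_mean_independent[OF F \<open>\<sigma> > 0\<close>, symmetric]
    by (cases r \<sigma> rule: linorder_cases) (blast | hypsubst | rule refl)+
  with bohr_coeff_tendsto[OF F \<open>r > 0\<close>, of x]
  show "((\<lambda>T. of_real (1 / (2 * T)) *
        integral {-T..T} (\<lambda>t. vertical F r t * exp (Complex r t * of_real x))) \<longlongrightarrow>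
        of_real (exp (\<sigma> * x)) * mean (\<lambda>t. vertical F \<sigma> t * cis (x * t))) at_top" by simp
qed

lemma mean_vertical:
  assumes F: "half_plane_ap F C" and "\<sigma> > 0"
  shows "mean (\<lambda>t. vertical F \<sigma> t * cis (x * t)) = bohr_coeff F x * of_real (exp (- (\<sigma> * x)))"
  by (simp add: bohr_coeff_eq[OF assms] exp_minus)

section \<open>Riesz sums of functions on the half-plane\<close>

lemma vertical_fejer_riesz:
  assumes freq: "frequency freq" and F: "half_plane_ap F C" and zero: "\<And>x. x \<notin> range freq \<Longrightarrow> bohr_coeff F x = 0"
    and "N > 0" "\<sigma> > 0"
  shows "(\<integral>u. vertical F \<sigma> (t + u / N) \<partial>fejer) = riesz freq (\<lambda>n. bohr_coeff F (freq n)) N (Complex \<sigma> t)"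
proof (rule bochner_ap_fejer_riesz[OF freq])
  show "bochner_ap (vertical F \<sigma>)" using F \<open>\<sigma> > 0\<close> by (simp add: half_plane_ap_def)
qed (use assms in \<open>simp_all add: mean_vertical[OF F]\<close>)

lemma norm_riesz_le_half_plane:
  assumes freq: "frequency freq" and F: "half_plane_ap F C" and zero: "\<And>x. x \<notin> range freq \<Longrightarrow> bohr_coeff F x = 0"
    and "N > 0"
  shows "norm (riesz freq (\<lambda>n. bohr_coeff F (freq n)) N (Complex 0 t)) \<le> C"
proof -
  let ?R = "riesz freq (\<lambda>n. bohr_coeff F (freq n)) N"
  have bnd: "norm (?R (Complex \<sigma> t)) \<le> C" if "\<sigma> > 0" for \<sigma>
  proof -
    have [measurable]: "vertical F \<sigma> \<in> borel_measurable borel"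
      using F that by (intro bochner_ap_measurable) (simp add: half_plane_ap_def)
    show ?thesis
      by (subst vertical_fejer_riesz[OF freq F zero \<open>N > 0\<close> that, symmetric], assumption)
        (rule fejer.norm_integral_le, measurable, use F that in \<open>auto simp: half_plane_ap_def vertical_def\<close>)
  qed
  have "isCont ?R (Complex 0 t)" unfolding riesz_def by (intro continuous_intros)
  moreover have "((\<lambda>\<sigma>. Complex \<sigma> t) \<longlongrightarrow> Complex 0 t) (at_right 0)"
    unfolding Complex_eq by (auto intro!: tendsto_eq_intros)
  ultimately have "((\<lambda>\<sigma>. ?R (Complex \<sigma> t)) \<longlongrightarrow> ?R (Complex 0 t)) (at_right 0)"
    by (rule isCont_tendsto_compose)
  then show ?thesis
    by (intro tendsto_upperbound[OF tendsto_norm])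
      (auto simp: eventually_at_right_less intro!: eventually_mono[OF eventually_at_right_less[of 0]] bnd)
qed

lemma riesz_tendsto_half_plane:
  assumes freq: "frequency freq" and F: "half_plane_ap F C" and zero: "\<And>x. x \<notin> range freq \<Longrightarrow> bohr_coeff F x = 0"
    and "Re z > 0"
  shows "(\<lambda>k. riesz freq (\<lambda>n. bohr_coeff F (freq n)) (real (Suc k)) z) \<longlonglongrightarrow> F z"
proof (rule LIMSEQ_I)
  fix e :: real assume "e > 0"
  then have e2: "e / 2 > 0" by simp
  define \<sigma> t where "\<sigma> = Re z" and "t = Im z"
  have z: "z = Complex \<sigma> t" by (simp add: \<sigma>_def t_def)
  have \<sigma>: "\<sigma> > 0" using assms by (simp add: \<sigma>_def)
  have "bochner_ap (vertical F \<sigma>)" using F \<sigma> by (simp add: half_plane_ap_def)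
  from bochner_ap_approximate_identity[OF this real_distribution_fejer e2] obtain a0 where a0: "a0 > 0"
    "\<And>a t. \<bar>a\<bar> \<le> a0 \<Longrightarrow> norm ((\<integral>s. vertical F \<sigma> (t + a * s) \<partial>fejer) - vertical F \<sigma> t) \<le> e / 2" by blast
  obtain N where N: "inverse (real (Suc N)) < a0" using reals_Archimedean[OF a0(1)] by blast
  have "norm (riesz freq (\<lambda>n. bohr_coeff F (freq n)) (real (Suc k)) z - F z) < e" if "k \<ge> N" for k
  proof -
    have "inverse (real (Suc k)) \<le> inverse (real (Suc N))" using that by (intro le_imp_inverse_le) auto
    then have "inverse (real (Suc k)) < a0" using N by (rule le_less_trans)
    then have "norm ((\<integral>s. vertical F \<sigma> (t + inverse (real (Suc k)) * s) \<partial>fejer) - vertical F \<sigma> t) \<le> e / 2"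
      by (intro a0(2)) (simp del: of_nat_Suc)
    then have "norm ((\<integral>s. vertical F \<sigma> (t + s / real (Suc k)) \<partial>fejer) - F z) \<le> e / 2"
      by (simp only: z vertical_def[of F \<sigma> t, symmetric] divide_inverse mult.commute[of "inverse _"])
    moreover have "(\<integral>s. vertical F \<sigma> (t + s / real (Suc k)) \<partial>fejer) = riesz freq (\<lambda>n. bohr_coeff F (freq n)) (real (Suc k)) z"
      unfolding z by (rule vertical_fejer_riesz[OF freq F zero _ \<sigma>]) (assumption, rule of_nat_0_less_iff[THEN iffD2], rule zero_less_Suc)
    ultimately have "norm (riesz freq (\<lambda>n. bohr_coeff F (freq n)) (real (Suc k)) z - F z) \<le> e / 2" by (simp only:)
    then show ?thesis using \<open>e > 0\<close> by linarith
  qed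
  then show "\<exists>no. \<forall>k\<ge>no. norm (riesz freq (\<lambda>n. bohr_coeff F (freq n)) (real (Suc k)) z - F z) < e" by blast
qed

lemma holomorphic_riesz: "riesz freq a N holomorphic_on S"
  unfolding riesz_def by (intro holomorphic_intros)

text \<open>The a priori bound that Phragmen--Lindelof needs; it depends on \<open>N\<close> and
  disappears from the final estimate.\<close>

lemma norm_riesz_le_sum:
  assumes freq: "frequency freq" and "Re z \<ge> 0"
  shows "norm (riesz freq a N z) \<le> (\<Sum>n | freq n < N. norm (a n))"
  unfolding riesz_def
proof (rule sum_norm_le)
  fix n
  have "freq n \<ge> 0" using freq by (simp add: frequency_def)
  then have "exp (- (freq n * Re z)) \<le> 1" using assms by simp
  then show "norm (of_real (tri (freq n / N)) * a n * exp (- of_real (freq n) * z)) \<le> norm (a n)"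
    unfolding norm_mult norm_exp_eq_Re
    by (simp add: mult_le_one mult.assoc mult.left_commute[of "tri _"] mult_left_le)
qed

text \<open>
  Phragmen--Lindelof for Dirichlet polynomials: dividing by \<open>1 + e z\<close> forces decay, so that the
  maximum principle applies on large half-discs.
\<close>

lemma norm_riesz_le_imaginary_axis:
  assumes freq: "frequency freq" and C: "\<And>t. norm (riesz freq a N (Complex 0 t)) \<le> C" and z: "Re z \<ge> 0"
  shows "norm (riesz freq a N z) \<le> C"
proof -
  define Q where "Q = riesz freq a N"
  define A where "A = (\<Sum>n | freq n < N. norm (a n))"
  have A: "norm (Q z) \<le> A" if "Re z \<ge> 0" for z
    unfolding Q_def A_def by (rule norm_riesz_le_sum[OF freq that])
  have C0: "C \<ge> 0" using C[of 0] norm_ge_zero order_trans by blast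
  have A0: "A \<ge> 0" unfolding A_def by (simp add: sum_nonneg)
  have bound: "norm (Q z) \<le> (C + e) * norm (1 + of_real e * z)" if e: "e > 0" for e
  proof -
    \<comment> \<open>The half-disc contains \<open>z\<close>, and
      \<open>R \<ge> A / (e * e)\<close> makes the contribution of the arc, A / (e R), at most
      \<open>e\<close>.\<close>
    define R where "R = norm z + A / (e * e) + 1"
    have R: "R > 0" "norm z \<le> R" "A / (e * R) \<le> e"
    proof -
      show "R > 0" using A0 e by (simp add: R_def add_nonneg_pos)
      have "e * e * R \<ge> A" using A0 e by (simp add: R_def distrib_left)
      then show "A / (e * R) \<le> e" using \<open>R > 0\<close> e by (simp add: divide_le_eq mult.assoc)
    qed (use A0 e in \<open>simp add: R_def\<close>)
    define S where "S = {z. Re z \<ge> 0} \<inter> cball 0 R"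
    have clS: "closed S" unfolding S_def by (intro closed_Int closed_halfspace_Re_ge closed_cball)
    define h where "h z = Q z / (1 + of_real e * z)" for z
    have Re1: "Re (1 + of_real e * w) \<ge> 1" if "Re w \<ge> 0" for w using that e by simp
    have nz: "1 + of_real e * w \<noteq> 0" if "Re w \<ge> 0" for w
      using Re1[OF that] by (metis not_one_le_zero zero_complex.sel(1))
    have hol: "h holomorphic_on S"
      unfolding h_def Q_def by (intro holomorphic_intros holomorphic_riesz) (use nz in \<open>auto simp: S_def\<close>)
    have ge1: "norm (1 + of_real e * w) \<ge> 1" if "Re w \<ge> 0" for w
      using Re1[OF that] complex_Re_le_cmod order_trans by blast
    have "norm (h z) \<le> C + e"
    proof (rule maximum_modulus_frontier[of h S])
      show "h holomorphic_on interior S" using hol holomorphic_on_subset interior_subset by blast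
      show "continuous_on (closure S) h" using hol clS by (simp add: holomorphic_on_imp_continuous_on)
      show "bounded S" unfolding S_def by (rule bounded_Int) simp
      show "z \<in> S" using z R by (simp add: S_def)
      fix w assume "w \<in> frontier S"
      then have w: "w \<in> S" "w \<notin> interior S" using clS by (auto simp: frontier_def)
      then have w0: "Re w \<ge> 0" "norm w \<le> R" by (auto simp: S_def)
      have "Re w = 0 \<or> norm w = R"
      proof (rule ccontr)
        assume "\<not> (Re w = 0 \<or> norm w = R)"
        then have "w \<in> {z. Re z > 0} \<inter> ball 0 R" using w0 by auto
        moreover have "open ({z. Re z > 0} \<inter> ball 0 R)" by (intro open_Int open_halfspace_Re_gt open_ball)
        moreover have "{z. Re z > 0} \<inter> ball 0 R \<subseteq> S" by (auto simp: S_def)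
        ultimately show False using w(2) interiorI by blast
      qed
      then show "norm (h w) \<le> C + e"
      proof
        assume "Re w = 0"
        then have "w = Complex 0 (Im w)" by (simp add: complex_eq_iff)
        then have "norm (Q w) \<le> C" unfolding Q_def using C[of "Im w"] by metis
        then have "norm (Q w) / norm (1 + of_real e * w) \<le> C / 1"
          using ge1[OF w0(1)] C0 by (intro frac_le) auto
        then show ?thesis using e by (simp add: h_def norm_divide)
      next
        assume wR: "norm w = R"
        \<comment> \<open>In the right half-plane adding 1 does not decrease the modulus, so on the
          arc the denominator is at least e R.\<close>
        have "(norm (of_real e * w))\<^sup>2 \<le> (norm (1 + of_real e * w))\<^sup>2"
        proof -
          have "(norm (1 + of_real e * w))\<^sup>2 = 1 + 2 * (e * Re w) + (norm (of_real e * w))\<^sup>2"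
            unfolding cmod_power2 by (simp add: power2_eq_square algebra_simps)
          moreover have "0 \<le> e * Re w" using e w0 by simp
          ultimately show ?thesis by linarith
        qed
        then have "norm (of_real e * w) \<le> norm (1 + of_real e * w)"
          by (rule power2_le_imp_le) (rule norm_ge_zero)
        moreover have "norm (of_real e * w) = e * R" using e wR by (simp add: norm_mult)
        ultimately have "e * R \<le> norm (1 + of_real e * w)" by (simp only:)
        then have "norm (Q w) / norm (1 + of_real e * w) \<le> A / (e * R)"
          using A[OF w0(1)] A0 e R by (intro frac_le) auto
        then show ?thesis using R(3) C0 by (simp add: h_def norm_divide)
      qed
    qed
    moreover have "norm (Q z) = norm (h z) * norm (1 + of_real e * z)"
      using nz[OF z] by (simp add: h_def norm_divide)
    ultimately show ?thesis by (simp add: mult_right_mono)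
  qed
  have "((\<lambda>e. (C + e) * norm (1 + of_real e * z)) \<longlongrightarrow> (C + 0) * norm (1 + of_real 0 * z)) (at_right 0)"
    by (intro tendsto_intros)
  then have "norm (Q z) \<le> (C + 0) * norm (1 + of_real 0 * z)"
    by (rule tendsto_lowerbound) (auto intro!: eventually_mono[OF eventually_at_right_less[of 0]] bound)
  then show ?thesis by (simp add: Q_def)
qed

text \<open>Cauchy's estimate on discs of radius s/2, whose closures stay inside the open
  half-plane. The Lipschitz constant depends only on \<open>C\<close> and \<open>s\<close>, hence is
  common to all Riesz sums.\<close>

lemma norm_diff_le_half_plane:
  assumes hol: "f holomorphic_on right_half_plane" and C: "\<And>z. Re z > 0 \<Longrightarrow> norm (f z) \<le> C"
    and s: "0 < s" "s \<le> \<sigma>"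
  shows "norm (f (Complex \<sigma> t) - f (Complex \<sigma> u)) \<le> 2 * C / s * \<bar>t - u\<bar>"
proof -
  define S where "S = {z. Re z \<ge> s}"
  have "norm (f (Complex \<sigma> t) - f (Complex \<sigma> u)) \<le> 2 * C / s * norm (Complex \<sigma> t - Complex \<sigma> u)"
  proof (rule field_differentiable_bound[where f'="deriv f"])
    show "convex S" unfolding S_def by (rule convex_halfspace_Re_ge)
    fix z assume z: "z \<in> S"
    then have "z \<in> right_half_plane" using s by (simp add: S_def right_half_plane_def)
    then show "(f has_field_derivative deriv f z) (at z within S)"
      using holomorphic_derivI[OF hol open_right_half_plane] by blast
    have ball: "Re w > 0" if "w \<in> cball z (s/2)" for w
    proof -
      have "\<bar>Re (z - w)\<bar> \<le> s/2" using that abs_Re_le_cmod[of "z - w"] by (simp add: dist_norm)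
      then have "Re (z - w) \<le> s/2" by (rule abs_le_D1)
      then show ?thesis using z s by (simp add: S_def)
    qed
    have "norm ((deriv ^^ 1) f z) \<le> fact 1 * C / (s/2)^1"
    proof (rule Cauchy_inequality)
      have sub: "cball z (s/2) \<subseteq> right_half_plane" using ball by (auto simp: right_half_plane_def)
      then show "f holomorphic_on ball z (s/2)"
        using hol holomorphic_on_subset ball_subset_cball by blast
      show "continuous_on (cball z (s/2)) f"
        using sub hol holomorphic_on_imp_continuous_on continuous_on_subset by blast
      show "norm (f x) \<le> C" if "norm (z - x) = s/2" for x
        using that by (intro C ball) (simp add: dist_norm)
    qed (use s in simp)
    then show "norm (deriv f z) \<le> 2 * C / s" by (simp add: mult.commute)
  qed (use s in \<open>auto simp: S_def\<close>)
  also have "norm (Complex \<sigma> t - Complex \<sigma> u) = \<bar>t - u\<bar>" by (simp add: cmod_def)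
  finally show ?thesis .
qed

section \<open>From bounded Riesz sums to a function on the half-plane\<close>

lemma riesz_fejer:
  "(\<integral>u. riesz freq a M (Complex \<sigma> (t + u / N)) \<partial>fejer) =
    riesz freq (\<lambda>n. of_real (tri (freq n / N)) * a n) M (Complex \<sigma> t)"
proof -
  have eq: "exp (- of_real x * Complex \<sigma> (t + u / N)) = exp (- of_real x * Complex \<sigma> t) * cis ((- x / N) * u)" for x u
    unfolding exp_Complex by (simp add: cis_mult distrib_left)
  have int: "integrable fejer (\<lambda>u. cis ((- x / N) * u))" for x
    by (rule fejer.integrable_bounded[where C=1]) auto
  have "(\<integral>u. riesz freq a M (Complex \<sigma> (t + u / N)) \<partial>fejer) =
     (\<Sum>n | freq n < M. (\<integral>u. of_real (tri (freq n / M)) * a n * exp (- of_real (freq n) * Complex \<sigma> (t + u / N)) \<partial>fejer))"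
    unfolding riesz_def
    by (intro Bochner_Integration.integral_sum) (simp only: eq mult.assoc[symmetric], intro integrable_mult_right int)
  also have "\<dots> = (\<Sum>n | freq n < M. of_real (tri (freq n / M)) * a n * exp (- of_real (freq n) * Complex \<sigma> t) * of_real (tri (freq n / N)))"
  proof (intro sum.cong refl)
    fix n
    have "(\<integral>u. of_real (tri (freq n / M)) * a n * exp (- of_real (freq n) * Complex \<sigma> (t + u / N)) \<partial>fejer)
      = of_real (tri (freq n / M)) * a n * exp (- of_real (freq n) * Complex \<sigma> t) * (\<integral>u. cis ((- freq n / N) * u) \<partial>fejer)"
      by (simp only: eq mult.assoc[symmetric] integral_mult_right_zero)
    then show "(\<integral>u. of_real (tri (freq n / M)) * a n * exp (- of_real (freq n) * Complex \<sigma> (t + u / N)) \<partial>fejer) =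
        of_real (tri (freq n / M)) * a n * exp (- of_real (freq n) * Complex \<sigma> t) * of_real (tri (freq n / N))"
      unfolding char_fejer by simp
  qed
  finally show ?thesis by (simp add: riesz_def mult_ac)
qed

lemma tendsto_tri: "(\<lambda>k. tri (x / real (Suc k))) \<longlonglongrightarrow> 1"
proof -
  have "(\<lambda>k. max 0 (1 - \<bar>x / real (Suc k)\<bar>)) \<longlonglongrightarrow> max 0 (1 - \<bar>0\<bar>)"
    by (intro tendsto_intros LIMSEQ_Suc lim_const_over_n)
  then show ?thesis by (simp add: tri_def)
qed

text \<open>
  With coefficients damped at level \<open>N\<close>, the Riesz sums are finite sums of fixed length, so they
  converge as the outer level grows.
\<close>

lemma riesz_damped_tendsto:
  assumes freq: "frequency freq" and "N > 0"
  shows "(\<lambda>k. riesz freq (\<lambda>n. of_real (tri (freq n / N)) * a n) (real (Suc k)) z) \<longlonglongrightarrow> riesz freq a N z"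
proof -
  have nn: "freq n \<ge> 0" for n using freq by (simp add: frequency_def)
  have "(\<lambda>k. \<Sum>n | freq n < N. of_real (tri (freq n / real (Suc k))) * (of_real (tri (freq n / N)) * a n) * exp (- of_real (freq n) * z))
    \<longlonglongrightarrow> (\<Sum>n | freq n < N. of_real 1 * (of_real (tri (freq n / N)) * a n) * exp (- of_real (freq n) * z))"
    by (intro tendsto_intros tendsto_tri)
  moreover have "\<forall>\<^sub>F k in sequentially.
    (\<Sum>n | freq n < N. of_real (tri (freq n / real (Suc k))) * (of_real (tri (freq n / N)) * a n) * exp (- of_real (freq n) * z)) =
    riesz freq (\<lambda>n. of_real (tri (freq n / N)) * a n) (real (Suc k)) z"
  proof -
    obtain K where K: "real K \<ge> N" using real_arch_simple by blast
    have "(\<Sum>n | freq n < N. of_real (tri (freq n / real (Suc k))) * (of_real (tri (freq n / N)) * a n) * exp (- of_real (freq n) * z)) =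
      riesz freq (\<lambda>n. of_real (tri (freq n / N)) * a n) (real (Suc k)) z" if "k \<ge> K" for k
      unfolding riesz_def
    proof (rule sum.mono_neutral_left)
      show "{n. freq n < N} \<subseteq> {n. freq n < real (Suc k)}" using K that by auto
      show "\<forall>n\<in>{n. freq n < real (Suc k)} - {n. freq n < N}. of_real (tri (freq n / real (Suc k))) *
          (of_real (tri (freq n / N)) * a n) * exp (- of_real (freq n) * z) = 0"
        using \<open>N > 0\<close> nn by (auto simp: not_less abs_div intro!: tri_eq_0)
    qed (rule frequency_finite[OF freq])
    then show ?thesis unfolding eventually_sequentially by blast
  qed
  ultimately show ?thesis unfolding riesz_def[of freq a] by (auto intro: Lim_transform_eventually)
qed

lemma bochner_ap_riesz_vertical: "bochner_ap (\<lambda>t. riesz freq a N (Complex \<sigma> t))"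
proof -
  have "bochner_ap (\<lambda>t. cis (- (x * t)))" for x using bochner_ap_cis[of "-x"] by simp
  then show ?thesis unfolding riesz_def exp_Complex
    by (intro bochner_ap_sum bochner_ap_cmult)
qed

text \<open>The sum on the right has at most one term; it treats \<open>x\<close> inside and outside
  the range of the frequency together.\<close>

lemma mean_riesz_vertical:
  assumes freq: "frequency freq" and "N > 0"
  shows "mean (\<lambda>t. riesz freq a N (Complex \<sigma> t) * cis (x * t)) =
    (\<Sum>n | freq n = x. of_real (tri (x / N)) * a n * of_real (exp (- (\<sigma> * x))))"
proof -
  have "riesz freq a N (Complex \<sigma> t) * cis (x * t) =
      (\<Sum>n | freq n < N. of_real (tri (freq n / N)) * a n * of_real (exp (- (\<sigma> * freq n))) * cis ((x - freq n) * t))" for t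
    unfolding riesz_def exp_Complex by (simp add: sum_distrib_right mult.assoc cis_mult left_diff_distrib)
  then have "mean (\<lambda>t. riesz freq a N (Complex \<sigma> t) * cis (x * t)) =
      (\<Sum>n | freq n < N. mean (\<lambda>t. of_real (tri (freq n / N)) * a n * of_real (exp (- (\<sigma> * freq n))) * cis ((x - freq n) * t)))"
    by (simp only:) (intro mean_sum bochner_ap_cmult bochner_ap_cis)
  also have "\<dots> = (\<Sum>n | freq n < N. if freq n = x then of_real (tri (x / N)) * a n * of_real (exp (- (\<sigma> * x))) else 0)"
    by (intro sum.cong refl) (simp only: mean_cmult[OF bochner_ap_cis] mean_cis, simp)
  also have "\<dots> = (\<Sum>n\<in>{n. freq n < N} \<inter> {n. freq n = x}. of_real (tri (x / N)) * a n * of_real (exp (- (\<sigma> * x))))"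
    using frequency_finite[OF freq] by (simp add: sum.inter_restrict)
  also have "\<dots> = (\<Sum>n | freq n = x. of_real (tri (x / N)) * a n * of_real (exp (- (\<sigma> * x))))"
  proof (rule sum.mono_neutral_left)
    show "finite {n. freq n = x}" by (rule finite_subset[OF _ frequency_finite[OF freq, of "x + 1"]]) auto
    have "x \<ge> 0" if "freq n = x" for n using freq that by (auto simp: frequency_def)
    then show "\<forall>n\<in>{n. freq n = x} - {n. freq n < N} \<inter> {n. freq n = x}. of_real (tri (x / N)) * a n * of_real (exp (- (\<sigma> * x))) = 0"
      using \<open>N > 0\<close> by (auto simp: not_less abs_div intro!: tri_eq_0)
  qed auto
  finally show ?thesis .
qed

text \<open>Damping a Riesz sum of level \<open>M\<close> at a large level \<open>N\<close> changes
  it by at most e/2, uniformly in \<open>M\<close>, by the common Lipschitz constant. For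
  \<open>M\<close> to infinity the damped sums tend to the Riesz sums of levels \<open>N\<close> and
  \<open>N'\<close>, while both stay near the same undamped sum.\<close>

lemma riesz_uniformly_Cauchy:
  assumes freq: "frequency freq" and C: "\<And>N t. N > 0 \<Longrightarrow> norm (riesz freq a N (Complex 0 t)) \<le> C"
    and "s > 0" "e > 0"
  obtains N0 where "N0 > 0" "\<And>N N' z. N \<ge> N0 \<Longrightarrow> N' \<ge> N0 \<Longrightarrow> Re z \<ge> s \<Longrightarrow>
    norm (riesz freq a N z - riesz freq a N' z) \<le> e"
proof -
  define D where "D = max C 1"
  have D: "D > 0" by (simp add: D_def)
  have bnd: "norm (riesz freq a N z) \<le> D" if "N > 0" "Re z \<ge> 0" for N z
    using norm_riesz_le_imaginary_axis[OF freq C[OF that(1)] that(2)] by (simp add: D_def)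
  \<comment> \<open>With the Lipschitz constant 2 D / s this modulus gives e/4, as
    \<open>approximate_identity\<close> asks for the tolerance e/2.\<close>
  define d where "d = s * e / (8 * D)"
  have "d > 0" using D \<open>s > 0\<close> \<open>e > 0\<close> by (simp add: d_def)
  have e2: "e / 2 > 0" using \<open>e > 0\<close> by simp
  obtain a0 where a0: "a0 > 0"
    "\<And>a g t. \<bar>a\<bar> \<le> a0 \<Longrightarrow> g \<in> borel_measurable borel \<Longrightarrow> (\<And>x. norm (g x :: complex) \<le> D) \<Longrightarrow>
      (\<And>u. \<bar>u\<bar> < d \<Longrightarrow> norm (g (t + u) - g t) \<le> e / 2 / 2) \<Longrightarrow>
      norm ((\<integral>s. g (t + a * s) \<partial>fejer) - g t) \<le> e / 2"
    using fejer.approximate_identity[OF D e2 \<open>d > 0\<close>] by blast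
  have step: "norm (riesz freq (\<lambda>n. of_real (tri (freq n / N)) * a n) M z - riesz freq a M z) \<le> e / 2"
    if "M > 0" "N \<ge> 1 / a0" "Re z \<ge> s" for M N z
  proof -
    define \<sigma> t where "\<sigma> = Re z" and "t = Im z"
    have z: "z = Complex \<sigma> t" by (simp add: \<sigma>_def t_def)
    have \<sigma>: "\<sigma> \<ge> s" using that by (simp add: \<sigma>_def)
    have "N > 0" using that a0(1) by (meson divide_pos_pos less_le_trans zero_less_one)
    have "norm ((\<integral>u. riesz freq a M (Complex \<sigma> (t + 1 / N * u)) \<partial>fejer) - riesz freq a M (Complex \<sigma> t)) \<le> e / 2"
    proof (rule a0(2))
      show "\<bar>1 / N\<bar> \<le> a0" using that(2) \<open>N > 0\<close> a0(1) by (simp add: field_simps)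
      show "(\<lambda>t. riesz freq a M (Complex \<sigma> t)) \<in> borel_measurable borel"
        by (rule bochner_ap_measurable[OF bochner_ap_riesz_vertical])
      show "norm (riesz freq a M (Complex \<sigma> x)) \<le> D" for x
        using \<sigma> \<open>s > 0\<close> \<open>M > 0\<close> by (intro bnd) auto
      fix u assume u: "\<bar>u\<bar> < d"
      have "norm (riesz freq a M (Complex \<sigma> (t + u)) - riesz freq a M (Complex \<sigma> t)) \<le> 2 * D / s * \<bar>t + u - t\<bar>"
        by (rule norm_diff_le_half_plane[OF holomorphic_riesz _ \<open>s > 0\<close> \<sigma>]) (use bnd \<open>M > 0\<close> in auto)
      also have "\<dots> \<le> 2 * D / s * d" using u D \<open>s > 0\<close> by (intro mult_left_mono) auto
      also have "\<dots> = e / 2 / 2" using D \<open>s > 0\<close> by (simp add: d_def)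
      finally show "norm (riesz freq a M (Complex \<sigma> (t + u)) - riesz freq a M (Complex \<sigma> t)) \<le> e / 2 / 2" .
    qed
    then show ?thesis using riesz_fejer[of freq a M \<sigma> t N] by (simp add: z)
  qed
  have "norm (riesz freq a N z - riesz freq a N' z) \<le> e"
    if N: "N \<ge> 1 / a0" "N' \<ge> 1 / a0" and z: "Re z \<ge> s" for N N' z
  proof -
    have pos: "N > 0" "N' > 0" using N a0(1) by (meson divide_pos_pos less_le_trans zero_less_one)+
    let ?R = "\<lambda>N k. riesz freq (\<lambda>n. of_real (tri (freq n / N)) * a n) (real (Suc k)) z"
    have "(\<lambda>k. ?R N k - ?R N' k) \<longlonglongrightarrow> riesz freq a N z - riesz freq a N' z"
      by (intro tendsto_diff riesz_damped_tendsto[OF freq] pos)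
    moreover have "norm (?R N k - ?R N' k) \<le> e" for k
    proof -
      have "norm (?R N k - riesz freq a (real (Suc k)) z) \<le> e / 2" "norm (riesz freq a (real (Suc k)) z - ?R N' k) \<le> e / 2"
        using step[of "real (Suc k)" N z] step[of "real (Suc k)" N' z] N z
        by (simp_all add: norm_minus_commute del: of_nat_Suc)
      from norm_triangle_mono[OF this] show ?thesis by simp
    qed
    ultimately show ?thesis by (intro tendsto_upperbound[OF tendsto_norm]) (auto simp del: of_nat_Suc)
  qed
  moreover have "1 / a0 > 0" using a0(1) by simp
  ultimately show ?thesis using that by blast
qed

text \<open>Uniform convergence of the Riesz sums on each Re z \<ge> s gives everything at once:
  holomorphy, almost periodicity on vertical lines, and the Bohr coefficients, because the mean is
  continuous in the supremum norm.\<close>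

theorem half_plane_of_riesz_bounded:
  assumes freq: "frequency freq" and C: "\<And>N t. N > 0 \<Longrightarrow> norm (riesz freq a N (Complex 0 t)) \<le> C"
  obtains F where "half_plane_ap F C" "\<And>z. z \<notin> right_half_plane \<Longrightarrow> F z = 0"
    "\<And>n. bohr_coeff F (freq n) = a n" "\<And>x. x \<notin> range freq \<Longrightarrow> bohr_coeff F x = 0"
proof -
  define R where "R k z = riesz freq a (real (Suc k)) z" for k z
  define F where "F z = (if Re z > 0 then lim (\<lambda>k. R k z) else 0)" for z
  have Cauchy: "\<exists>K. \<forall>k\<ge>K. \<forall>k'\<ge>K. \<forall>z. Re z \<ge> s \<longrightarrow> norm (R k z - R k' z) \<le> e" if se: "s > 0" "e > 0" for s e
  proof -
    obtain N0 where N0: "N0 > 0" "\<And>N N' z. N \<ge> N0 \<Longrightarrow> N' \<ge> N0 \<Longrightarrow> Re z \<ge> s \<Longrightarrow>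
        norm (riesz freq a N z - riesz freq a N' z) \<le> e"
      using riesz_uniformly_Cauchy[OF freq C se] by blast
    obtain K where K: "real K \<ge> N0" using real_arch_simple by blast
    have "norm (R k z - R k' z) \<le> e" if "k \<ge> K" "k' \<ge> K" "Re z \<ge> s" for k k' z
      unfolding R_def by (rule N0(2)) (use that K in auto)
    then show ?thesis by blast
  qed
  have lim: "(\<lambda>k. R k z) \<longlonglongrightarrow> F z" if "Re z > 0" for z
  proof -
    have "Cauchy (\<lambda>k. R k z)" unfolding Cauchy_def dist_norm
    proof (intro allI impI)
      fix e :: real assume "e > 0"
      then have "e / 2 > 0" by simp
      from Cauchy[OF that this] obtain K where K: "\<And>k k'. k \<ge> K \<Longrightarrow> k' \<ge> K \<Longrightarrow> norm (R k z - R k' z) \<le> e / 2" by blast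
      have "norm (R k z - R k' z) < e" if "k \<ge> K" "k' \<ge> K" for k k'
        using K[OF that] \<open>e > 0\<close> by linarith
      then show "\<exists>M. \<forall>m\<ge>M. \<forall>n\<ge>M. norm (R m z - R n z) < e" by blast
    qed
    then have "convergent (\<lambda>k. R k z)" by (rule Cauchy_convergent)
    then show ?thesis using that by (simp add: F_def convergent_LIMSEQ_iff)
  qed
  have unif: "\<exists>K. \<forall>k\<ge>K. \<forall>z. Re z \<ge> s \<longrightarrow> norm (R k z - F z) \<le> e" if s: "s > 0" and e: "e > 0" for s e
  proof -
    from Cauchy[OF s e] obtain K where K: "\<And>k k' z. k \<ge> K \<Longrightarrow> k' \<ge> K \<Longrightarrow> Re z \<ge> s \<Longrightarrow> norm (R k z - R k' z) \<le> e"
      by blast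
    have "norm (R k z - F z) \<le> e" if "k \<ge> K" "Re z \<ge> s" for k z
    proof (rule Lim_bounded)
      show "(\<lambda>k'. norm (R k z - R k' z)) \<longlonglongrightarrow> norm (R k z - F z)"
        by (intro tendsto_intros lim) (use s that in linarith)
      show "\<forall>k'\<ge>K. norm (R k z - R k' z) \<le> e" using K that by blast
    qed
    then show ?thesis by blast
  qed
  have F: "half_plane_ap F C" unfolding half_plane_ap_def
  proof (intro conjI allI impI)
    show "F holomorphic_on right_half_plane"
    proof (rule holomorphic_uniform_sequence[OF open_right_half_plane, of R])
      show "R k holomorphic_on right_half_plane" for k unfolding R_def by (rule holomorphic_riesz)
      fix z assume "z \<in> right_half_plane"
      then have z: "Re z / 2 > 0" by (simp add: right_half_plane_def)
      have sub: "Re w \<ge> Re z / 2" if "w \<in> cball z (Re z / 2)" for w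
      proof -
        have "\<bar>Re (z - w)\<bar> \<le> Re z / 2" using that abs_Re_le_cmod[of "z - w"] by (simp add: dist_norm)
        then have "Re (z - w) \<le> Re z / 2" by (rule abs_le_D1)
        then show ?thesis by simp
      qed
      show "\<exists>d>0. cball z d \<subseteq> right_half_plane \<and> uniform_limit (cball z d) R F sequentially"
      proof (intro exI[of _ "Re z / 2"] conjI z)
        show "cball z (Re z / 2) \<subseteq> right_half_plane"
          unfolding right_half_plane_def using sub z less_le_trans by blast
        show "uniform_limit (cball z (Re z / 2)) R F sequentially"
        proof (rule uniform_limitI)
          fix e :: real assume "e > 0"
          then have "e / 2 > 0" by simp
          from unif[OF z this] obtain K where K: "\<And>k w. k \<ge> K \<Longrightarrow> Re w \<ge> Re z / 2 \<Longrightarrow> norm (R k w - F w) \<le> e / 2" by blast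
          have "dist (R k w) (F w) < e" if "k \<ge> K" "w \<in> cball z (Re z / 2)" for k w
            using K[OF that(1) sub[OF that(2)]] \<open>e > 0\<close> unfolding dist_norm by linarith
          then show "\<forall>\<^sub>F n in sequentially. \<forall>x\<in>cball z (Re z / 2). dist (R n x) (F x) < e"
            unfolding eventually_sequentially by blast
        qed
      qed
    qed
    fix z assume z: "Re z > 0"
    show "norm (F z) \<le> C"
    proof (rule tendsto_upperbound[OF tendsto_norm[OF lim[OF z]]])
      have "norm (R k z) \<le> C" for k
        unfolding R_def by (rule norm_riesz_le_imaginary_axis[OF freq C]) (use z in auto)
      then show "\<forall>\<^sub>F k in sequentially. norm (R k z) \<le> C" by simp
    qed simp
  next
    fix \<sigma> :: real assume \<sigma>: "\<sigma> > 0"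
    show "bochner_ap (vertical F \<sigma>)"
    proof (rule bochner_ap_uniform_limit)
      fix e :: real assume "e > 0"
      from unif[OF \<sigma> this] obtain K where "\<And>z. Re z \<ge> \<sigma> \<Longrightarrow> norm (R K z - F z) \<le> e" by blast
      then show "\<exists>h. bochner_ap h \<and> (\<forall>x. norm (vertical F \<sigma> x - h x) \<le> e)"
        by (intro exI[of _ "\<lambda>t. R K (Complex \<sigma> t)"])
          (simp add: R_def bochner_ap_riesz_vertical vertical_def norm_minus_commute)
    qed
  qed
  have bohr: "bohr_coeff F x = (\<Sum>n | freq n = x. a n)" for x
  proof -
    have ap1: "bochner_ap (vertical F 1)" using F by (simp add: half_plane_ap_def)
    have apR: "bochner_ap (\<lambda>t. R k (Complex 1 t))" for k unfolding R_def by (rule bochner_ap_riesz_vertical)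
    have "(\<lambda>k. mean (\<lambda>t. R k (Complex 1 t) * cis (x * t))) \<longlonglongrightarrow> mean (\<lambda>t. vertical F 1 t * cis (x * t))"
    proof (rule LIMSEQ_I)
      fix e :: real assume "e > 0"
      then have "e / 2 > 0" by simp
      from unif[OF zero_less_one this] obtain K where K: "\<And>k z. k \<ge> K \<Longrightarrow> Re z \<ge> 1 \<Longrightarrow> norm (R k z - F z) \<le> e / 2" by blast
      have "norm (mean (\<lambda>t. R k (Complex 1 t) * cis (x * t)) - mean (\<lambda>t. vertical F 1 t * cis (x * t))) < e" if "k \<ge> K" for k
      proof -
        have "norm (mean (\<lambda>t. R k (Complex 1 t) * cis (x * t)) - mean (\<lambda>t. vertical F 1 t * cis (x * t))) \<le> e / 2"
        proof (intro norm_mean_diff_le bochner_ap_mult bochner_ap_cis ap1 apR)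
          fix t
          have "norm ((R k (Complex 1 t) - F (Complex 1 t)) * cis (x * t)) \<le> e / 2"
            using K[OF that, of "Complex 1 t"] by (simp add: norm_mult)
          then show "norm (R k (Complex 1 t) * cis (x * t) - vertical F 1 t * cis (x * t)) \<le> e / 2"
            by (simp only: vertical_def left_diff_distrib)
        qed
        then show ?thesis using \<open>e > 0\<close> by linarith
      qed
      then show "\<exists>no. \<forall>k\<ge>no. norm (mean (\<lambda>t. R k (Complex 1 t) * cis (x * t)) - mean (\<lambda>t. vertical F 1 t * cis (x * t))) < e"
        by blast
    qed
    moreover have "(\<lambda>k. mean (\<lambda>t. R k (Complex 1 t) * cis (x * t))) \<longlonglongrightarrow> (\<Sum>n | freq n = x. of_real 1 * a n * of_real (exp (- (1 * x))))"
    proof -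
      have "mean (\<lambda>t. R k (Complex 1 t) * cis (x * t)) =
          (\<Sum>n | freq n = x. of_real (tri (x / real (Suc k))) * a n * of_real (exp (- (1 * x))))" for k
        unfolding R_def by (rule mean_riesz_vertical[OF freq]) simp
      moreover have "(\<lambda>k. \<Sum>n | freq n = x. of_real (tri (x / real (Suc k))) * a n * of_real (exp (- (1 * x))))
          \<longlonglongrightarrow> (\<Sum>n | freq n = x. of_real 1 * a n * of_real (exp (- (1 * x))))"
        by (intro tendsto_intros tendsto_tri)
      ultimately show ?thesis by (simp only:)
    qed
    ultimately have "mean (\<lambda>t. vertical F 1 t * cis (x * t)) = (\<Sum>n | freq n = x. of_real 1 * a n * of_real (exp (- (1 * x))))"
      by (rule LIMSEQ_unique)
    then show ?thesis unfolding bohr_coeff_eq[OF F zero_less_one]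
      by (simp add: exp_minus flip: sum_distrib_right)
  qed
  show ?thesis
  proof (rule that[OF F])
    show "F z = 0" if "z \<notin> right_half_plane" for z using that by (simp add: F_def right_half_plane_def)
    show "bohr_coeff F (freq n) = a n" for n
    proof -
      have "{k. freq k = freq n} = {n}" using frequency_inj[OF freq] by (auto dest: injD)
      then show ?thesis by (simp add: bohr)
    qed
    show "bohr_coeff F x = 0" if "x \<notin> range freq" for x
    proof -
      have "{n. freq n = x} = {}" using that by auto
      then show ?thesis by (simp add: bohr)
    qed
  qed
qed

section \<open>Dirichlet groups\<close>

text \<open>The group need not be second countable, so continuity on the product does not give
  measurability for the product sigma-algebra. Rounding \<open>t\<close> down to multiples of 1 / (n
  + 1) leaves countably many measurable sections.\<close>

lemma measurable_caratheodory:
  fixes G :: "'a \<Rightarrow> real \<Rightarrow> complex"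
  assumes meas: "\<And>t. (\<lambda>x. G x t) \<in> borel_measurable M" and cont: "\<And>x. continuous_on UNIV (G x)"
  shows "case_prod G \<in> borel_measurable (M \<Otimes>\<^sub>M borel)"
proof (rule borel_measurable_LIMSEQ_metric)
  show "(\<lambda>p. G (fst p) (of_int \<lfloor>snd p * real (Suc n)\<rfloor> / real (Suc n))) \<in> borel_measurable (M \<Otimes>\<^sub>M borel)" for n
  proof (rule measurable_compose_countable[where f="\<lambda>i p. G (fst p) (real_of_int i / real (Suc n))"
        and g="\<lambda>p. \<lfloor>snd p * real (Suc n)\<rfloor>"])
    show "(\<lambda>p. G (fst p) (real_of_int i / real (Suc n))) \<in> borel_measurable (M \<Otimes>\<^sub>M borel)" for i
      by (rule measurable_compose[OF measurable_fst meas])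
  qed measurable
  fix p :: "'a \<times> real" assume "p \<in> space (M \<Otimes>\<^sub>M borel)"
  obtain x t where p: "p = (x, t)" by (cases p)
  have "(\<lambda>n. real_of_int \<lfloor>t * real (Suc n)\<rfloor> / real (Suc n)) \<longlonglongrightarrow> t"
  proof (rule real_tendsto_sandwich)
    show "(\<lambda>n. t - 1 / real (Suc n)) \<longlonglongrightarrow> t"
      using tendsto_diff[OF tendsto_const LIMSEQ_Suc[OF lim_const_over_n[of 1]], of t] by simp
    show "\<forall>\<^sub>F n in sequentially. t - 1 / real (Suc n) \<le> real_of_int \<lfloor>t * real (Suc n)\<rfloor> / real (Suc n)"
    proof (intro always_eventually allI)
      fix n
      have "t * real (Suc n) - 1 \<le> real_of_int \<lfloor>t * real (Suc n)\<rfloor>" by linarith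
      then have "(t * real (Suc n) - 1) / real (Suc n) \<le> real_of_int \<lfloor>t * real (Suc n)\<rfloor> / real (Suc n)"
        by (rule divide_right_mono) simp
      then show "t - 1 / real (Suc n) \<le> real_of_int \<lfloor>t * real (Suc n)\<rfloor> / real (Suc n)"
        by (simp add: diff_divide_distrib del: of_nat_Suc)
    qed
    show "\<forall>\<^sub>F n in sequentially. real_of_int \<lfloor>t * real (Suc n)\<rfloor> / real (Suc n) \<le> t"
      by (intro always_eventually allI) (simp add: divide_le_eq del: of_nat_Suc)
  qed simp
  then show "(\<lambda>n. G (fst p) (real_of_int \<lfloor>snd p * real (Suc n)\<rfloor> / real (Suc n))) \<longlonglongrightarrow> case_prod G p"
    using continuous_on_tendsto_compose[OF cont, of _ t sequentially x] by (simp add: p)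
qed

lemma compact_Urysohn:
  fixes K U :: "'a::t2_space set"
  assumes "compact (UNIV :: 'a set)" "closed K" "open U" "K \<subseteq> U"
  obtains v :: "'a \<Rightarrow> real" where "continuous_on UNIV v" "\<And>x. 0 \<le> v x" "\<And>x. v x \<le> 1"
    "\<And>x. x \<in> K \<Longrightarrow> v x = 1" "\<And>x. x \<notin> U \<Longrightarrow> v x = 0"
proof -
  have "Hausdorff_space (euclidean :: 'a topology)"
    unfolding Hausdorff_space_def by (auto simp: disjnt_def dest!: hausdorff)
  moreover have "compact_space (euclidean :: 'a topology)"
    using assms(1) by (simp add: compact_space_def)
  ultimately have "normal_space (euclidean :: 'a topology)"
    by (simp add: compact_Hausdorff_or_regular_imp_normal_space)
  moreover have "closedin euclidean (- U)" "closedin euclidean K" "disjnt (- U) K"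
    using assms by (auto simp: disjnt_def)
  ultimately obtain v where v: "continuous_map euclidean (top_of_set {0..1::real}) v" "v ` (- U) \<subseteq> {0}" "v ` K \<subseteq> {1}"
    using Urysohn_lemma[of euclidean "- U" K 0 1] by auto
  have "continuous_on UNIV v" "\<And>x. v x \<in> {0..1}"
    using v(1) by (auto simp: continuous_map_in_subtopology)
  moreover have "v x = 1" if "x \<in> K" for x using v(3) that by blast
  moreover have "v x = 0" if "x \<notin> U" for x using v(2) that by blast
  ultimately show ?thesis by (intro that[of v]) auto
qed

lemma translate_vimage: "(\<lambda>x. g + x) -` A = (\<lambda>x. - g + x) ` (A :: 'a::group_add set)"
proof (intro set_eqI iffI)
  fix x assume "x \<in> (\<lambda>x. g + x) -` A"
  then have "g + x \<in> A" by simp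
  then have "- g + (g + x) \<in> (\<lambda>x. - g + x) ` A" by (rule imageI)
  then show "x \<in> (\<lambda>x. - g + x) ` A" by (simp add: add.assoc[symmetric])
next
  fix x assume "x \<in> (\<lambda>x. - g + x) ` A"
  then obtain y where "x = - g + y" "y \<in> A" by blast
  then show "x \<in> (\<lambda>x. g + x) -` A" by (simp add: add.assoc[symmetric])
qed

locale haar_dirichlet =
  fixes \<beta> :: "real \<Rightarrow> 'g::{topological_ab_group_add,t2_space}" and m :: "'g measure"
  assumes dirichlet: "dirichlet_group \<beta>" and haar: "normalized_haar_measure m"
begin

section \<open>Compactness of the group and invariance of the measure\<close>

lemma compact_UNIV: "compact (UNIV :: 'g set)"
  and continuous_\<beta>: "continuous_on UNIV \<beta>"
  and \<beta>_add: "\<beta> (s + t) = \<beta> s + \<beta> t"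
  and dense: "closure (range \<beta>) = UNIV"
  using dirichlet by (auto simp: dirichlet_group_def)

lemma sets_m [measurable_cong, simp]: "sets m = sets borel"
  using haar by (simp add: normalized_haar_measure_def)

lemma space_m [simp]: "space m = UNIV"
  using sets_eq_imp_space_eq[OF sets_m] by simp

lemma haar_translate: "A \<in> sets borel \<Longrightarrow> emeasure m ((\<lambda>x. g + x) ` A) = emeasure m A"
  and haar_outer: "A \<in> sets borel \<Longrightarrow> emeasure m A = (INF U\<in>{U. A \<subseteq> U \<and> open U}. emeasure m U)"
  and haar_inner: "A \<in> sets borel \<Longrightarrow> emeasure m A = (SUP K\<in>{K. K \<subseteq> A \<and> compact K}. emeasure m K)"
  using haar unfolding normalized_haar_measure_def by blast+

sublocale prob_space m
  by standard (use haar in \<open>simp add: normalized_haar_measure_def\<close>)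

lemma \<beta>_0 [simp]: "\<beta> 0 = 0"
  using \<beta>_add[of 0 0] by simp

lemma \<beta>_minus: "\<beta> (- t) = - \<beta> t"
  using \<beta>_add[of "-t" t] by (simp add: eq_neg_iff_add_eq_0)

lemma continuous_measurable: "continuous_on UNIV v \<Longrightarrow> v \<in> borel_measurable m"
  by (simp add: borel_measurable_continuous_onI cong: measurable_cong_sets)

lemma continuous_bounded:
  fixes v :: "'g \<Rightarrow> complex"
  assumes "continuous_on UNIV v"
  obtains C where "C > 0" "\<And>x. norm (v x) \<le> C"
proof -
  have "bounded (v ` UNIV)"
    using compact_continuous_image[OF assms compact_UNIV] by (rule compact_imp_bounded)
  then show ?thesis using that by (auto simp: bounded_pos)
qed

lemma integrable_bounded:
  fixes f :: "'g \<Rightarrow> 'b::{banach,second_countable_topology}"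
  assumes "f \<in> borel_measurable m" "\<And>x. norm (f x) \<le> C"
  shows "integrable m f"
  using assms by (intro integrable_const_bound[where B=C]) auto

lemma integrable_continuous:
  fixes v :: "'g \<Rightarrow> complex"
  assumes "continuous_on UNIV v" shows "integrable m v"
proof -
  obtain C where "\<And>x. norm (v x) \<le> C" using continuous_bounded[OF assms] by blast
  then show ?thesis by (intro integrable_bounded[of _ C] continuous_measurable assms)
qed

lemma norm_integral_le:
  fixes f :: "'g \<Rightarrow> complex"
  assumes "f \<in> borel_measurable m" "\<And>x. norm (f x) \<le> C"
  shows "norm (\<integral>x. f x \<partial>m) \<le> C"
proof -
  have "norm (\<integral>x. f x \<partial>m) \<le> (\<integral>x. norm (f x) \<partial>m)" by (rule integral_norm_bound)
  also have "\<dots> \<le> (\<integral>x. C \<partial>m)"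
    using assms by (intro integral_mono integrable_norm integrable_bounded[of f C]) auto
  finally show ?thesis using prob_space by simp
qed

lemma measurable_translate [measurable]: "(\<lambda>x. g + x) \<in> measurable m m"
proof -
  have "(\<lambda>x. g + x) \<in> borel_measurable borel"
    by (intro borel_measurable_continuous_onI continuous_intros)
  then show ?thesis by (simp cong: measurable_cong_sets)
qed

lemma distr_translate: "distr m m (\<lambda>x. g + x) = m"
proof (rule measure_eqI)
  fix A assume "A \<in> sets (distr m m (\<lambda>x. g + x))"
  then have A: "A \<in> sets m" by simp
  have "(\<lambda>x. g + x) -` A \<inter> space m = (\<lambda>x. - g + x) ` A"
    by (simp add: translate_vimage)
  then have "emeasure (distr m m (\<lambda>x. g + x)) A = emeasure m ((\<lambda>x. - g + x) ` A)"
    using A by (simp add: emeasure_distr)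
  also have "\<dots> = emeasure m A"
    using A by (intro haar_translate) simp
  finally show "emeasure (distr m m (\<lambda>x. g + x)) A = emeasure m A" .
qed simp

lemma integral_translate:
  fixes f :: "'g \<Rightarrow> complex"
  assumes "f \<in> borel_measurable m"
  shows "(\<integral>x. f (g + x) \<partial>m) = (\<integral>x. f x \<partial>m)"
  using integral_distr[OF measurable_translate[of g] assms] by (simp add: distr_translate)

text \<open>By compactness finitely many translates of \<open>U\<close> cover the group, and all
  have the measure of \<open>U\<close>.\<close>

lemma open_prob_pos:
  assumes "open U" "U \<noteq> {}"
  shows "prob U > 0"
proof (rule ccontr)
  assume "\<not> prob U > 0"
  then have U0: "prob U = 0" using measure_nonneg[of m U] by linarith
  obtain x0 where x0: "x0 \<in> U" using assms by blast
  have op: "open ((\<lambda>x. g + x) ` U)" for g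
  proof -
    have "(\<lambda>x. g + x) ` U = (\<lambda>x. - g + x) -` U"
      using translate_vimage[of "- g" U] by (simp only: minus_minus)
    moreover have "open ((\<lambda>x. - g + x) -` U)"
      by (intro open_vimage assms continuous_intros)
    ultimately show ?thesis by simp
  qed
  have "UNIV \<subseteq> (\<Union>g\<in>UNIV. (\<lambda>x. g + x) ` U)"
  proof
    fix y
    have "y = (y - x0) + x0" by simp
    then show "y \<in> (\<Union>g\<in>UNIV. (\<lambda>x. g + x) ` U)" using x0 by blast
  qed
  then obtain D where D: "finite D" "UNIV \<subseteq> (\<Union>g\<in>D. (\<lambda>x. g + x) ` U)"
    by (rule compactE_image[OF compact_UNIV, rotated]) (use op in auto)
  have U: "U \<in> sets borel" using assms by simp
  have "prob UNIV \<le> prob (\<Union>g\<in>D. (\<lambda>x. g + x) ` U)"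
    using D op by (intro finite_measure_mono) auto
  also have "\<dots> \<le> (\<Sum>g\<in>D. prob ((\<lambda>x. g + x) ` U))"
    using D op by (intro finite_measure_subadditive_finite) auto
  also have "\<dots> = (\<Sum>g\<in>D. prob U)"
    using haar_translate[OF U] by (simp add: measure_def)
  finally show False using U0 prob_space by simp
qed

text \<open>Uniform continuity without a metric: compactness in the variable \<open>z\<close>
  provides one neighbourhood of \<open>y0\<close> that is good for all \<open>z\<close>.\<close>

lemma equicontinuous:
  fixes v :: "'g \<Rightarrow> complex"
  assumes "continuous_on UNIV v" "e > 0"
  obtains U where "open U" "y0 \<in> U" "\<And>y z. y \<in> U \<Longrightarrow> norm (v (y + z) - v (y0 + z)) \<le> e"
proof -
  have "continuous_on (UNIV \<times> UNIV) (\<lambda>(y, z). v (y + z))"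
    unfolding split_beta by (intro continuous_on_compose2[OF assms(1)] continuous_intros) auto
  from continuous_on_prod_compactE[OF this compact_UNIV UNIV_I \<open>e > 0\<close>, of y0]
  obtain X0 where "y0 \<in> X0" "open X0" "\<forall>x\<in>X0 \<inter> UNIV. \<forall>t\<in>UNIV. dist (v (x + t)) (v (y0 + t)) \<le> e"
    by auto
  then show ?thesis using that[of X0] by (auto simp: dist_norm)
qed

section \<open>The dense line and its orbits\<close>

lemma continuous_eqI:
  fixes f h :: "'g \<Rightarrow> complex"
  assumes "continuous_on UNIV f" "continuous_on UNIV h" "\<And>t. f (\<beta> t) = h (\<beta> t)"
  shows "f x = h x"
proof -
  have "closure (range \<beta>) \<subseteq> {x. f x = h x}"
    by (rule closure_minimal) (use assms in \<open>auto intro: closed_Collect_eq\<close>)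
  then show ?thesis by (auto simp: dense)
qed

lemma continuous_norm_leI:
  fixes f :: "'g \<Rightarrow> complex"
  assumes "continuous_on UNIV f" "\<And>t. norm (f (\<beta> t)) \<le> C"
  shows "norm (f x) \<le> C"
proof -
  have "closure (range \<beta>) \<subseteq> {x. norm (f x) \<le> C}"
    by (rule closure_minimal) (use assms in \<open>auto intro!: closed_Collect_le continuous_intros\<close>)
  then show ?thesis by (auto simp: dense)
qed

text \<open>Finitely many neighbourhoods of equicontinuity cover the group, and density of the line
  puts a point \<open>- \<beta> b\<close> into each. The net is uniform in \<open>x\<close>, so it
  serves single orbits and integrals over all orbits.\<close>

lemma orbit_net:
  fixes v :: "'g \<Rightarrow> complex"
  assumes v: "continuous_on UNIV v" and "e > 0"
  obtains B where "finite B" "\<And>t. \<exists>b\<in>B. \<forall>x. norm (v (x - \<beta> t) - v (x - \<beta> b)) \<le> e"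
proof -
  have e2: "e / 2 > 0" using \<open>e > 0\<close> by simp
  have "\<exists>U. open U \<and> y0 \<in> U \<and> (\<forall>y\<in>U. \<forall>z. norm (v (y + z) - v (y0 + z)) \<le> e / 2)" for y0
    using equicontinuous[OF v e2] by metis
  then obtain U where U: "\<And>y. open (U y)" "\<And>y. y \<in> U y"
    "\<And>y0 y z. y \<in> U y0 \<Longrightarrow> norm (v (y + z) - v (y0 + z)) \<le> e / 2" by metis
  obtain D where D: "finite D" "UNIV \<subseteq> (\<Union>y\<in>D. U y)"
    by (rule compactE_image[OF compact_UNIV, of UNIV U]) (use U in auto)
  have "\<exists>b. - \<beta> b \<in> U y" for y
  proof -
    have "open (uminus -` U y)" by (intro open_vimage U continuous_intros)
    moreover have "- y \<in> uminus -` U y" using U(2) by simp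
    ultimately have "uminus -` U y \<inter> range \<beta> \<noteq> {}"
      using dense open_Int_closure_eq_empty by blast
    then show ?thesis by auto
  qed
  then obtain b where b: "\<And>y. - \<beta> (b y) \<in> U y" by metis
  have "\<exists>c\<in>b ` D. \<forall>x. norm (v (x - \<beta> t) - v (x - \<beta> c)) \<le> e" for t
  proof -
    obtain y where y: "y \<in> D" "- \<beta> t \<in> U y" using D(2) by blast
    have "norm (v (x - \<beta> t) - v (x - \<beta> (b y))) \<le> e" for x
    proof -
      have "norm (v (- \<beta> t + x) - v (y + x)) \<le> e / 2" "norm (v (y + x) - v (- \<beta> (b y) + x)) \<le> e / 2"
        using U(3)[OF y(2), of x] U(3)[OF b, of y x] by (simp_all add: norm_minus_commute)
      from norm_triangle_mono[OF this] show ?thesis by simp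
    qed
    then show ?thesis using y(1) by blast
  qed
  then show ?thesis using D(1) that[of "b ` D"] by blast
qed

text \<open>All regularity comes from \<open>v\<close>; the function \<open>f\<close>, bounded and
  measurable only, multiplies the distances by at most its bound.\<close>

lemma bochner_ap_orbit_integral:
  fixes v :: "'g \<Rightarrow> complex"
  assumes v: "continuous_on UNIV v" and f: "f \<in> borel_measurable m" "\<And>x. norm (f x) \<le> C"
  shows "bochner_ap (\<lambda>t. \<integral>x. f x * v (x - \<beta> t) \<partial>m)"
proof -
  define D where "D = max C 1"
  have D: "D > 0" "\<And>x. norm (f x) \<le> D" using f(2) by (auto simp: D_def le_max_iff_disj)
  obtain E where E: "E > 0" "\<And>x. norm (v x) \<le> E" using continuous_bounded[OF v] by blast
  have vm[measurable]: "(\<lambda>x. v (x - y)) \<in> borel_measurable m" for y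
    by (intro continuous_measurable continuous_on_compose2[OF v] continuous_intros) auto
  have int: "integrable m (\<lambda>x. f x * v (x - y))" for y
    using f(1) D E by (intro integrable_bounded[of _ "D * E"]) (auto simp: norm_mult intro: mult_mono)
  have bnd: "norm ((\<integral>x. f x * v (x - y) \<partial>m) - (\<integral>x. f x * v (x - y') \<partial>m)) \<le> D * e"
    if "\<And>x. norm (v (x - y) - v (x - y')) \<le> e" for y y' e
  proof -
    have "(\<integral>x. f x * v (x - y) \<partial>m) - (\<integral>x. f x * v (x - y') \<partial>m) = (\<integral>x. f x * v (x - y) - f x * v (x - y') \<partial>m)"
      using int by simp
    also have "norm \<dots> \<le> D * e"
    proof (rule norm_integral_le)
      show "(\<lambda>x. f x * v (x - y) - f x * v (x - y')) \<in> borel_measurable m" using f(1) by measurable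
      show "norm (f x * v (x - y) - f x * v (x - y')) \<le> D * e" for x
        unfolding right_diff_distrib[symmetric] norm_mult using D that by (intro mult_mono) auto
    qed
    finally show ?thesis .
  qed
  show ?thesis unfolding bochner_ap_def
  proof (intro conjI allI impI)
    show "continuous_on UNIV (\<lambda>t. \<integral>x. f x * v (x - \<beta> t) \<partial>m)"
      unfolding continuous_on_iff dist_norm
    proof (intro ballI allI impI)
      fix t e :: real assume "e > 0"
      then have "e / (2 * D) > 0" using D by simp
      from equicontinuous[OF v this, of "- \<beta> t"] obtain U
        where U: "open U" "- \<beta> t \<in> U" "\<And>y z. y \<in> U \<Longrightarrow> norm (v (y + z) - v (- \<beta> t + z)) \<le> e / (2 * D)" by blast
      have "open ((\<lambda>t. - \<beta> t) -` U)" by (intro open_vimage U continuous_intros continuous_\<beta>)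
      then obtain d where d: "d > 0" "\<And>s. \<bar>s - t\<bar> < d \<Longrightarrow> - \<beta> s \<in> U"
        using U(2) unfolding open_dist dist_real_def by blast
      have "norm ((\<integral>x. f x * v (x - \<beta> s) \<partial>m) - (\<integral>x. f x * v (x - \<beta> t) \<partial>m)) < e" if "norm (s - t) < d" for s
      proof -
        have "norm ((\<integral>x. f x * v (x - \<beta> s) \<partial>m) - (\<integral>x. f x * v (x - \<beta> t) \<partial>m)) \<le> D * (e / (2 * D))"
          by (rule bnd) (use U(3)[OF d(2)[of s]] that in simp)
        also have "\<dots> < e" using D \<open>e > 0\<close> by simp
        finally show ?thesis .
      qed
      then show "\<exists>d>0. \<forall>s\<in>UNIV. norm (s - t) < d \<longrightarrow>
          norm ((\<integral>x. f x * v (x - \<beta> s) \<partial>m) - (\<integral>x. f x * v (x - \<beta> t) \<partial>m)) < e" using d(1) by blast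
    qed
    fix e :: real assume "e > 0"
    then have "e / D > 0" using D by simp
    from orbit_net[OF v this] obtain B where
      B: "finite B" "\<And>t. \<exists>b\<in>B. \<forall>x. norm (v (x - \<beta> t) - v (x - \<beta> b)) \<le> e / D" by blast
    show "\<exists>B. finite B \<and> (\<forall>t. \<exists>b\<in>B. \<forall>s. norm ((\<integral>x. f x * v (x - \<beta> (s + t)) \<partial>m) -
        (\<integral>x. f x * v (x - \<beta> (s + b)) \<partial>m)) \<le> e)"
    proof (intro exI[of _ B] conjI allI B(1))
      fix t
      obtain b where b: "b \<in> B" "\<And>x. norm (v (x - \<beta> t) - v (x - \<beta> b)) \<le> e / D" using B(2) by blast
      have "norm ((\<integral>x. f x * v (x - \<beta> (s + t)) \<partial>m) - (\<integral>x. f x * v (x - \<beta> (s + b)) \<partial>m)) \<le> D * (e / D)" for s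
        by (rule bnd) (use b(2)[of "_ - \<beta> s"] in \<open>simp add: \<beta>_add diff_diff_eq\<close>)
      then show "\<exists>b\<in>B. \<forall>s. norm ((\<integral>x. f x * v (x - \<beta> (s + t)) \<partial>m) -
        (\<integral>x. f x * v (x - \<beta> (s + b)) \<partial>m)) \<le> e" using D b(1) by auto
    qed
  qed
qed

lemma continuous_orbit:
  fixes v :: "'g \<Rightarrow> complex"
  assumes "continuous_on UNIV v" shows "continuous_on UNIV (\<lambda>t. v (x - \<beta> t))"
  by (intro continuous_on_compose2[OF assms] continuous_intros continuous_\<beta>) auto

lemma bochner_ap_orbit:
  fixes v :: "'g \<Rightarrow> complex"
  assumes v: "continuous_on UNIV v"
  shows "bochner_ap (\<lambda>t. v (x - \<beta> t))"
  unfolding bochner_ap_def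
proof (intro conjI allI impI continuous_orbit v)
  fix e :: real assume "e > 0"
  from orbit_net[OF v this] obtain B where
    B: "finite B" "\<And>t. \<exists>b\<in>B. \<forall>x. norm (v (x - \<beta> t) - v (x - \<beta> b)) \<le> e" by blast
  show "\<exists>B. finite B \<and> (\<forall>t. \<exists>b\<in>B. \<forall>s. norm (v (x - \<beta> (s + t)) - v (x - \<beta> (s + b))) \<le> e)"
  proof (intro exI[of _ B] conjI allI B(1))
    fix t
    obtain b where b: "b \<in> B" "\<And>x. norm (v (x - \<beta> t) - v (x - \<beta> b)) \<le> e" using B(2) by blast
    have "norm (v (x - \<beta> (s + t)) - v (x - \<beta> (s + b))) \<le> e" for s
      using b(2)[of "x - \<beta> s"] by (simp add: \<beta>_add diff_diff_eq)
    then show "\<exists>b\<in>B. \<forall>s. norm (v (x - \<beta> (s + t)) - v (x - \<beta> (s + b))) \<le> e" using b(1) by blast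
  qed
qed

text \<open>A Bohr coefficient of the orbit through \<open>x\<close>, run backwards as in the
  correlation of \<open>f\<close> with translates of \<open>v\<close>. As a function of
  \<open>x\<close> it varies like the conjugate of the character of frequency
  \<open>y\<close>.\<close>

definition orbit_coeff :: "('g \<Rightarrow> complex) \<Rightarrow> real \<Rightarrow> 'g \<Rightarrow> complex" where
  "orbit_coeff v y x = mean (\<lambda>t. v (x - \<beta> t) * cis (y * t))"

lemma bochner_ap_orbit_cis:
  fixes v :: "'g \<Rightarrow> complex"
  assumes "continuous_on UNIV v" shows "bochner_ap (\<lambda>t. v (x - \<beta> t) * cis (y * t))"
  by (intro bochner_ap_mult bochner_ap_cis bochner_ap_orbit assms)

lemma orbit_coeff_shift:
  assumes v: "continuous_on UNIV v"
  shows "orbit_coeff v y (x + \<beta> s) = cis (y * s) * orbit_coeff v y x"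
proof -
  have "orbit_coeff v y (x + \<beta> s) = mean (\<lambda>t. v (x + \<beta> s - \<beta> (t + s)) * cis (y * (t + s)))"
    unfolding orbit_coeff_def by (rule mean_shift[symmetric]) (rule bochner_ap_orbit_cis[OF v])
  also have "(\<lambda>t. v (x + \<beta> s - \<beta> (t + s)) * cis (y * (t + s))) = (\<lambda>t. cis (y * s) * (v (x - \<beta> t) * cis (y * t)))"
    by (simp add: fun_eq_iff \<beta>_add distrib_left mult.left_commute[of "cis _"] cis_mult add.commute[of "y * s"])
  also have "mean \<dots> = cis (y * s) * orbit_coeff v y x"
    unfolding orbit_coeff_def by (intro mean_cmult bochner_ap_orbit_cis v)
  finally show ?thesis .
qed

lemma continuous_orbit_coeff:
  assumes v: "continuous_on UNIV v"
  shows "continuous_on UNIV (orbit_coeff v y)"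
  unfolding continuous_on_topological
proof (intro ballI allI impI)
  fix x B assume B: "open B" "orbit_coeff v y x \<in> B"
  then obtain e where e: "e > 0" "ball (orbit_coeff v y x) e \<subseteq> B" by (auto simp: open_contains_ball)
  then have e2: "e / 2 > 0" by simp
  obtain U where U: "open U" "x \<in> U" "\<And>y z. y \<in> U \<Longrightarrow> norm (v (y + z) - v (x + z)) \<le> e / 2"
    using equicontinuous[OF v e2] by blast
  have "orbit_coeff v y x' \<in> B" if "x' \<in> U" for x'
  proof -
    have "norm (orbit_coeff v y x' - orbit_coeff v y x) \<le> e / 2"
      unfolding orbit_coeff_def
    proof (intro norm_mean_diff_le bochner_ap_orbit_cis v)
      fix t
      have "norm ((v (x' - \<beta> t) - v (x - \<beta> t)) * cis (y * t)) \<le> e / 2"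
        using U(3)[OF that, of "- \<beta> t"] by (simp add: norm_mult)
      then show "norm (v (x' - \<beta> t) * cis (y * t) - v (x - \<beta> t) * cis (y * t)) \<le> e / 2"
        by (simp only: left_diff_distrib)
    qed
    then have "orbit_coeff v y x' \<in> ball (orbit_coeff v y x) e"
      using e(1) by (simp add: dist_norm norm_minus_commute)
    then show ?thesis using e(2) by blast
  qed
  then show "\<exists>A. open A \<and> x \<in> A \<and> (\<forall>y'\<in>UNIV. y' \<in> A \<longrightarrow> orbit_coeff v y y' \<in> B)"
    using U by blast
qed

section \<open>Characters and the frequencies of orbits\<close>

lemma extends_frequency_iff:
  "extends_frequency \<beta> y \<gamma> \<longleftrightarrow> group_character \<gamma> \<and> (\<forall>t. \<gamma> (\<beta> t) = cis (- (y * t)))"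
  unfolding extends_frequency_def by (simp add: cis_conv_exp mult.assoc)

lemma group_character_cnj: "group_character \<gamma> \<Longrightarrow> group_character (\<lambda>x. cnj (\<gamma> x))"
  by (auto simp: group_character_def intro: continuous_on_cnj)

lemma group_character_mult: "group_character \<gamma> \<Longrightarrow> group_character \<eta> \<Longrightarrow> group_character (\<lambda>x. \<gamma> x * \<eta> x)"
  by (auto simp: group_character_def norm_mult intro!: continuous_intros)

lemma group_character_continuous: "group_character \<gamma> \<Longrightarrow> continuous_on UNIV \<gamma>"
  and group_character_norm: "group_character \<gamma> \<Longrightarrow> norm (\<gamma> x) = 1"
  and group_character_add: "group_character \<gamma> \<Longrightarrow> \<gamma> (x + y) = \<gamma> x * \<gamma> y"
  by (auto simp: group_character_def)

lemma group_character_mult_cnj: "group_character \<gamma> \<Longrightarrow> \<gamma> x * cnj (\<gamma> x) = 1"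
  using group_character_norm[of \<gamma> x] by (simp flip: complex_norm_square)

lemma group_character_0: assumes "group_character \<gamma>" shows "\<gamma> 0 = 1"
proof -
  have "\<gamma> 0 = \<gamma> 0 * \<gamma> 0" using group_character_add[OF assms, of 0 0] by simp
  moreover have "\<gamma> 0 \<noteq> 0" using group_character_norm[OF assms, of 0] by auto
  ultimately show ?thesis by simp
qed

text \<open>
  A frequency that occurs in an orbit of a continuous function belongs to a character of the group:
  the coefficient itself, as a function of the starting point, is a multiple of that character.
\<close>

lemma orbit_coeff_character:
  assumes v: "continuous_on UNIV v" and nz: "orbit_coeff v y x0 \<noteq> 0"
  obtains \<gamma> where "extends_frequency \<beta> y \<gamma>" "\<And>x. orbit_coeff v y x = orbit_coeff v y 0 * cnj (\<gamma> x)"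
proof -
  define \<eta> where "\<eta> x = orbit_coeff v y (x0 + x) / orbit_coeff v y x0" for x
  have cont: "continuous_on UNIV \<eta>" unfolding \<eta>_def
    by (intro continuous_intros continuous_on_compose2[OF continuous_orbit_coeff[OF v]]) (use nz in auto)
  have shift: "\<eta> (x + \<beta> s) = \<eta> x * cis (y * s)" for x s
    unfolding \<eta>_def using orbit_coeff_shift[OF v, of y "x0 + x" s] by (simp add: add.assoc mult.commute)
  have \<eta>0: "\<eta> 0 = 1" using nz by (simp add: \<eta>_def)
  have \<eta>\<beta>: "\<eta> (\<beta> s) = cis (y * s)" for s using shift[of 0 s] by (simp add: \<eta>0)
  \<comment> \<open>For fixed \<open>x\<close> this holds for all \<open>z\<close> on the line, by
    \<open>shift\<close>, and so everywhere by density.\<close>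
  have add: "\<eta> (x + z) = \<eta> x * \<eta> z" for x z
    by (rule continuous_eqI[of "\<lambda>z. \<eta> (x + z)" "\<lambda>z. \<eta> x * \<eta> z"])
      (auto intro!: continuous_intros continuous_on_compose2[OF cont] cont simp: shift \<eta>\<beta>)
  have "complex_of_real (norm (\<eta> x)) = 1" for x
    by (rule continuous_eqI[of "\<lambda>x. complex_of_real (norm (\<eta> x))" "\<lambda>_. 1"])
      (auto intro!: continuous_intros cont simp: \<eta>\<beta>)
  then have norm: "norm (\<eta> x) = 1" for x by (metis of_real_eq_1_iff)
  have \<eta>: "group_character \<eta>" unfolding group_character_def using cont add norm by blast
  show ?thesis
  proof (rule that)
    \<comment> \<open>The quotient \<open>\<eta>\<close> moves with \<open>cis (y * s)\<close> along
      the line, whereas the character of frequency \<open>y\<close> moves with the inverse; hence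
      the conjugate.\<close>
    show "extends_frequency \<beta> y (\<lambda>x. cnj (\<eta> x))"
      unfolding extends_frequency_iff using group_character_cnj[OF \<eta>] by (simp add: \<eta>\<beta> cis_cnj)
    fix x
    have eq: "orbit_coeff v y z = orbit_coeff v y x0 * (\<eta> (- x0) * \<eta> z)" for z
    proof -
      have "orbit_coeff v y z = orbit_coeff v y x0 * \<eta> (- x0 + z)"
        using nz by (simp add: \<eta>_def)
      then show ?thesis by (simp only: add)
    qed
    show "orbit_coeff v y x = orbit_coeff v y 0 * cnj (cnj (\<eta> x))"
      using eq[of x] eq[of 0] by (simp add: \<eta>0 mult_ac)
  qed
qed

lemma mean_orbit_integral:
  assumes v: "continuous_on UNIV v" and f: "f \<in> borel_measurable m" "\<And>x. norm (f x) \<le> C"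
  shows "mean (\<lambda>t. (\<integral>x. f x * v (x - \<beta> t) \<partial>m) * cis (y * t)) = (\<integral>x. f x * orbit_coeff v y x \<partial>m)"
proof -
  obtain E where E: "E > 0" "\<And>x. norm (v x) \<le> E" using continuous_bounded[OF v] by blast
  have C0: "C \<ge> 0" using f(2)[of 0] norm_ge_zero order_trans by blast
  have vm[measurable]: "(\<lambda>x. v (x - y)) \<in> borel_measurable m" for y
    by (intro continuous_measurable continuous_on_compose2[OF v] continuous_intros) auto
  have eq: "(\<lambda>t. (\<integral>x. f x * v (x - \<beta> t) \<partial>m) * cis (y * t)) = (\<lambda>t. \<integral>x. f x * (v (x - \<beta> t) * cis (y * t)) \<partial>m)"
    by (simp flip: mult.assoc)
  have "mean (\<lambda>t. \<integral>x. f x * (v (x - \<beta> t) * cis (y * t)) \<partial>m) = (\<integral>x. mean (\<lambda>t. f x * (v (x - \<beta> t) * cis (y * t))) \<partial>m)"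
  proof (rule mean_integral_prob_space[OF prob_space_axioms, where C="C * E"])
    show "(\<lambda>(x, t). f x * (v (x - \<beta> t) * cis (y * t))) \<in> borel_measurable (m \<Otimes>\<^sub>M borel)"
    proof (rule measurable_caratheodory)
      show "(\<lambda>x. f x * (v (x - \<beta> t) * cis (y * t))) \<in> borel_measurable m" for t using f(1) by measurable
      show "continuous_on UNIV (\<lambda>t. f x * (v (x - \<beta> t) * cis (y * t)))" for x
        by (intro continuous_intros continuous_orbit v)
    qed
    show "norm (f x * (v (x - \<beta> t) * cis (y * t))) \<le> C * E" for x t
      using f(2) E C0 by (simp add: norm_mult mult_mono)
    show "bochner_ap (\<lambda>t. f x * (v (x - \<beta> t) * cis (y * t)))" for x by (intro bochner_ap_cmult bochner_ap_orbit_cis v)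
    show "bochner_ap (\<lambda>t. \<integral>x. f x * (v (x - \<beta> t) * cis (y * t)) \<partial>m)"
      unfolding eq[symmetric] by (intro bochner_ap_mult bochner_ap_cis bochner_ap_orbit_integral[OF v f])
  qed
  also have "\<dots> = (\<integral>x. f x * orbit_coeff v y x \<partial>m)"
    unfolding orbit_coeff_def by (subst mean_cmult[OF bochner_ap_orbit_cis[OF v]]) (rule refl)
  finally show ?thesis unfolding eq .
qed

text \<open>Every orbit is equidistributed: the time mean is continuous in \<open>x\<close> and
  invariant along the dense line, hence constant, and integrating it over \<open>x\<close>
  identifies the constant as the Haar integral.\<close>

lemma mean_orbit:
  assumes v: "continuous_on UNIV v"
  shows "mean (\<lambda>t. v (x - \<beta> t)) = (\<integral>x. v x \<partial>m)"
proof -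
  have const: "orbit_coeff v 0 x = orbit_coeff v 0 0" for x
    by (rule continuous_eqI[of "orbit_coeff v 0" "\<lambda>_. orbit_coeff v 0 0"])
      (use orbit_coeff_shift[OF v, of 0 0] in \<open>auto intro: continuous_orbit_coeff v\<close>)
  have "(\<integral>x. v (x - \<beta> t) \<partial>m) = (\<integral>x. v x \<partial>m)" for t
    using integral_translate[OF continuous_measurable[OF v], of "- \<beta> t"] by simp
  then have "(\<integral>x. v x \<partial>m) = mean (\<lambda>t. (\<integral>x. 1 * v (x - \<beta> t) \<partial>m) * cis (0 * t))"
    by (simp add: mean_const)
  also have "\<dots> = (\<integral>x. 1 * orbit_coeff v 0 x \<partial>m)"
    by (rule mean_orbit_integral[OF v, where C=1]) auto
  also have "\<dots> = orbit_coeff v 0 x"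
    by (subst (1 2) const) (use prob_space in simp)
  finally show ?thesis by (simp add: orbit_coeff_def)
qed

text \<open>Along the orbit \<open>h\<close> supplies the oscillating factor, so the coefficient is
  the time mean of \<open>v * h\<close>, to which \<open>mean_orbit\<close> applies.\<close>

lemma orbit_coeff_extends:
  assumes v: "continuous_on UNIV v" and h: "extends_frequency \<beta> y h"
  shows "orbit_coeff v y x = (\<integral>z. v z * h z \<partial>m) * cnj (h x)"
proof -
  have hc: "group_character h" and h\<beta>: "h (\<beta> t) = cis (- (y * t))" for t
    using h by (auto simp: extends_frequency_iff)
  have cont: "continuous_on UNIV (\<lambda>z. v z * h z)"
    by (intro continuous_intros v group_character_continuous[OF hc])
  have "v (x - \<beta> t) * cis (y * t) = cnj (h x) * (v (x - \<beta> t) * h (x - \<beta> t))" for t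
  proof -
    have "h (x - \<beta> t) = h x * cis (y * t)"
      using group_character_add[OF hc, of x "\<beta> (- t)"] h\<beta>[of "- t"] by (simp add: \<beta>_minus)
    then have "cnj (h x) * (v (x - \<beta> t) * h (x - \<beta> t)) = (h x * cnj (h x)) * (v (x - \<beta> t) * cis (y * t))"
      by (simp add: mult_ac)
    then show ?thesis by (simp only: group_character_mult_cnj[OF hc] mult_1_left)
  qed
  then have "orbit_coeff v y x = cnj (h x) * mean (\<lambda>t. v (x - \<beta> t) * h (x - \<beta> t))"
    unfolding orbit_coeff_def using mean_cmult[OF bochner_ap_orbit[OF cont]] by (simp only:)
  then show ?thesis using mean_orbit[OF cont] by simp
qed

lemma frequency_unique:
  assumes "extends_frequency \<beta> x h" "extends_frequency \<beta> y h"
  shows "x = y"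
proof -
  have "cis (- (x * t)) = cis (- (y * t))" for t using assms by (metis extends_frequency_iff)
  then have "cis ((y - x) * t) = 1" for t
    using cis_mult[of "y * t" "- (x * t)"] cis_mult[of "y * t" "- (y * t)"] by (simp add: left_diff_distrib)
  then have "mean (\<lambda>t. cis ((y - x) * t)) = 1" by (simp add: mean_const)
  then show ?thesis by (auto simp: mean_cis split: if_splits)
qed

text \<open>
  Correlating \<open>f\<close> with a continuous test function gives an almost periodic function along \<open>\<beta>\<close> without
  Bohr coefficients, which therefore vanishes; regularity of \<open>m\<close> then supplies enough test functions.
\<close>

lemma AE_eq_0_if_coefficients_0:
  assumes f: "f \<in> borel_measurable m" "\<And>x. norm (f x) \<le> C"
    and zero: "\<And>\<gamma>. group_character \<gamma> \<Longrightarrow> (\<integral>x. f x * cnj (\<gamma> x) \<partial>m) = 0"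
  shows "AE x in m. f x = 0"
proof -
  note [measurable] = f(1)
  have C0: "C \<ge> 0" using f(2)[of 0] norm_ge_zero order_trans by blast
  \<comment> \<open>The integral sought is the value at t = 0 of an almost periodic function. Each
    of its Bohr coefficients is either 0 or a multiple of a Fourier coefficient of
    \<open>f\<close>.\<close>
  have test: "(\<integral>x. f x * v x \<partial>m) = 0" if v: "continuous_on UNIV v" for v
  proof -
    have "(\<integral>x. f x * v (x - \<beta> 0) \<partial>m) = 0"
    proof (rule bochner_ap_uniqueness)
      show "bochner_ap (\<lambda>t. \<integral>x. f x * v (x - \<beta> t) \<partial>m)" by (rule bochner_ap_orbit_integral[OF v f])
      fix y
      have "(\<integral>x. f x * orbit_coeff v y x \<partial>m) = 0"
      proof (cases "\<exists>x0. orbit_coeff v y x0 \<noteq> 0")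
        case True
        then obtain \<gamma> where \<gamma>: "extends_frequency \<beta> y \<gamma>" "\<And>x. orbit_coeff v y x = orbit_coeff v y 0 * cnj (\<gamma> x)"
          using orbit_coeff_character[OF v] by metis
        have "(\<integral>x. f x * orbit_coeff v y x \<partial>m) = (\<integral>x. orbit_coeff v y 0 * (f x * cnj (\<gamma> x)) \<partial>m)"
          by (subst \<gamma>(2)) (simp add: mult_ac)
        also have "\<dots> = 0" using zero[of \<gamma>] \<gamma>(1) by (simp add: extends_frequency_iff)
        finally show ?thesis .
      qed simp
      then show "mean (\<lambda>t. (\<integral>x. f x * v (x - \<beta> t) \<partial>m) * cis (y * t)) = 0"
        by (simp add: mean_orbit_integral[OF v f])
    qed
    then show ?thesis by simp
  qed
  \<comment> \<open>Regularity encloses \<open>A\<close> between a compact \<open>K\<close> and an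
    open \<open>U\<close> with little measure in between; a Urysohn function for this pair differs
    from the indicator of \<open>A\<close> only on \<open>U - K\<close>.\<close>
  have set: "(\<integral>x. indicator A x *\<^sub>R f x \<partial>m) = 0" if A[measurable]: "A \<in> sets borel" for A
  proof -
    have "norm (\<integral>x. indicator A x *\<^sub>R f x \<partial>m) \<le> C * (2 * e)" if e: "e > 0" for e
    proof -
      have "emeasure m A < emeasure m A + ennreal e"
        using e by (simp add: emeasure_eq_measure ennreal_less_iff flip: ennreal_plus)
      then have "(INF U\<in>{U. A \<subseteq> U \<and> open U}. emeasure m U) < emeasure m A + ennreal e"
        by (simp only: haar_outer[OF A, symmetric])
      then obtain U where U: "A \<subseteq> U" "open U" "emeasure m U < emeasure m A + ennreal e"
        unfolding INF_less_iff by blast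
      have "\<exists>K. K \<subseteq> A \<and> compact K \<and> prob A - e < prob K"
      proof (rule ccontr)
        assume *: "\<not> ?thesis"
        have "emeasure m K \<le> ennreal (max 0 (prob A - e))" if "K \<subseteq> A" "compact K" for K
          using * that by (auto simp: emeasure_eq_measure not_less intro!: ennreal_leI)
        then have "(SUP K\<in>{K. K \<subseteq> A \<and> compact K}. emeasure m K) \<le> ennreal (max 0 (prob A - e))"
          by (intro SUP_least) auto
        then have "emeasure m A \<le> ennreal (max 0 (prob A - e))"
          by (simp only: haar_inner[OF A, symmetric])
        then have "prob A \<le> max 0 (prob A - e)"
          by (simp only: emeasure_eq_measure ennreal_le_iff[OF max.cobounded1])
        then have "prob A = 0" using e measure_nonneg[of m A] by linarith
        \<comment> \<open>If \<open>A\<close> is a null set, then the empty set already is such a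
          \<open>K\<close>.\<close>
        with * e show False by (auto dest!: spec[of _ "{}"])
      qed
      then obtain K where K: "K \<subseteq> A" "compact K" "prob A - e < prob K" by blast
      have clK: "closed K" using K(2) by (rule compact_imp_closed)
      have [measurable]: "U \<in> sets borel" "K \<in> sets borel" using U clK by auto
      have "prob U < prob A + e"
        using U(3) e by (simp add: emeasure_eq_measure ennreal_less_iff flip: ennreal_plus)
      then have UK: "prob (U - K) \<le> 2 * e"
        using K U(1) by (subst finite_measure_Diff) auto
      obtain v where v: "continuous_on UNIV v" "\<And>x. 0 \<le> v x" "\<And>x. v x \<le> (1::real)"
          "\<And>x. x \<in> K \<Longrightarrow> v x = 1" "\<And>x. x \<notin> U \<Longrightarrow> v x = 0"
        using compact_Urysohn[OF compact_UNIV clK U(2)] K U by blast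
      have cv: "continuous_on UNIV (\<lambda>x. complex_of_real (v x))" by (intro continuous_intros v)
      have [measurable]: "(\<lambda>x. complex_of_real (v x)) \<in> borel_measurable m" by (rule continuous_measurable[OF cv])
      have i1: "integrable m (\<lambda>x. indicator A x *\<^sub>R f x)"
        by (rule integrable_bounded[of _ C]) (use f C0 in \<open>auto split: split_indicator\<close>)
      have i2: "integrable m (\<lambda>x. f x * of_real (v x))"
        by (rule integrable_bounded[of _ C]) (use f C0 v in \<open>auto simp: norm_mult intro!: mult_left_le mult_mono order_trans[OF mult_mono[of "norm _" C "v _" 1]]\<close>)
      have "(\<integral>x. indicator A x *\<^sub>R f x \<partial>m) = (\<integral>x. indicator A x *\<^sub>R f x - f x * of_real (v x) \<partial>m)"
        using i1 i2 test[OF cv] by simp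
      also have "norm \<dots> \<le> (\<integral>x. C * indicator (U - K) x \<partial>m)"
      proof (rule order_trans[OF integral_norm_bound integral_mono])
        show "integrable m (\<lambda>x. norm (indicator A x *\<^sub>R f x - f x * of_real (v x)))" using i1 i2 by simp
        show "integrable m (\<lambda>x. C * indicator (U - K) x)"
          by (intro integrable_mult_right) (simp add: emeasure_eq_measure)
        fix x
        have "\<bar>indicator A x - v x\<bar> \<le> indicator (U - K) x"
          using v(2)[of x] v(3)[of x] v(4)[of x] v(5)[of x] K(1) U(1) by (auto split: split_indicator)
        then have "norm (complex_of_real (indicator A x - v x) * f x) \<le> indicator (U - K) x * C"
          unfolding norm_mult norm_of_real using f(2) by (intro mult_mono) auto
        then show "norm (indicator A x *\<^sub>R f x - f x * of_real (v x)) \<le> C * indicator (U - K) x"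
          by (simp add: scaleR_conv_of_real right_diff_distrib mult.commute)
      qed
      also have "\<dots> = C * prob (U - K)" by simp
      also have "\<dots> \<le> C * (2 * e)" using UK C0 by (rule mult_left_mono)
      finally show ?thesis .
    qed
    note small = this
    have "norm (\<integral>x. indicator A x *\<^sub>R f x \<partial>m) \<le> e" if "e > 0" for e
    proof -
      have "e / (2 * (C + 1)) > 0" using that C0 by simp
      from small[OF this] have "norm (\<integral>x. indicator A x *\<^sub>R f x \<partial>m) \<le> C * (2 * (e / (2 * (C + 1))))" .
      also have "\<dots> = C / (C + 1) * e" using C0 by (simp add: field_simps)
      also have "\<dots> \<le> 1 * e" using C0 that by (intro mult_right_mono) auto
      finally show ?thesis by simp
    qed
    then have "norm (\<integral>x. indicator A x *\<^sub>R f x \<partial>m) \<le> 0" by (rule field_le_epsilon[where y=0, simplified])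
    then show ?thesis by simp
  qed
  \<comment> \<open>Integrating over the set where \<open>L (f x)\<close> is positive shows that
    this set is null. The choices Re, Im and their negatives then force \<open>f\<close> to be
    0.\<close>
  have half: "AE x in m. L (f x) \<le> 0" if L: "bounded_linear L" for L :: "complex \<Rightarrow> real"
  proof -
    have [measurable]: "L \<in> borel_measurable borel"
      by (intro borel_measurable_continuous_onI linear_continuous_on L)
    define A where "A = {x. L (f x) > 0}"
    have A[measurable]: "A \<in> sets borel"
    proof -
      have "{x \<in> space m. L (f x) > 0} \<in> sets m" by measurable
      then show ?thesis by (simp add: A_def)
    qed
    have i1: "integrable m (\<lambda>x. indicator A x *\<^sub>R f x)"
      by (rule integrable_bounded[of _ C]) (use f C0 in \<open>auto split: split_indicator\<close>)
    have i: "integrable m (\<lambda>x. L (indicator A x *\<^sub>R f x))" by (rule integrable_bounded_linear[OF L i1])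
    have "(\<integral>x. L (indicator A x *\<^sub>R f x) \<partial>m) = 0"
      using integral_bounded_linear[OF L i1] set[OF A] linear_simps(3)[OF L] by simp
    moreover have nn: "0 \<le> L (indicator A x *\<^sub>R f x)" for x
      using linear_simps(3)[OF L] by (auto simp: A_def less_imp_le split: split_indicator)
    ultimately have "AE x in m. L (indicator A x *\<^sub>R f x) = 0"
      using integral_nonneg_eq_0_iff_AE[OF i] by simp
    then show ?thesis by eventually_elim (auto simp: A_def not_less split: split_indicator_asm)
  qed
  show ?thesis
    using half[OF bounded_linear_Re] half[OF bounded_linear_minus[OF bounded_linear_Re]]
      half[OF bounded_linear_Im] half[OF bounded_linear_minus[OF bounded_linear_Im]]
    by eventually_elim (simp add: complex_eq_iff)
qed

text \<open>Only finitely many characters matter, so they are jointly close to 1 on a neighbourhood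
  of 0; a normalized bump there is a single function in place of a net of approximate units.\<close>

lemma approximate_unit:
  assumes "finite I" "\<And>n. n \<in> I \<Longrightarrow> group_character (h n)" "e > 0"
  obtains v :: "'g \<Rightarrow> real" where "continuous_on UNIV v" "\<And>x. 0 \<le> v x" "(\<integral>x. v x \<partial>m) = 1"
    "\<And>n. n \<in> I \<Longrightarrow> norm ((\<integral>x. of_real (v x) * h n x \<partial>m) - 1) \<le> e"
proof -
  define U where "U = (\<Inter>n\<in>I. {x. norm (h n x - 1) < e})"
  have "open U" unfolding U_def
  proof (intro open_INT ballI assms(1))
    fix n assume "n \<in> I"
    then have "continuous_on UNIV (h n)" using assms(2) group_character_continuous by blast
    then show "open {x. norm (h n x - 1) < e}" by (intro open_Collect_less continuous_intros)
  qed
  moreover have "0 \<in> U" unfolding U_def using assms by (simp add: group_character_0)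
  ultimately obtain w where w: "continuous_on UNIV w" "\<And>x. 0 \<le> w x" "\<And>x. w x \<le> (1::real)"
      "w 0 = 1" "\<And>x. x \<notin> U \<Longrightarrow> w x = 0"
    using compact_Urysohn[OF compact_UNIV, of "{0}" U] by auto
  have [measurable]: "w \<in> borel_measurable m"
    using borel_measurable_continuous_onI[OF w(1)] by (simp cong: measurable_cong_sets)
  have iw: "integrable m w" by (rule integrable_bounded[of _ 1]) (use w in auto)
  \<comment> \<open>A nonempty open set on which \<open>w\<close> exceeds 1/2; its positive measure
    allows division by the integral of \<open>w\<close>.\<close>
  define V where "V = {x. w x > 1/2}"
  have V: "open V" unfolding V_def by (intro open_Collect_less continuous_intros w)
  have "0 \<in> V" using w by (simp add: V_def)
  then have "prob V > 0" using open_prob_pos[OF V] by blast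
  have "(\<integral>x. 1/2 * indicator V x \<partial>m) \<le> (\<integral>x. w x \<partial>m)"
  proof (rule integral_mono[OF _ iw])
    show "integrable m (\<lambda>x. 1/2 * indicator V x :: real)"
      using V by (intro integrable_mult_right) (simp add: emeasure_eq_measure)
    show "1/2 * indicator V x \<le> w x" for x using w by (auto simp: V_def split: split_indicator)
  qed
  then have c: "(\<integral>x. w x \<partial>m) > 0" using \<open>prob V > 0\<close> by simp
  define v where "v x = w x / (\<integral>x. w x \<partial>m)" for x
  have v: "continuous_on UNIV v" "\<And>x. 0 \<le> v x" "(\<integral>x. v x \<partial>m) = 1" "integrable m v"
    unfolding v_def using w c iw by (auto intro!: continuous_intros)
  have [measurable]: "v \<in> borel_measurable m" using v(4) by simp
  have "norm ((\<integral>x. of_real (v x) * h n x \<partial>m) - 1) \<le> e" if n: "n \<in> I" for n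
  proof -
    have hc: "group_character (h n)" using assms n by blast
    have ih: "integrable m (\<lambda>x. of_real (v x) * h n x)"
      by (intro integrable_continuous continuous_intros v group_character_continuous hc)
    have iv: "integrable m (\<lambda>x. complex_of_real (v x))" using v(4) by simp
    have "(\<integral>x. of_real (v x) * h n x \<partial>m) - 1 = (\<integral>x. of_real (v x) * h n x \<partial>m) - (\<integral>x. of_real (v x) \<partial>m)"
      using v(3) by simp
    also have "\<dots> = (\<integral>x. of_real (v x) * h n x - of_real (v x) \<partial>m)" using ih iv by simp
    also have "norm \<dots> \<le> (\<integral>x. norm (of_real (v x) * h n x - of_real (v x)) \<partial>m)" by (rule integral_norm_bound)
    also have "\<dots> \<le> (\<integral>x. v x * e \<partial>m)"
    proof (rule integral_mono)
      show "integrable m (\<lambda>x. norm (of_real (v x) * h n x - of_real (v x)))" using ih iv by simp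
      show "integrable m (\<lambda>x. v x * e)" using v(4) by simp
      fix x
      have "v x * norm (h n x - 1) \<le> v x * e"
      proof (cases "x \<in> U")
        case True
        then have "norm (h n x - 1) \<le> e" using n by (auto simp: U_def less_imp_le)
        then show ?thesis using v(2) by (rule mult_left_mono)
      qed (simp add: v_def w)
      moreover have "norm (complex_of_real (v x) * (h n x - 1)) = v x * norm (h n x - 1)"
        using v(2)[of x] by (simp add: norm_mult)
      ultimately show "norm (of_real (v x) * h n x - of_real (v x)) \<le> v x * e"
        by (simp add: right_diff_distrib)
    qed
    also have "\<dots> = e" using v(3) by simp
    finally show ?thesis .
  qed
  then show ?thesis using that v by blast
qed

text \<open>
  Averaging \<open>f\<close> over translates with an approximate unit yields an almost periodic function along the
  orbit \<open>\<beta>\<close>, whose Fejer means are the Riesz sums of \<open>f\<close> up to a small perturbation of the coefficients.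
\<close>

theorem norm_riesz_le_group:
  assumes freq: "frequency freq" and h: "\<And>n. extends_frequency \<beta> (freq n) (h n)"
    and f: "f \<in> borel_measurable m" "\<And>x. norm (f x) \<le> C"
    and spec: "\<And>\<gamma>. group_character \<gamma> \<Longrightarrow> (\<integral>x. f x * cnj (\<gamma> x) \<partial>m) \<noteq> 0 \<Longrightarrow> \<exists>n. \<gamma> = h n"
    and "N > 0"
  shows "norm (riesz freq (\<lambda>n. \<integral>x. f x * cnj (h n x) \<partial>m) N (Complex 0 t)) \<le> C"
proof (rule field_le_epsilon)
  fix e :: real assume "e > 0"
  have C0: "C \<ge> 0" using f(2)[of 0] norm_ge_zero order_trans by blast
  have hc: "group_character (h n)" for n using h by (simp add: extends_frequency_iff)
  define a where "a n = (\<integral>x. f x * cnj (h n x) \<partial>m)" for n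
  define I where "I = {n. freq n < N}"
  have I: "finite I" unfolding I_def by (rule frequency_finite[OF freq])
  \<comment> \<open>The coefficients entering the Riesz sum have total size less than
    \<open>A\<close>, so errors of \<open>e / A\<close> in their factors add up to at most
    \<open>e\<close>; the summand 1 keeps \<open>A\<close> positive.\<close>
  define A where "A = 1 + (\<Sum>n\<in>I. norm (a n))"
  have A: "A > 0" unfolding A_def by (simp add: add_pos_nonneg sum_nonneg)
  have "e / A > 0" using \<open>e > 0\<close> A by simp
  obtain v where v: "continuous_on UNIV v" "\<And>x. 0 \<le> v x" "(\<integral>x. v x \<partial>m) = 1"
    "\<And>n. n \<in> I \<Longrightarrow> norm ((\<integral>x. of_real (v x) * h n x \<partial>m) - 1) \<le> e / A"
    by (rule approximate_unit[where h=h, OF I hc \<open>e / A > 0\<close>]) (rule that)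
  define V where "V x = complex_of_real (v x)" for x
  have V: "continuous_on UNIV V" unfolding V_def by (intro continuous_intros v)
  define u where "u t = (\<integral>x. f x * V (x - \<beta> t) \<partial>m)" for t
  have u: "bochner_ap u" unfolding u_def by (rule bochner_ap_orbit_integral[OF V f])
  have u_bnd: "norm (u t) \<le> C" for t
  proof -
    have vt: "continuous_on UNIV (\<lambda>x. V (x - \<beta> t))"
      by (intro continuous_on_compose2[OF V] continuous_intros) auto
    have [measurable]: "(\<lambda>x. V (x - \<beta> t)) \<in> borel_measurable m" by (rule continuous_measurable[OF vt])
    have iV: "integrable m (\<lambda>x. V (x - \<beta> t))" by (rule integrable_continuous[OF vt])
    obtain E where E: "E > 0" "\<And>x. norm (V x) \<le> E" using continuous_bounded[OF V] by blast
    have int_eq: "(\<integral>x. V (x - \<beta> t) \<partial>m) = 1"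
      using integral_translate[OF continuous_measurable[OF V], of "- \<beta> t"] v(3) by (simp add: V_def)
    have Vnorm: "norm (V x) = Re (V x)" for x using v(2)[of x] by (simp add: V_def)
    have "norm (u t) \<le> (\<integral>x. norm (f x * V (x - \<beta> t)) \<partial>m)" unfolding u_def by (rule integral_norm_bound)
    also have "\<dots> \<le> (\<integral>x. C * Re (V (x - \<beta> t)) \<partial>m)"
    proof (rule integral_mono)
      show "integrable m (\<lambda>x. norm (f x * V (x - \<beta> t)))"
      proof (intro integrable_norm integrable_bounded[of _ "C * E"])
        show "(\<lambda>x. f x * V (x - \<beta> t)) \<in> borel_measurable m" using f(1) by measurable
        show "norm (f x * V (x - \<beta> t)) \<le> C * E" for x
          unfolding norm_mult using f(2) E C0 by (intro mult_mono) auto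
      qed
      show "integrable m (\<lambda>x. C * Re (V (x - \<beta> t)))" using iV by (intro integrable_mult_right integrable_Re)
      show "norm (f x * V (x - \<beta> t)) \<le> C * Re (V (x - \<beta> t))" for x
        unfolding norm_mult Vnorm[symmetric] by (intro mult_right_mono f) simp
    qed
    also have "\<dots> = C" using int_eq integral_Re[OF iV] by simp
    finally show ?thesis .
  qed
  \<comment> \<open>Averaging with \<open>V\<close> multiplies the coefficient \<open>a n\<close> by
    the integral of \<open>V * h n\<close>, which is close to 1 for \<open>n\<close> in
    \<open>I\<close>.\<close>
  define b where "b n = (\<integral>x. V x * h n x \<partial>m) * a n" for n
  have mean_u: "mean (\<lambda>t. u t * cis (y * t)) = (\<integral>x. f x * orbit_coeff V y x \<partial>m)" for y
    unfolding u_def by (rule mean_orbit_integral[OF V f])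
  have mean_b: "mean (\<lambda>t. u t * cis (freq n * t)) = b n" for n
  proof -
    have "mean (\<lambda>t. u t * cis (freq n * t)) = (\<integral>x. (\<integral>x. V x * h n x \<partial>m) * (f x * cnj (h n x)) \<partial>m)"
      unfolding mean_u orbit_coeff_extends[OF V h] by (simp add: mult_ac)
    then show ?thesis by (simp add: b_def a_def)
  qed
  \<comment> \<open>A frequency outside the given ones may still occur along orbits of
    \<open>V\<close>. It then belongs to a character, at which \<open>spec\<close> makes the Fourier
    coefficient of \<open>f\<close> vanish.\<close>
  have mean_0: "mean (\<lambda>t. u t * cis (y * t)) = 0" if y: "y \<notin> range freq" for y
  proof (cases "\<exists>x0. orbit_coeff V y x0 \<noteq> 0")
    case True
    then obtain \<gamma> where \<gamma>: "extends_frequency \<beta> y \<gamma>" "\<And>x. orbit_coeff V y x = orbit_coeff V y 0 * cnj (\<gamma> x)"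
      using orbit_coeff_character[OF V] by metis
    have "(\<integral>x. f x * orbit_coeff V y x \<partial>m) = (\<integral>x. orbit_coeff V y 0 * (f x * cnj (\<gamma> x)) \<partial>m)"
      by (subst \<gamma>(2)) (simp add: mult_ac)
    also have "\<dots> = 0"
    proof -
      have "(\<integral>x. f x * cnj (\<gamma> x) \<partial>m) = 0"
      proof (rule ccontr)
        assume nz: "(\<integral>x. f x * cnj (\<gamma> x) \<partial>m) \<noteq> 0"
        have "group_character \<gamma>" using \<gamma>(1) by (simp add: extends_frequency_iff)
        from spec[OF this nz] obtain n where "\<gamma> = h n" by blast
        then have "y = freq n" using frequency_unique[OF \<gamma>(1)] h by blast
        then show False using y by simp
      qed
      then show ?thesis by simp
    qed
    finally show ?thesis by (simp add: mean_u)
  qed (simp add: mean_u)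
  have "(\<integral>s. u (t + s / N) \<partial>fejer) = riesz freq b N (Complex 0 t)"
    by (rule bochner_ap_fejer_riesz[OF freq u \<open>N > 0\<close> mean_0]) (simp_all add: mean_b)
  moreover have [measurable]: "u \<in> borel_measurable borel" by (rule bochner_ap_measurable[OF u])
  have "norm (\<integral>s. u (t + s / N) \<partial>fejer) \<le> C" by (rule fejer.norm_integral_le) (use u_bnd in auto)
  ultimately have rb: "norm (riesz freq b N (Complex 0 t)) \<le> C" by simp
  have "norm (riesz freq a N (Complex 0 t) - riesz freq b N (Complex 0 t)) \<le> (\<Sum>n\<in>I. norm (a n) * (e / A))"
    unfolding riesz_def I_def[symmetric] sum_subtractf[symmetric]
  proof (rule sum_norm_le)
    fix n assume n: "n \<in> I"
    have "of_real (tri (freq n / N)) * a n * exp (- of_real (freq n) * Complex 0 t) -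
        of_real (tri (freq n / N)) * b n * exp (- of_real (freq n) * Complex 0 t) =
        of_real (tri (freq n / N)) * (a n * (1 - (\<integral>x. V x * h n x \<partial>m))) * exp (- of_real (freq n) * Complex 0 t)"
      by (simp add: b_def algebra_simps)
    also have "norm \<dots> = tri (freq n / N) * (norm (a n) * norm ((\<integral>x. V x * h n x \<partial>m) - 1))"
      unfolding exp_Complex by (simp add: norm_mult norm_minus_commute)
    also have "\<dots> \<le> 1 * (norm (a n) * (e / A))"
      using v(4)[OF n] by (intro mult_mono) (auto simp: V_def)
    finally show "norm (of_real (tri (freq n / N)) * a n * exp (- of_real (freq n) * Complex 0 t) -
        of_real (tri (freq n / N)) * b n * exp (- of_real (freq n) * Complex 0 t)) \<le> norm (a n) * (e / A)" by simp
  qed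
  also have "\<dots> = (\<Sum>n\<in>I. norm (a n)) * (e / A)" by (rule sum_distrib_right[symmetric])
  also have "\<dots> \<le> A * (e / A)" using \<open>e / A > 0\<close> by (intro mult_right_mono) (auto simp: A_def)
  also have "\<dots> = e" using A by simp
  finally have "norm (riesz freq a N (Complex 0 t)) \<le> C + e"
    using rb norm_triangle_sub[of "riesz freq a N (Complex 0 t)" "riesz freq b N (Complex 0 t)"] by linarith
  then show "norm (riesz freq (\<lambda>n. \<integral>x. f x * cnj (h n x) \<partial>m) N (Complex 0 t)) \<le> C + e"
    by (simp add: a_def[abs_def])
qed

section \<open>Orthogonality of characters\<close>

lemma integral_character:
  assumes \<gamma>: "group_character \<gamma>" and "\<gamma> x0 \<noteq> 1"
  shows "(\<integral>x. \<gamma> x \<partial>m) = 0"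
proof -
  have "(\<integral>x. \<gamma> x \<partial>m) = (\<integral>x. \<gamma> (x0 + x) \<partial>m)"
    by (rule integral_translate[symmetric]) (rule continuous_measurable[OF group_character_continuous[OF \<gamma>]])
  also have "\<dots> = \<gamma> x0 * (\<integral>x. \<gamma> x \<partial>m)" by (simp add: group_character_add[OF \<gamma>])
  finally show ?thesis using \<open>\<gamma> x0 \<noteq> 1\<close> by auto
qed

lemma integral_character_mult_cnj:
  assumes \<gamma>: "group_character \<gamma>" and \<eta>: "group_character \<eta>"
  shows "(\<integral>x. \<gamma> x * cnj (\<eta> x) \<partial>m) = (if \<gamma> = \<eta> then 1 else 0)"
proof (cases "\<gamma> = \<eta>")
  case True
  then show ?thesis using prob_space by (simp add: group_character_mult_cnj[OF \<eta>])
next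
  case False
  then obtain x0 where x0: "\<gamma> x0 \<noteq> \<eta> x0" by blast
  have "\<gamma> x0 * cnj (\<eta> x0) \<noteq> 1"
  proof
    assume "\<gamma> x0 * cnj (\<eta> x0) = 1"
    then have "(\<gamma> x0 * cnj (\<eta> x0)) * \<eta> x0 = \<eta> x0" by simp
    then have "\<gamma> x0 * (\<eta> x0 * cnj (\<eta> x0)) = \<eta> x0" by (simp add: mult_ac)
    then show False using x0 by (simp add: group_character_mult_cnj[OF \<eta>])
  qed
  then show ?thesis
    using integral_character[OF group_character_mult[OF \<gamma> group_character_cnj[OF \<eta>]]] False by simp
qed

lemma integral_character_sum:
  assumes h: "\<And>n. group_character (h n)" and \<gamma>: "group_character \<gamma>"
  shows "(\<integral>x. (\<Sum>n\<in>J. c n * h n x) * cnj (\<gamma> x) \<partial>m) = (\<Sum>n\<in>J. c n * (if h n = \<gamma> then 1 else 0))"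
proof -
  have "integrable m (\<lambda>x. h n x * cnj (\<gamma> x))" for n
    by (intro integrable_continuous continuous_intros group_character_continuous h \<gamma>)
  then have "(\<integral>x. (\<Sum>n\<in>J. c n * (h n x * cnj (\<gamma> x))) \<partial>m) = (\<Sum>n\<in>J. c n * (if h n = \<gamma> then 1 else 0))"
    by (subst Bochner_Integration.integral_sum) (simp_all add: integral_character_mult_cnj[OF h \<gamma>])
  then show ?thesis by (simp add: sum_distrib_right mult.assoc)
qed

lemma integral_norm_sq_character_sum:
  assumes h: "\<And>n. group_character (h n)" and inj: "inj_on h J" and "finite J"
  shows "(\<integral>x. (norm (\<Sum>n\<in>J. c n * h n x))\<^sup>2 \<partial>m) = (\<Sum>n\<in>J. (norm (c n))\<^sup>2)"
proof -
  let ?P = "\<lambda>x. \<Sum>n\<in>J. c n * h n x"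
  have P: "continuous_on UNIV ?P" by (intro continuous_intros group_character_continuous h)
  have "complex_of_real (\<integral>x. (norm (?P x))\<^sup>2 \<partial>m) = (\<integral>x. ?P x * cnj (?P x) \<partial>m)"
    by (subst integral_complex_of_real[symmetric]) (simp only: complex_norm_square)
  also have "\<dots> = (\<integral>x. (\<Sum>k\<in>J. cnj (c k) * (?P x * cnj (h k x))) \<partial>m)"
    by (simp add: sum_distrib_left mult_ac)
  also have "\<dots> = (\<Sum>k\<in>J. (\<integral>x. cnj (c k) * (?P x * cnj (h k x)) \<partial>m))"
    by (intro Bochner_Integration.integral_sum integrable_continuous continuous_intros group_character_continuous h)
  also have "\<dots> = (\<Sum>k\<in>J. cnj (c k) * (\<Sum>n\<in>J. c n * (if h n = h k then 1 else 0)))"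
    by (simp only: integral_mult_right_zero integral_character_sum[OF h h])
  also have "\<dots> = (\<Sum>k\<in>J. cnj (c k) * c k)"
  proof (intro sum.cong refl arg_cong2[where f="(*)"])
    fix k assume k: "k \<in> J"
    have "(\<Sum>n\<in>J. c n * (if h n = h k then 1 else 0)) = (\<Sum>n\<in>J. if n = k then c k else 0)"
      using inj k by (intro sum.cong refl) (auto dest: inj_onD)
    then show "(\<Sum>n\<in>J. c n * (if h n = h k then 1 else 0)) = c k" using k \<open>finite J\<close> by simp
  qed
  also have "\<dots> = complex_of_real (\<Sum>k\<in>J. (norm (c k))\<^sup>2)"
    unfolding of_real_sum complex_norm_square by (simp add: mult.commute)
  finally show ?thesis by (simp only: of_real_eq_iff)
qed

text \<open>
  The Riesz sums are Cauchy in \<open>L\<^sub>2\<close>; along a subsequence with summable distances they converge almost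
  everywhere to a function with the prescribed coefficients.
\<close>

theorem group_function_of_riesz_bounded:
  assumes freq: "frequency freq" and h: "\<And>n. extends_frequency \<beta> (freq n) (h n)"
    and C: "\<And>N t. N > 0 \<Longrightarrow> norm (riesz freq a N (Complex 0 t)) \<le> C"
  obtains f where "f \<in> borel_measurable m" "\<And>x. norm (f x) \<le> C"
    "\<And>n. (\<integral>x. f x * cnj (h n x) \<partial>m) = a n"
    "\<And>\<gamma>. group_character \<gamma> \<Longrightarrow> (\<integral>x. f x * cnj (\<gamma> x) \<partial>m) \<noteq> 0 \<Longrightarrow> \<exists>n. \<gamma> = h n"
proof -
  have hc: "group_character (h n)" for n using h by (simp add: extends_frequency_iff)
  have nn: "freq n \<ge> 0" for n using freq by (simp add: frequency_def)
  have C0: "C \<ge> 0" using C[of 1 0] norm_ge_zero order_trans zero_less_one by blast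
  have inj: "inj h"
  proof (rule injI)
    fix n k assume "h n = h k"
    then have "freq n = freq k" using frequency_unique h by metis
    then show "n = k" using frequency_inj[OF freq] by (auto dest: injD)
  qed
  define J where "J N = {n. freq n < N}" for N
  have J: "finite (J N)" for N unfolding J_def by (rule frequency_finite[OF freq])
  define P where "P N x = (\<Sum>n\<in>J N. of_real (tri (freq n / N)) * a n * h n x)" for N x
  have Pc: "continuous_on UNIV (P N)" for N
    unfolding P_def by (intro continuous_intros group_character_continuous hc)
  have P_mono: "P N x = (\<Sum>n\<in>J M. of_real (tri (freq n / N)) * a n * h n x)" if "0 < N" "N \<le> M" for N M x
    unfolding P_def
  proof (rule sum.mono_neutral_left[OF J])
    show "J N \<subseteq> J M" using that by (auto simp: J_def)
    show "\<forall>n\<in>J M - J N. of_real (tri (freq n / N)) * a n * h n x = 0"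
      using that nn by (auto simp: J_def not_less abs_div intro!: tri_eq_0)
  qed
  \<comment> \<open>On the line \<open>P N\<close> is the Riesz sum on the imaginary axis; density
    and continuity carry its bound to the whole group.\<close>
  have P_bnd: "norm (P N x) \<le> C" if "N > 0" for N x
  proof (rule continuous_norm_leI[OF Pc])
    fix t
    have "P N (\<beta> t) = riesz freq a N (Complex 0 t)"
      unfolding P_def riesz_def J_def exp_Complex using h by (simp add: extends_frequency_iff)
    then show "norm (P N (\<beta> t)) \<le> C" using C[OF that] by simp
  qed
  \<comment> \<open>Orthogonality bounds the damped squares by the mean square of a Riesz sum, hence
    by \<open>C\<^sup>2\<close>. For growing levels the damping factors tend to 1.\<close>
  have bessel: "(\<Sum>n\<in>F. (norm (a n))\<^sup>2) \<le> C\<^sup>2" if F: "finite F" for F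
  proof (rule tendsto_upperbound)
    have "(\<lambda>k. \<Sum>n\<in>F. (tri (freq n / real (Suc k)))\<^sup>2 * (norm (a n))\<^sup>2) \<longlonglongrightarrow> (\<Sum>n\<in>F. 1\<^sup>2 * (norm (a n))\<^sup>2)"
      by (intro tendsto_intros tendsto_tri)
    then show "(\<lambda>k. \<Sum>n\<in>F. (tri (freq n / real (Suc k)))\<^sup>2 * (norm (a n))\<^sup>2) \<longlonglongrightarrow> (\<Sum>n\<in>F. (norm (a n))\<^sup>2)"
      by simp
    obtain K where K: "real K \<ge> Max (insert 0 (freq ` F))" using real_arch_simple by blast
    have "(\<Sum>n\<in>F. (tri (freq n / real (Suc k)))\<^sup>2 * (norm (a n))\<^sup>2) \<le> C\<^sup>2" if "k \<ge> K" for k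
    proof -
      have "F \<subseteq> J (real (Suc k))"
      proof
        fix n assume "n \<in> F"
        then have "freq n \<le> Max (insert 0 (freq ` F))" using F by (intro Max_ge) auto
        then show "n \<in> J (real (Suc k))" using K that by (simp add: J_def)
      qed
      then have "(\<Sum>n\<in>F. (tri (freq n / real (Suc k)))\<^sup>2 * (norm (a n))\<^sup>2) \<le>
          (\<Sum>n\<in>J (real (Suc k)). (norm (of_real (tri (freq n / real (Suc k))) * a n))\<^sup>2)"
        by (intro order_trans[OF _ sum_mono2[OF J]] sum_mono) (auto simp: norm_mult power_mult_distrib)
      also have "\<dots> = (\<integral>x. (norm (P (real (Suc k)) x))\<^sup>2 \<partial>m)"
        unfolding P_def by (rule integral_norm_sq_character_sum[OF hc inj_on_subset[OF inj] J, symmetric]) simp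
      also have "\<dots> \<le> (\<integral>x. C\<^sup>2 \<partial>m)"
      proof (rule integral_mono)
        show b: "(norm (P (real (Suc k)) x))\<^sup>2 \<le> C\<^sup>2" for x by (intro power_mono P_bnd) auto
        have [measurable]: "P (real (Suc k)) \<in> borel_measurable m" by (rule continuous_measurable[OF Pc])
        show "integrable m (\<lambda>x. (norm (P (real (Suc k)) x))\<^sup>2)"
          by (rule integrable_bounded[of _ "C\<^sup>2"]) (use b in \<open>auto simp del: of_nat_Suc\<close>)
      qed simp
      finally show ?thesis using prob_space by simp
    qed
    then show "\<forall>\<^sub>F k in sequentially. (\<Sum>n\<in>F. (tri (freq n / real (Suc k)))\<^sup>2 * (norm (a n))\<^sup>2) \<le> C\<^sup>2"
      unfolding eventually_sequentially by blast
  qed simp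
  have summ: "summable (\<lambda>n. (norm (a n))\<^sup>2)"
    by (rule summableI_nonneg_bounded[OF _ bessel]) auto
  \<comment> \<open>The squared L_2 distance of the Riesz sum of level k + 1 from the limit that is
    still to be constructed, read off the coefficients.\<close>
  define D where "D k = (\<Sum>n. (1 - tri (freq n / real (Suc k)))\<^sup>2 * (norm (a n))\<^sup>2)" for k
  have t1: "(1 - tri x)\<^sup>2 \<le> 1" for x by (intro power_le_one) auto
  have summD: "summable (\<lambda>n. (1 - tri (freq n / real (Suc k)))\<^sup>2 * (norm (a n))\<^sup>2)" for k
    by (rule summable_comparison_test'[OF summ, of 0]) (use t1 in \<open>auto intro: mult_left_le_one_le\<close>)
  have D_lim: "D \<longlonglongrightarrow> 0"
  proof -
    have "(\<lambda>k. (1 - tri (freq n / real (Suc k)))\<^sup>2 * (norm (a n))\<^sup>2) \<longlonglongrightarrow> (1 - 1)\<^sup>2 * (norm (a n))\<^sup>2" for n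
      by (intro tendsto_intros tendsto_tri)
    moreover have "\<forall>\<^sub>F (n, k) in at_top \<times>\<^sub>F sequentially.
        norm ((1 - tri (freq n / real (Suc k)))\<^sup>2 * (norm (a n))\<^sup>2) \<le> (norm (a n))\<^sup>2"
      by (rule always_eventually) (auto intro: mult_left_le_one_le t1)
    ultimately have "(\<lambda>k. suminf (\<lambda>n. (1 - tri (freq n / real (Suc k)))\<^sup>2 * (norm (a n))\<^sup>2)) \<longlonglongrightarrow> suminf (\<lambda>n. (0::real))"
      by (intro tannerys_theorem[where M="\<lambda>n. (norm (a n))\<^sup>2", THEN conjunct2, THEN conjunct2] summ) simp_all
    then show ?thesis by (simp add: D_def[abs_def])
  qed
  have dist: "(\<integral>x. (norm (P (real (Suc k)) x - P (real (Suc l)) x))\<^sup>2 \<partial>m) \<le> 2 * D k + 2 * D l" for k l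
  proof -
    define M where "M = max (real (Suc k)) (real (Suc l))"
    define c where "c n = (tri (freq n / real (Suc k)) - tri (freq n / real (Suc l)))" for n
    have diff: "P (real (Suc k)) x - P (real (Suc l)) x = (\<Sum>n\<in>J M. (of_real (c n) * a n) * h n x)" for x
      by (subst (1 2) P_mono[of _ M]) (auto simp: M_def c_def sum_subtractf[symmetric] algebra_simps)
    have c2: "(c n)\<^sup>2 \<le> 2 * (1 - tri (freq n / real (Suc k)))\<^sup>2 + 2 * (1 - tri (freq n / real (Suc l)))\<^sup>2" for n
    proof -
      have "0 \<le> ((1 - tri (freq n / real (Suc k))) + (1 - tri (freq n / real (Suc l))))\<^sup>2" by simp
      then show ?thesis unfolding c_def power2_eq_square by (simp add: algebra_simps)
    qed
    have "(\<integral>x. (norm (P (real (Suc k)) x - P (real (Suc l)) x))\<^sup>2 \<partial>m) = (\<Sum>n\<in>J M. (norm (of_real (c n) * a n))\<^sup>2)"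
      unfolding diff by (rule integral_norm_sq_character_sum[OF hc inj_on_subset[OF inj] J]) simp
    also have "\<dots> \<le> (\<Sum>n\<in>J M. 2 * ((1 - tri (freq n / real (Suc k)))\<^sup>2 * (norm (a n))\<^sup>2) +
        2 * ((1 - tri (freq n / real (Suc l)))\<^sup>2 * (norm (a n))\<^sup>2))"
    proof (rule sum_mono)
      fix n
      have "(norm (of_real (c n) * a n))\<^sup>2 = (c n)\<^sup>2 * (norm (a n))\<^sup>2" by (simp add: norm_mult power_mult_distrib)
      also have "\<dots> \<le> (2 * (1 - tri (freq n / real (Suc k)))\<^sup>2 + 2 * (1 - tri (freq n / real (Suc l)))\<^sup>2) * (norm (a n))\<^sup>2"
        by (intro mult_right_mono c2) simp
      finally show "(norm (of_real (c n) * a n))\<^sup>2 \<le> 2 * ((1 - tri (freq n / real (Suc k)))\<^sup>2 * (norm (a n))\<^sup>2) +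
        2 * ((1 - tri (freq n / real (Suc l)))\<^sup>2 * (norm (a n))\<^sup>2)" by (simp add: distrib_right mult.assoc)
    qed
    also have "\<dots> = 2 * (\<Sum>n\<in>J M. (1 - tri (freq n / real (Suc k)))\<^sup>2 * (norm (a n))\<^sup>2) +
        2 * (\<Sum>n\<in>J M. (1 - tri (freq n / real (Suc l)))\<^sup>2 * (norm (a n))\<^sup>2)"
      by (simp add: sum.distrib sum_distrib_left)
    also have "\<dots> \<le> 2 * D k + 2 * D l"
      unfolding D_def by (intro add_mono mult_left_mono sum_le_suminf summD J) auto
    finally show ?thesis .
  qed
  \<comment> \<open>By \<open>dist\<close>, two levels with this bound have squared distance at most
    \<open>(1/4) ^ i\<close>, so the distances are summable.\<close>
  have "\<exists>K. \<forall>k\<ge>K. D k \<le> (1/4) ^ i / 4" for i :: nat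
  proof -
    have "(1/4) ^ i / 4 > (0::real)" by simp
    from order_tendstoD(2)[OF D_lim this] show ?thesis
      unfolding eventually_sequentially by (meson less_imp_le)
  qed
  then obtain K where K: "\<And>i k. k \<ge> K i \<Longrightarrow> D k \<le> (1/4) ^ i / 4" by metis
  \<comment> \<open>Adding up the thresholds gives r i \<ge> K i, and the summand \<open>i\<close>
    forces the levels to infinity.\<close>
  define r where "r i = i + (\<Sum>j\<le>i. K j)" for i :: nat
  have rK: "r i \<ge> K i" for i unfolding r_def using member_le_sum[of i "{..i}" K] by simp
  have r_ge: "r i \<ge> i" for i by (simp add: r_def)
  have Dr: "D (r i) \<le> (1/4) ^ i / 4" for i by (rule K[OF rK])
  define g where "g i = P (real (Suc (r i)))" for i
  have gm[measurable]: "g i \<in> borel_measurable m" for i unfolding g_def by (rule continuous_measurable[OF Pc])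
  have g_bnd: "norm (g i x) \<le> C" for i x unfolding g_def by (rule P_bnd) simp
  have diff_bnd: "norm (g (Suc i) x - g i x) \<le> 2 * C" for i x
    using norm_triangle_ineq4[of "g (Suc i) x" "g i x"] g_bnd[of "Suc i" x] g_bnd[of i x] by linarith
  have int_diff: "(\<integral>x. norm (g (Suc i) x - g i x) \<partial>m) \<le> (1/2) ^ i" for i
  proof -
    define q where "q = (1/2::real) ^ i"
    have q: "q > 0" "q * q = (1/4) ^ i" by (auto simp: q_def simp flip: power_mult_distrib)
    have i2: "integrable m (\<lambda>x. (norm (g (Suc i) x - g i x))\<^sup>2)"
    proof (rule integrable_bounded[of _ "(2 * C)\<^sup>2"])
      fix x
      from power_mono[OF diff_bnd norm_ge_zero, of i x 2]
      show "norm ((norm (g (Suc i) x - g i x))\<^sup>2) \<le> (2 * C)\<^sup>2" by simp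
    qed simp
    \<comment> \<open>The inequality 2 d \<le> q + d^2 / q, with \<open>q\<close> the size of the
      L_2 distance, turns the L_2 bound into an L_1 bound in place of Cauchy--Schwarz.\<close>
    have "(\<integral>x. norm (g (Suc i) x - g i x) \<partial>m) \<le> (\<integral>x. (q + (norm (g (Suc i) x - g i x))\<^sup>2 / q) / 2 \<partial>m)"
    proof (rule integral_mono)
      show "integrable m (\<lambda>x. norm (g (Suc i) x - g i x))"
        by (rule integrable_bounded[of _ "2 * C"])
          (use diff_bnd in auto)
      show "integrable m (\<lambda>x. (q + (norm (g (Suc i) x - g i x))\<^sup>2 / q) / 2)" using i2 by simp
      fix x
      have "0 \<le> (norm (g (Suc i) x - g i x) - q)\<^sup>2" by simp
      then have "2 * norm (g (Suc i) x - g i x) * q \<le> q * q + (norm (g (Suc i) x - g i x))\<^sup>2"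
        unfolding power2_eq_square by (simp add: algebra_simps)
      then show "norm (g (Suc i) x - g i x) \<le> (q + (norm (g (Suc i) x - g i x))\<^sup>2 / q) / 2"
        using q(1) by (simp add: field_simps)
    qed
    also have "\<dots> = (q + (\<integral>x. (norm (g (Suc i) x - g i x))\<^sup>2 \<partial>m) / q) / 2"
      using i2 prob_space by simp
    also have "\<dots> \<le> (q + (q * q) / q) / 2"
    proof -
      have "(\<integral>x. (norm (g (Suc i) x - g i x))\<^sup>2 \<partial>m) \<le> 2 * D (r (Suc i)) + 2 * D (r i)"
        unfolding g_def by (rule dist)
      also have "\<dots> \<le> 2 * ((1/4) ^ i / 4) + 2 * ((1/4) ^ i / 4)"
      proof -
        have "(1/4::real) ^ Suc i / 4 \<le> (1/4) ^ i / 4" by simp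
        with Dr[of "Suc i"] have "D (r (Suc i)) \<le> (1/4) ^ i / 4" by (rule order_trans)
        then show ?thesis using Dr[of i] by simp
      qed
      also have "\<dots> = q * q" by (simp add: q(2))
      finally show ?thesis using q(1) by (intro divide_right_mono add_left_mono) auto
    qed
    also have "\<dots> = q" using q(1) by simp
    finally show ?thesis by (simp add: q_def)
  qed
  have conv: "AE x in m. convergent (\<lambda>i. g i x)"
  proof -
    have "(\<integral>\<^sup>+x. (\<Sum>i. ennreal (norm (g (Suc i) x - g i x))) \<partial>m) = (\<Sum>i. \<integral>\<^sup>+x. ennreal (norm (g (Suc i) x - g i x)) \<partial>m)"
      by (rule nn_integral_suminf) measurable
    also have "\<dots> \<le> (\<Sum>i. ennreal ((1/2) ^ i))"
    proof (rule suminf_le)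
      fix i
      have "(\<integral>\<^sup>+x. ennreal (norm (g (Suc i) x - g i x)) \<partial>m) = ennreal (\<integral>x. norm (g (Suc i) x - g i x) \<partial>m)"
        by (rule nn_integral_eq_integral[OF integrable_bounded[of _ "2 * C"]])
          (use diff_bnd in auto)
      then show "(\<integral>\<^sup>+x. ennreal (norm (g (Suc i) x - g i x)) \<partial>m) \<le> ennreal ((1/2) ^ i)"
        using int_diff[of i] by (simp add: ennreal_leI)
    qed auto
    also have "\<dots> = ennreal (\<Sum>i. (1/2) ^ i)"
      by (rule suminf_ennreal2) (auto intro!: summable_geometric)
    also have "\<dots> < \<infinity>" by (rule ennreal_less_top[unfolded infinity_ennreal_def[symmetric]])
    finally have "AE x in m. (\<Sum>i. ennreal (norm (g (Suc i) x - g i x))) \<noteq> \<infinity>"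
      by (intro nn_integral_PInf_AE) auto
    then show ?thesis
    proof eventually_elim
      case (elim x)
      then have "summable (\<lambda>i. norm (g (Suc i) x - g i x))"
        by (intro summable_suminf_not_top) auto
      then have "summable (\<lambda>i. g (Suc i) x - g i x)" by (rule summable_norm_cancel)
      then have "convergent (\<lambda>n. \<Sum>i<n. g (Suc i) x - g i x)" by (simp add: summable_iff_convergent)
      then have "convergent (\<lambda>n. g n x - g 0 x)" by (simp only: sum_lessThan_telescope[of "\<lambda>i. g i x"])
      then have "convergent (\<lambda>n. (g n x - g 0 x) + g 0 x)" by (intro convergent_add convergent_const)
      then show ?case by simp
    qed
  qed
  define f0 where "f0 x = lim (\<lambda>i. g i x)" for x
  have f0m[measurable]: "f0 \<in> borel_measurable m" unfolding f0_def by measurable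
  \<comment> \<open>Where the subsequence diverges, \<open>lim\<close> is an unspecified value; the
    truncation makes the bound \<open>C\<close> hold at every point.\<close>
  define f where "f x = (if norm (f0 x) \<le> C then f0 x else 0)" for x
  have fm[measurable]: "f \<in> borel_measurable m" unfolding f_def by measurable
  have f_bnd: "norm (f x) \<le> C" for x using C0 by (simp add: f_def)
  have lim_f: "AE x in m. (\<lambda>i. g i x) \<longlonglongrightarrow> f x"
    using conv
  proof eventually_elim
    case (elim x)
    then have l: "(\<lambda>i. g i x) \<longlonglongrightarrow> f0 x" unfolding f0_def by (simp add: convergent_LIMSEQ_iff)
    then have "norm (f0 x) \<le> C"
      by (rule tendsto_upperbound[OF tendsto_norm]) (use g_bnd in auto)
    with l show ?case by (simp add: f_def)
  qed
  have coeff: "(\<lambda>i. \<integral>x. g i x * cnj (\<gamma> x) \<partial>m) \<longlonglongrightarrow> (\<integral>x. f x * cnj (\<gamma> x) \<partial>m)" if \<gamma>: "group_character \<gamma>" for \<gamma>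
  proof (rule integral_dominated_convergence[where w="\<lambda>_. C"])
    have [measurable]: "\<gamma> \<in> borel_measurable m" by (rule continuous_measurable[OF group_character_continuous[OF \<gamma>]])
    show "(\<lambda>x. f x * cnj (\<gamma> x)) \<in> borel_measurable m" "\<And>i. (\<lambda>x. g i x * cnj (\<gamma> x)) \<in> borel_measurable m"
      by measurable
    show "AE x in m. (\<lambda>i. g i x * cnj (\<gamma> x)) \<longlonglongrightarrow> f x * cnj (\<gamma> x)"
      using lim_f by eventually_elim (intro tendsto_intros)
    show "AE x in m. norm (g i x * cnj (\<gamma> x)) \<le> C" for i
      using g_bnd by (intro AE_I2) (simp add: norm_mult group_character_norm[OF \<gamma>])
  qed simp
  have coeff_g: "(\<integral>x. g i x * cnj (\<gamma> x) \<partial>m) =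
      (\<Sum>n\<in>J (real (Suc (r i))). (of_real (tri (freq n / real (Suc (r i)))) * a n) * (if h n = \<gamma> then 1 else 0))"
    if \<gamma>: "group_character \<gamma>" for i \<gamma>
    unfolding g_def P_def by (rule integral_character_sum[OF hc \<gamma>])
  show ?thesis
  proof (rule that[OF fm f_bnd])
    fix n
    have "(\<integral>x. g i x * cnj (h n x) \<partial>m) = of_real (tri (freq n / real (Suc (r i)))) * a n" for i
    proof -
      have "(\<integral>x. g i x * cnj (h n x) \<partial>m) =
          (\<Sum>k\<in>J (real (Suc (r i))). if k = n then of_real (tri (freq n / real (Suc (r i)))) * a n else 0)"
        unfolding coeff_g[OF hc] using inj by (intro sum.cong refl) (auto dest: injD)
      also have "\<dots> = of_real (tri (freq n / real (Suc (r i)))) * a n"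
      proof (cases "n \<in> J (real (Suc (r i)))")
        case False
        then have "tri (freq n / real (Suc (r i))) = 0"
          using nn[of n] by (intro tri_eq_0) (simp add: J_def not_less abs_div del: of_nat_Suc)
        then show ?thesis using False J by simp
      qed (use J in simp)
      finally show ?thesis .
    qed
    moreover have "(\<lambda>i. complex_of_real (tri (freq n / real (Suc (r i)))) * a n) \<longlonglongrightarrow> of_real 1 * a n"
    proof (intro tendsto_intros)
      have "filterlim r sequentially sequentially"
        using r_ge by (intro filterlim_at_top_mono[OF filterlim_ident]) auto
      then show "(\<lambda>i. tri (freq n / real (Suc (r i)))) \<longlonglongrightarrow> 1" by (rule filterlim_compose[OF tendsto_tri])
    qed
    ultimately show "(\<integral>x. f x * cnj (h n x) \<partial>m) = a n"
      using coeff[OF hc, of n] LIMSEQ_unique by fastforce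
  next
    fix \<gamma> assume \<gamma>: "group_character \<gamma>" and nz: "(\<integral>x. f x * cnj (\<gamma> x) \<partial>m) \<noteq> 0"
    show "\<exists>n. \<gamma> = h n"
    proof (rule ccontr)
      assume "\<not> ?thesis"
      then have "h n \<noteq> \<gamma>" for n by metis
      then have "(\<lambda>i. \<integral>x. g i x * cnj (\<gamma> x) \<partial>m) = (\<lambda>i. 0)" by (simp add: coeff_g[OF \<gamma>])
      then show False using coeff[OF \<gamma>] nz by (simp add: LIMSEQ_const_iff)
    qed
  qed
qed

lemma measurable_character: "group_character \<gamma> \<Longrightarrow> \<gamma> \<in> borel_measurable m"
  by (intro continuous_measurable group_character_continuous)

end

section \<open>Bounded representatives of classes\<close>

lemma (in prob_space) linf_bounded:
  assumes f: "f \<in> borel_measurable M" "\<And>x. norm (f x) \<le> C"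
  shows "f \<in> linf_fun M" "linf_norm M (linf_rel M `` {f}) \<le> C"
proof -
  note [measurable] = f(1)
  have le: "esssup M (\<lambda>x. ereal (norm (f x))) \<le> ereal C"
    using f(2) by (intro esssup_I) auto
  then show l: "f \<in> linf_fun M" using f(1) by (auto simp: linf_fun_def intro: le_less_trans)
  have "ereal 0 = esssup M (\<lambda>x. ereal 0)" by (rule esssup_const[symmetric]) (simp add: emeasure_space_1)
  also have "\<dots> \<le> esssup M (\<lambda>x. ereal (norm (f x)))" by (intro esssup_mono) auto
  finally have ge: "0 \<le> esssup M (\<lambda>x. ereal (norm (f x)))" by (simp add: zero_ereal_def)
  show "linf_norm M (linf_rel M `` {f}) \<le> C"
    unfolding linf_norm_class[OF l] using le ge by (cases "esssup M (\<lambda>x. ereal (norm (f x)))") auto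
qed

text \<open>Setting a representative to 0 where it exceeds its essential supremum changes it on a
  null set only, and yields the pointwise bound that the results on the group assume.\<close>

lemma (in prob_space) linf_representative:
  assumes "A \<in> linf M"
  obtains f where "f \<in> borel_measurable M" "\<And>x. norm (f x) \<le> linf_norm M A" "f \<in> linf_fun M" "A = linf_rel M `` {f}"
proof -
  obtain g where g: "g \<in> linf_fun M" "A = linf_rel M `` {g}"
    using assms unfolding linf_def by (rule quotientE)
  have [measurable]: "g \<in> borel_measurable M" using g(1) by (simp add: linf_fun_def)
  have "ereal 0 = esssup M (\<lambda>x. ereal 0)" by (rule esssup_const[symmetric]) (simp add: emeasure_space_1)
  also have "\<dots> \<le> esssup M (\<lambda>x. ereal (norm (g x)))" by (intro esssup_mono) auto
  finally have ge: "0 \<le> esssup M (\<lambda>x. ereal (norm (g x)))" by (simp add: zero_ereal_def)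
  have lt: "esssup M (\<lambda>x. ereal (norm (g x))) < \<infinity>" using g(1) by (simp add: linf_fun_def)
  define c where "c = linf_norm M A"
  have c: "esssup M (\<lambda>x. ereal (norm (g x))) = ereal c" "c \<ge> 0"
    unfolding c_def g(2) linf_norm_class[OF g(1)] using ge lt
    by (cases "esssup M (\<lambda>x. ereal (norm (g x)))"; simp)+
  define f where "f x = (if norm (g x) \<le> c then g x else 0)" for x
  have f: "f \<in> borel_measurable M" "\<And>x. norm (f x) \<le> c"
    using c(2) by (auto simp: f_def[abs_def])
  have "AE x in M. ereal (norm (g x)) \<le> esssup M (\<lambda>x. ereal (norm (g x)))" by (rule esssup_AE)
  then have "AE x in M. g x = f x" by eventually_elim (simp add: c f_def)
  then have "A = linf_rel M `` {f}"
    unfolding g(2) using g(1) linf_bounded(1)[OF f]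
    by (intro equiv_class_eq[OF equiv_linf_rel]) (simp add: linf_rel_def)
  then show ?thesis using f linf_bounded(1)[OF f] by (intro that[of f]) (auto simp: c_def)
qed

section \<open>The isometry\<close>

theorem theorem2p16:
  fixes freq :: "nat \<Rightarrow> real"
    and \<beta> :: "real \<Rightarrow> 'g::{topological_ab_group_add,t2_space}"
    and m :: "'g measure"
  assumes "frequency freq"
    and "freq_dirichlet_group freq \<beta>"
    and "normalized_haar_measure m"
  shows "\<exists>\<Psi> :: (complex \<Rightarrow> complex) \<Rightarrow> ('g \<Rightarrow> complex) set.
    \<Psi> ` hardy_inf_half_plane freq = hardy_inf_group freq \<beta> m
    \<and> (\<forall>F\<in>hardy_inf_half_plane freq. \<forall>H\<in>hardy_inf_half_plane freq.
         \<Psi> (\<lambda>z. F z + H z) = linf_add m (\<Psi> F) (\<Psi> H))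
    \<and> (\<forall>c. \<forall>F\<in>hardy_inf_half_plane freq.
         \<Psi> (\<lambda>z. c * F z) = linf_scale m c (\<Psi> F))
    \<and> (\<forall>F\<in>hardy_inf_half_plane freq. linf_norm m (\<Psi> F) = half_plane_norm F)
    \<and> (\<forall>F\<in>hardy_inf_half_plane freq. \<forall>n.
         bohr_coeff F (freq n) = fourier_coeff m (\<Psi> F) (freq_char \<beta> (freq n)))"
proof -
  interpret haar_dirichlet \<beta> m
    using assms(2,3) by unfold_locales (auto simp: freq_dirichlet_group_def)
  note freq = assms(1)
  let ?X = "hardy_inf_half_plane freq" and ?Y = "hardy_inf_group freq \<beta> m"
  define h where "h n = freq_char \<beta> (freq n)" for n
  have h: "extends_frequency \<beta> (freq n) (h n)" for n
  proof -
    obtain k where k: "extends_frequency \<beta> (freq n) k"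
      using assms(2) unfolding freq_dirichlet_group_def by blast
    then show ?thesis unfolding h_def using freq_char_unique[OF dirichlet k] by simp
  qed
  have hc: "group_character (h n)" for n using h by (simp add: extends_frequency_iff)
  have fc: "fourier_coeff m (linf_rel m `` {f}) \<gamma> = (\<integral>x. f x * cnj (\<gamma> x) \<partial>m)"
    if "f \<in> linf_fun m" "group_character \<gamma>" for f \<gamma>
    by (rule fourier_coeff_class[OF that(1) measurable_character[OF that(2)]])
  have Y_iff: "linf_rel m `` {f} \<in> ?Y \<longleftrightarrow>
      (\<forall>\<gamma>. group_character \<gamma> \<longrightarrow> (\<integral>x. f x * cnj (\<gamma> x) \<partial>m) \<noteq> 0 \<longrightarrow> (\<exists>n. \<gamma> = h n))"
    if f: "f \<in> linf_fun m" for f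
    unfolding hardy_inf_group_def h_def using fc[OF f] quotientI[OF f, of "linf_rel m"]
    by (auto simp: linf_def)
  have int_linf: "integrable m (\<lambda>x. f x * cnj (\<gamma> x))"
    if f: "f \<in> borel_measurable m" "\<And>x. norm (f x) \<le> C" and \<gamma>: "group_character \<gamma>" for f \<gamma> C
  proof (rule integrable_bounded[of _ C])
    have [measurable]: "\<gamma> \<in> borel_measurable m" by (rule measurable_character[OF \<gamma>])
    show "(\<lambda>x. f x * cnj (\<gamma> x)) \<in> borel_measurable m" using f(1) by measurable
    show "norm (f x * cnj (\<gamma> x)) \<le> C" for x using f(2) by (simp add: norm_mult group_character_norm[OF \<gamma>])
  qed
  \<comment> \<open>At characters other than the \<open>h n\<close> both coefficients are 0, so the
    difference of two representatives has no nonzero Fourier coefficient.\<close>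
  have unique: "A = B" if A: "A \<in> ?Y" and B: "B \<in> ?Y"
    and eq: "\<And>n. fourier_coeff m A (h n) = fourier_coeff m B (h n)" for A B
  proof -
    have "A \<in> linf m" "B \<in> linf m" using A B by (auto simp: hardy_inf_group_def)
    then obtain f g where f: "f \<in> borel_measurable m" "\<And>x. norm (f x) \<le> linf_norm m A" "f \<in> linf_fun m" "A = linf_rel m `` {f}"
      and g: "g \<in> borel_measurable m" "\<And>x. norm (g x) \<le> linf_norm m B" "g \<in> linf_fun m" "B = linf_rel m `` {g}"
      using linf_representative by metis
    have "AE x in m. f x - g x = 0"
    proof (rule AE_eq_0_if_coefficients_0)
      show "(\<lambda>x. f x - g x) \<in> borel_measurable m" using f(1) g(1) by measurable
      show "norm (f x - g x) \<le> linf_norm m A + linf_norm m B" for x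
        using norm_triangle_ineq4[of "f x" "g x"] f(2)[of x] g(2)[of x] by linarith
      fix \<gamma> :: "'g \<Rightarrow> complex" assume \<gamma>: "group_character \<gamma>"
      have "(\<integral>x. f x * cnj (\<gamma> x) \<partial>m) = (\<integral>x. g x * cnj (\<gamma> x) \<partial>m)"
      proof (cases "\<exists>n. \<gamma> = h n")
        case True
        then show ?thesis using eq fc[OF f(3) hc] fc[OF g(3) hc] by (auto simp: f(4) g(4))
      next
        case False
        then show ?thesis using A B \<gamma> Y_iff[OF f(3)] Y_iff[OF g(3)] by (simp add: f(4) g(4)) metis
      qed
      then show "(\<integral>x. (f x - g x) * cnj (\<gamma> x) \<partial>m) = 0"
        using int_linf[OF f(1,2) \<gamma>] int_linf[OF g(1,2) \<gamma>] by (simp add: left_diff_distrib)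
    qed
    then have "AE x in m. f x = g x" by eventually_elim simp
    then show ?thesis unfolding f(4) g(4)
      using f(3) g(3) by (intro equiv_class_eq[OF equiv_linf_rel]) (simp add: linf_rel_def)
  qed
  have X: "half_plane_ap F (half_plane_norm F)" "\<And>x. x \<notin> range freq \<Longrightarrow> bohr_coeff F x = 0" if F: "F \<in> ?X" for F
  proof -
    have "bdd_above ((\<lambda>z. norm (F z)) ` right_half_plane)"
    proof -
      obtain B where "\<And>z. z \<in> right_half_plane \<Longrightarrow> norm (F z) \<le> B"
        using F by (auto simp: hardy_inf_half_plane_def bounded_iff)
      then show ?thesis by (intro bdd_aboveI2)
    qed
    then have "norm (F z) \<le> half_plane_norm F" if "Re z > 0" for z
      unfolding half_plane_norm_def using that by (intro cSUP_upper) (auto simp: right_half_plane_def)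
    then show "half_plane_ap F (half_plane_norm F)"
      using F by (simp add: hardy_inf_half_plane_def half_plane_ap_def uniformly_almost_periodic_iff)
    show "bohr_coeff F x = 0" if "x \<notin> range freq" for x
      using F that by (simp add: hardy_inf_half_plane_def)
  qed
  \<comment> \<open>The map is determined by coefficients alone, so linearity needs no formula for
    it: by \<open>\<Psi>I\<close> it is enough that the sum or multiple of the images lies in the
    space and has the right coefficients.\<close>
  define \<Psi> where "\<Psi> F = (THE A. A \<in> ?Y \<and> (\<forall>n. fourier_coeff m A (h n) = bohr_coeff F (freq n)))" for F
  have \<Psi>I: "\<Psi> F = A" if "A \<in> ?Y" "\<And>n. fourier_coeff m A (h n) = bohr_coeff F (freq n)" for F A
    unfolding \<Psi>_def by (rule the_equality) (use that unique in auto)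
  have ex: "\<exists>A\<in>?Y. (\<forall>n. fourier_coeff m A (h n) = bohr_coeff F (freq n)) \<and> linf_norm m A \<le> half_plane_norm F"
    if F: "F \<in> ?X" for F
  proof -
    obtain f where f: "f \<in> borel_measurable m" "\<And>x. norm (f x) \<le> half_plane_norm F"
      "\<And>n. (\<integral>x. f x * cnj (h n x) \<partial>m) = bohr_coeff F (freq n)"
      "\<And>\<gamma>. group_character \<gamma> \<Longrightarrow> (\<integral>x. f x * cnj (\<gamma> x) \<partial>m) \<noteq> 0 \<Longrightarrow> \<exists>n. \<gamma> = h n"
      using group_function_of_riesz_bounded[OF freq h norm_riesz_le_half_plane[OF freq X[OF F]]] by blast
    note l = linf_bounded[OF f(1,2)]
    show ?thesis
      using Y_iff[OF l(1)] f(3,4) l(2) fc[OF l(1) hc] by (intro bexI[of _ "linf_rel m `` {f}"]) auto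
  qed
  have \<Psi>: "\<Psi> F \<in> ?Y" "\<And>n. fourier_coeff m (\<Psi> F) (h n) = bohr_coeff F (freq n)" "linf_norm m (\<Psi> F) \<le> half_plane_norm F"
    if "F \<in> ?X" for F
    using ex[OF that] \<Psi>I by metis+
  have Y_riesz: "norm (riesz freq (\<lambda>n. fourier_coeff m A (h n)) N (Complex 0 t)) \<le> linf_norm m A"
    if A: "A \<in> ?Y" and "N > 0" for A N t
  proof -
    have "A \<in> linf m" using A by (auto simp: hardy_inf_group_def)
    then obtain f where f: "f \<in> borel_measurable m" "\<And>x. norm (f x) \<le> linf_norm m A" "f \<in> linf_fun m" "A = linf_rel m `` {f}"
      using linf_representative by metis
    have eq: "(\<lambda>n. fourier_coeff m A (h n)) = (\<lambda>n. \<integral>x. f x * cnj (h n x) \<partial>m)"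
      unfolding f(4) using fc[OF f(3) hc] by simp
    show ?thesis unfolding eq
    proof (rule norm_riesz_le_group[OF freq h f(1,2) _ \<open>N > 0\<close>])
      show "\<exists>n. \<gamma> = h n" if "group_character \<gamma>" "(\<integral>x. f x * cnj (\<gamma> x) \<partial>m) \<noteq> 0" for \<gamma>
        using A that Y_iff[OF f(3)] by (simp add: f(4))
    qed
  qed
  \<comment> \<open>The Riesz sums of \<open>F\<close> are those of its image, hence bounded by the
    norm on the group, first on the imaginary axis and then on the half-plane, where they converge
    to \<open>F\<close>.\<close>
  have norm_ge: "half_plane_norm F \<le> linf_norm m (\<Psi> F)" if F: "F \<in> ?X" for F
    unfolding half_plane_norm_def
  proof (rule cSUP_least)
    show "right_half_plane \<noteq> {}" unfolding right_half_plane_def by (auto intro: exI[of _ 1])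
    fix z assume "z \<in> right_half_plane"
    then have z: "Re z > 0" by (simp add: right_half_plane_def)
    show "norm (F z) \<le> linf_norm m (\<Psi> F)"
    proof (rule tendsto_upperbound[OF tendsto_norm[OF riesz_tendsto_half_plane[OF freq X[OF F] z]]])
      have "norm (riesz freq (\<lambda>n. bohr_coeff F (freq n)) (real (Suc k)) z) \<le> linf_norm m (\<Psi> F)" for k
      proof (rule norm_riesz_le_imaginary_axis[OF freq])
        show "norm (riesz freq (\<lambda>n. bohr_coeff F (freq n)) (real (Suc k)) (Complex 0 t)) \<le> linf_norm m (\<Psi> F)" for t
          using Y_riesz[OF \<Psi>(1)[OF F], of "real (Suc k)" t] \<Psi>(2)[OF F] by simp
      qed (use z in simp)
      then show "\<forall>\<^sub>F k in sequentially. norm (riesz freq (\<lambda>n. bohr_coeff F (freq n)) (real (Suc k)) z) \<le> linf_norm m (\<Psi> F)"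
        by simp
    qed simp_all
  qed
  \<comment> \<open>The coefficients are evaluated on the line Re z = 1, where the mean is
    additive.\<close>
  have bohr_add: "bohr_coeff (\<lambda>z. F z + H z) x = bohr_coeff F x + bohr_coeff H x"
    if F: "F \<in> ?X" and H: "H \<in> ?X" for F H x
  proof -
    note F' = X(1)[OF F] and H' = X(1)[OF H]
    have bochner_ap: "bochner_ap (vertical F \<sigma>)" "bochner_ap (vertical H \<sigma>)" if "\<sigma> > 0" for \<sigma>
      using F' H' that by (auto simp: half_plane_ap_def)
    have vert: "vertical (\<lambda>z. F z + H z) \<sigma> = (\<lambda>t. vertical F \<sigma> t + vertical H \<sigma> t)" for \<sigma>
      by (simp add: vertical_def[abs_def])
    have "half_plane_ap (\<lambda>z. F z + H z) (half_plane_norm F + half_plane_norm H)"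
      unfolding half_plane_ap_def vert using F' H' bochner_ap
      by (auto simp: half_plane_ap_def intro!: holomorphic_intros bochner_ap_add norm_triangle_le add_mono)
    then show ?thesis
      using mean_add[of "\<lambda>t. vertical F 1 t * cis (x * t)" "\<lambda>t. vertical H 1 t * cis (x * t)"]
      by (simp add: bohr_coeff_eq[OF _ zero_less_one] bohr_coeff_eq[OF F' zero_less_one] bohr_coeff_eq[OF H' zero_less_one] vert distrib_right distrib_left bochner_ap_mult bochner_ap_cis bochner_ap)
  qed
  have bohr_scale: "bohr_coeff (\<lambda>z. c * F z) x = c * bohr_coeff F x" if F: "F \<in> ?X" for F c x
  proof -
    note F' = X(1)[OF F]
    have bochner_ap: "bochner_ap (vertical F \<sigma>)" if "\<sigma> > 0" for \<sigma> using F' that by (auto simp: half_plane_ap_def)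
    have vert: "vertical (\<lambda>z. c * F z) \<sigma> = (\<lambda>t. c * vertical F \<sigma> t)" for \<sigma>
      by (simp add: vertical_def[abs_def])
    have "half_plane_ap (\<lambda>z. c * F z) (norm c * half_plane_norm F)"
      unfolding half_plane_ap_def vert using F' bochner_ap
      by (auto simp: half_plane_ap_def norm_mult intro!: holomorphic_intros bochner_ap_cmult mult_left_mono)
    then show ?thesis
      using mean_cmult[of "\<lambda>t. vertical F 1 t * cis (x * t)" c]
      by (simp add: bohr_coeff_eq[OF _ zero_less_one] bohr_coeff_eq[OF F' zero_less_one] vert mult.assoc bochner_ap_mult bochner_ap_cis bochner_ap)
  qed
  have rep: "\<exists>f. f \<in> borel_measurable m \<and> (\<forall>x. norm (f x) \<le> linf_norm m (\<Psi> F)) \<and> f \<in> linf_fun m \<and> \<Psi> F = linf_rel m `` {f}"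
    if F: "F \<in> ?X" for F
  proof -
    have "\<Psi> F \<in> linf m" using \<Psi>(1)[OF F] by (simp add: hardy_inf_group_def)
    then show ?thesis using linf_representative by metis
  qed
  show ?thesis
  proof (intro exI[of _ \<Psi>] conjI ballI allI)
    show "\<Psi> ` ?X = ?Y"
    proof (intro equalityI subsetI)
      fix A assume "A \<in> \<Psi> ` ?X" then show "A \<in> ?Y" using \<Psi>(1) by blast
    next
      fix A assume A: "A \<in> ?Y"
      obtain F where F: "half_plane_ap F (linf_norm m A)" "\<And>z. z \<notin> right_half_plane \<Longrightarrow> F z = 0"
        "\<And>n. bohr_coeff F (freq n) = fourier_coeff m A (h n)" "\<And>x. x \<notin> range freq \<Longrightarrow> bohr_coeff F x = 0"
        using half_plane_of_riesz_bounded[OF freq Y_riesz[OF A]] by blast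
      have "F \<in> ?X"
        using F unfolding hardy_inf_half_plane_def half_plane_ap_def
        by (auto simp: uniformly_almost_periodic_iff right_half_plane_def bounded_iff)
      moreover have "\<Psi> F = A" by (rule \<Psi>I[OF A]) (simp add: F)
      ultimately show "A \<in> \<Psi> ` ?X" by blast
    qed
  next
    fix F H assume F: "F \<in> ?X" and H: "H \<in> ?X"
    obtain f where f: "f \<in> borel_measurable m" "\<And>x. norm (f x) \<le> linf_norm m (\<Psi> F)" "f \<in> linf_fun m" "\<Psi> F = linf_rel m `` {f}"
      using rep[OF F] by blast
    obtain g where g: "g \<in> borel_measurable m" "\<And>x. norm (g x) \<le> linf_norm m (\<Psi> H)" "g \<in> linf_fun m" "\<Psi> H = linf_rel m `` {g}"
      using rep[OF H] by blast
    note fg = linf_fun_add[OF f(3) g(3)]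
    have add: "(\<integral>x. (f x + g x) * cnj (\<gamma> x) \<partial>m) = (\<integral>x. f x * cnj (\<gamma> x) \<partial>m) + (\<integral>x. g x * cnj (\<gamma> x) \<partial>m)"
      if \<gamma>: "group_character \<gamma>" for \<gamma>
      using int_linf[OF f(1,2) \<gamma>] int_linf[OF g(1,2) \<gamma>] by (simp add: distrib_right)
    have sum: "linf_add m (\<Psi> F) (\<Psi> H) = linf_rel m `` {\<lambda>x. f x + g x}"
      unfolding f(4) g(4) by (rule linf_add_class[OF f(3) g(3)])
    show "\<Psi> (\<lambda>z. F z + H z) = linf_add m (\<Psi> F) (\<Psi> H)"
    proof (rule \<Psi>I)
      show "linf_add m (\<Psi> F) (\<Psi> H) \<in> ?Y"
        unfolding sum Y_iff[OF fg]
      proof (intro allI impI)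
        fix \<gamma> :: "'g \<Rightarrow> complex"
        assume \<gamma>: "group_character \<gamma>" and nz: "(\<integral>x. (f x + g x) * cnj (\<gamma> x) \<partial>m) \<noteq> 0"
        have "(\<integral>x. f x * cnj (\<gamma> x) \<partial>m) \<noteq> 0 \<or> (\<integral>x. g x * cnj (\<gamma> x) \<partial>m) \<noteq> 0"
          using nz unfolding add[OF \<gamma>] by auto
        then show "\<exists>n. \<gamma> = h n"
          using \<Psi>(1)[OF F, unfolded f(4) Y_iff[OF f(3)]] \<Psi>(1)[OF H, unfolded g(4) Y_iff[OF g(3)]] \<gamma> by blast
      qed
      show "fourier_coeff m (linf_add m (\<Psi> F) (\<Psi> H)) (h n) = bohr_coeff (\<lambda>z. F z + H z) (freq n)" for n
        unfolding sum fc[OF fg hc] add[OF hc] bohr_add[OF F H]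
        using \<Psi>(2)[OF F, of n] \<Psi>(2)[OF H, of n] by (simp add: f(4) g(4) fc[OF f(3) hc] fc[OF g(3) hc])
    qed
  next
    fix c F assume F: "F \<in> ?X"
    obtain f where f: "f \<in> borel_measurable m" "\<And>x. norm (f x) \<le> linf_norm m (\<Psi> F)" "f \<in> linf_fun m" "\<Psi> F = linf_rel m `` {f}"
      using rep[OF F] by blast
    note cf = linf_fun_scale[OF f(3), of c]
    have scale: "(\<integral>x. (c * f x) * cnj (\<gamma> x) \<partial>m) = c * (\<integral>x. f x * cnj (\<gamma> x) \<partial>m)" for \<gamma>
      by (simp add: mult.assoc)
    have sc: "linf_scale m c (\<Psi> F) = linf_rel m `` {\<lambda>x. c * f x}"
      unfolding f(4) by (rule linf_scale_class[OF f(3)])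
    show "\<Psi> (\<lambda>z. c * F z) = linf_scale m c (\<Psi> F)"
    proof (rule \<Psi>I)
      show "linf_scale m c (\<Psi> F) \<in> ?Y"
        unfolding sc Y_iff[OF cf] scale using \<Psi>(1)[OF F, unfolded f(4) Y_iff[OF f(3)]] by simp
      show "fourier_coeff m (linf_scale m c (\<Psi> F)) (h n) = bohr_coeff (\<lambda>z. c * F z) (freq n)" for n
        unfolding sc fc[OF cf hc] scale bohr_scale[OF F]
        using \<Psi>(2)[OF F, of n] by (simp add: f(4) fc[OF f(3) hc])
    qed
  next
    fix F assume F: "F \<in> ?X"
    show "linf_norm m (\<Psi> F) = half_plane_norm F" using \<Psi>(3)[OF F] norm_ge[OF F] by (rule antisym)
    show "bohr_coeff F (freq n) = fourier_coeff m (\<Psi> F) (freq_char \<beta> (freq n))" for n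
      using \<Psi>(2)[OF F, of n] by (simp add: h_def)
  qed
qed

end
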